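(* Let $\mathcal{M}$ be a countably decomposable, properly infinite von Neumann algebra with a faithful normal semifinite tracial weight $\tau$ and let $\mathcal{K}_\Phi(\mathcal{M},\tau)$ be a norm ideal of $(\mathcal{M},\tau)$. Assume that $$\lim_{\substack{\tau(e)\to\infty\\ e\in\mathcal{PF}(\mathcal{M},\tau)}}\frac{\Phi(e)}{\tau(e)}=0 .$$ Let $a\in\mathcal{M}$ be a self-adjoint element. Then for every $\epsilon>0$ there exists a diagonal operator $d$ in $\mathcal{M}$ such that: (i) $a-d\in\mathcal{K}^0_\Phi(\mathcal{M},\tau)$; (ii) $\Phi(a-d)\le\epsilon$.
   Context: A von Neumann algebra is countably decomposable if every orthogonal family of nonzero projections in it is countable. Set $\mathcal{PF}(\mathcal{M},\tau)=\{e: e=e^*=e^2\in\mathcal{M},\ \tau(e)<\infty\}$, $\mathcal{F}(\mathcal{M},\tau)=\{xey: e\in\mathcal{PF}(\mathcal{M},\tau),\ x,y\in\mathcal{M}\}$, and let $\mathcal{K}(\mathcal{M},\tau)$ be the operator-norm closure of $\mathcal{F}(\mathcal{M},\tau)$ in $\mathcal{M}$. A norm ideal $\mathcal{K}_\Phi(\mathcal{M},\tau)$ of $(\mathcal{M},\tau)$ is a two-sided ideal of $\mathcal{M}$ equipped with a norm $\Phi:\mathcal{K}_\Phi(\mathcal{M},\tau)\to[0,\infty)$ such that: (1) $\Phi(uxv)=\Phi(x)$ for all $x\in\mathcal{K}_\Phi(\mathcal{M},\tau)$ and all unitaries $u,v\in\mathcal{M}$; (2) there is $\lambda>0$ with $\Phi(x)\ge\lambda\|x\|$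 for all $x\in\mathcal{K}_\Phi(\mathcal{M},\tau)$; (3) $\mathcal{K}_\Phi(\mathcal{M},\tau)$ is a Banach space with respect to $\Phi$; (4) $\mathcal{F}(\mathcal{M},\tau)\subseteq\mathcal{K}_\Phi(\mathcal{M},\tau)\subseteq\mathcal{K}(\mathcal{M},\tau)$. $\mathcal{K}^0_\Phi(\mathcal{M},\tau)$ denotes the $\Phi$-norm closure of $\mathcal{F}(\mathcal{M},\tau)$ in $\mathcal{K}_\Phi(\mathcal{M},\tau)$. The limit condition means: for every $\eta>0$ there is $T>0$ such that $\Phi(e)/\tau(e)<\eta$ for all $e\in\mathcal{PF}(\mathcal{M},\tau)$ with $\tau(e)>T$. An operator $d\in\mathcal{M}$ is called diagonal if there exist a family $\{e_n\}_{n=1}^\infty$ of (mutually) orthogonal projections in $\mathcal{M}$ and a family $\{\lambda_n\}_{n=1}^\infty$ of complex numbers such that $d=\sum_{n=1}^\infty\lambda_n e_n$ (convergence in the strong operator topology). *)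

theory Defs
  imports "HOL-Analysis.Analysis"
begin

section \<open>Complex Hilbert spaces\<close>

text \<open>
  The inner product is complex linear in its first argument. Its real part is the real inner
  product of the class \<open>real_inner\<close>, so norm and topology are the usual ones and positive
  definiteness is inherited.
\<close>

class complex_inner = real_inner +
  fixes scaleC :: "complex \<Rightarrow> 'a \<Rightarrow> 'a" (infixr "*\<^sub>C" 75)
    and cinner :: "'a \<Rightarrow> 'a \<Rightarrow> complex"
  assumes scaleC_add_right: "c *\<^sub>C (x + y) = c *\<^sub>C x + c *\<^sub>C y"
    and scaleC_add_left: "(c + d) *\<^sub>C x = c *\<^sub>C x + d *\<^sub>C x"
    and scaleC_scaleC: "c *\<^sub>C d *\<^sub>C x = (c * d) *\<^sub>C x"
    and scaleR_scaleC: "r *\<^sub>R x = complex_of_real r *\<^sub>C x"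
    and cinner_commute: "cinner x y = cnj (cinner y x)"
    and cinner_add_left: "cinner (x + y) z = cinner x z + cinner y z"
    and cinner_scaleC_left: "cinner (c *\<^sub>C x) y = c * cinner x y"
    and Re_cinner: "Re (cinner x y) = inner x y"

class complex_hilbert = complex_inner + complete_space

lemma Im_cinner: "Im (cinner x y) = - inner (\<i> *\<^sub>C x) y"
  by (simp add: Re_cinner[symmetric] cinner_scaleC_left)

lemma cinner_scaleC_right: "cinner x (c *\<^sub>C y) = cnj c * cinner x y"
  by (metis cinner_commute cinner_scaleC_left complex_cnj_mult)

lemma norm_scaleC: "norm (c *\<^sub>C x) = cmod c * norm (x :: 'a :: complex_inner)"
proof -
  have "complex_of_real (norm (c *\<^sub>C x) ^ 2) = complex_of_real ((cmod c * norm x) ^ 2)"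
  proof (rule complex_eqI)
    have "inner (c *\<^sub>C x) (c *\<^sub>C x) = Re (c * cnj c * cinner x x)"
      by (simp only: Re_cinner[symmetric] cinner_scaleC_left cinner_scaleC_right ac_simps)
    also have "\<dots> = (cmod c)\<^sup>2 * inner x x"
      by (simp add: complex_norm_square[symmetric] Re_cinner)
    finally show "Re (complex_of_real (norm (c *\<^sub>C x) ^ 2))
        = Re (complex_of_real ((cmod c * norm x) ^ 2))"
      by (simp add: power2_norm_eq_inner power_mult_distrib)
  qed simp
  then have "norm (c *\<^sub>C x) ^ 2 = (cmod c * norm x) ^ 2"
    using of_real_eq_iff by blast
  then show ?thesis
    by (simp add: power2_eq_iff_nonneg)
qed

lemma bounded_linear_scaleC: "bounded_linear (\<lambda>x :: 'a :: complex_inner. c *\<^sub>C x)"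
proof (rule bounded_linear_intro)
  show "c *\<^sub>C (x + y) = c *\<^sub>C x + c *\<^sub>C y" for x y :: 'a
    by (rule scaleC_add_right)
  show "c *\<^sub>C (r *\<^sub>R x) = r *\<^sub>R (c *\<^sub>C x)" for r and x :: 'a
    by (simp add: scaleR_scaleC scaleC_scaleC mult.commute)
  show "norm (c *\<^sub>C x) \<le> norm x * cmod c" for x :: 'a
    by (simp add: norm_scaleC mult.commute)
qed

section \<open>Bounded operators\<close>

text \<open>
  The bounded operators on a complex Hilbert space are the complex linear elements of the library
  type of real-linear bounded operators; the operator norm is that of the library.
\<close>

type_synonym 'h operator = "'h \<Rightarrow>\<^sub>L 'h"

definition bounded_operators :: "'h::complex_hilbert operator set" where
  "bounded_operators = {T. \<forall>c x. blinfun_apply T (c *\<^sub>C x) = c *\<^sub>C blinfun_apply T x}"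

definition op_scaleC :: "complex \<Rightarrow> 'h::complex_hilbert operator \<Rightarrow> 'h operator" where
  "op_scaleC c T = Blinfun (\<lambda>x. c *\<^sub>C blinfun_apply T x)"

lemma op_scaleC_apply: "blinfun_apply (op_scaleC c T) x = c *\<^sub>C blinfun_apply T x"
  unfolding op_scaleC_def
  by (subst bounded_linear_Blinfun_apply)
    (auto intro: bounded_linear_compose[OF bounded_linear_scaleC blinfun.bounded_linear_right])

definition op_adjoint :: "'h::complex_hilbert operator \<Rightarrow> 'h operator" where
  "op_adjoint T =
    (THE S. \<forall>x y. cinner (blinfun_apply T x) y = cinner x (blinfun_apply S y))"

text \<open>The adjoint is well defined, by the Riesz representation theorem.\<close>

lemma riesz_representation:
  fixes f :: "'a::{real_inner, complete_space} \<Rightarrow> real"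
  assumes f: "bounded_linear f"
  shows "\<exists>w. \<forall>x. f x = inner x w"
proof -
  interpret bounded_linear f by (rule f)
  define g where "g x = (norm x)\<^sup>2 - 2 * f x" for x
  obtain B where B: "\<And>x. \<bar>f x\<bar> \<le> norm x * B"
    using bounded by auto
  have lower: "- B\<^sup>2 \<le> g x" for x
  proof -
    have "0 \<le> (norm x - B)\<^sup>2" by simp
    then show ?thesis
      using B[of x] by (simp add: g_def power2_diff)
  qed
  define c where "c = Inf (range g)"
  have bdd: "bdd_below (range g)"
    using lower by (intro bdd_belowI) auto
  have c_le: "c \<le> g x" for x
    unfolding c_def using bdd by (simp add: cINF_lower)
  have "\<exists>x. g x < c + inverse (real (Suc n))" for n
  proof -
    have "c < c + inverse (real (Suc n))" by simp
    then obtain y where "y \<in> range g" "y < c + inverse (real (Suc n))"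
      unfolding c_def using cInf_less_iff[OF _ bdd] by blast
    then show ?thesis by blast
  qed
  then obtain X where X: "\<And>n. g (X n) < c + inverse (real (Suc n))" by metis
  have par: "(norm (x - y))\<^sup>2 = 2 * g x + 2 * g y - 4 * g ((1/2) *\<^sub>R (x + y))" for x y
    by (simp add: g_def scaleR add power2_norm_eq_inner inner_simps inner_commute field_simps)
  have dist_le: "(norm (X m - X n))\<^sup>2 \<le> 2 * inverse (real (Suc m)) + 2 * inverse (real (Suc n))"
    for m n
    using par[of "X m" "X n"] c_le[of "(1/2) *\<^sub>R (X m + X n)"] X[of m] X[of n] by linarith
  have "Cauchy X"
  proof (rule metric_CauchyI)
    fix e :: real assume "e > 0"
    then obtain N where N: "inverse (real (Suc N)) < e\<^sup>2 / 4"
      using reals_Archimedean[of "e\<^sup>2 / 4"] by auto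
    have "dist (X m) (X n) < e" if "m \<ge> N" "n \<ge> N" for m n
    proof -
      have "inverse (real (Suc m)) \<le> inverse (real (Suc N))"
        "inverse (real (Suc n)) \<le> inverse (real (Suc N))"
        using that by (simp_all add: le_imp_inverse_le)
      then have "(norm (X m - X n))\<^sup>2 < e\<^sup>2"
        using dist_le[of m n] N by linarith
      then show ?thesis
        using \<open>e > 0\<close> by (simp add: dist_norm power2_less_imp_less)
    qed
    then show "\<exists>N. \<forall>m\<ge>N. \<forall>n\<ge>N. dist (X m) (X n) < e" by blast
  qed
  then obtain w where w: "X \<longlonglongrightarrow> w"
    using Cauchy_convergent_iff convergent_def by blast
  have "(\<lambda>n. g (X n)) \<longlonglongrightarrow> g w"
    unfolding g_def by (intro tendsto_intros w tendsto)
  moreover have "(\<lambda>n. c + inverse (real (Suc n))) \<longlonglongrightarrow> c + 0"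
    by (intro tendsto_intros LIMSEQ_inverse_real_of_nat)
  ultimately have "g w \<le> c + 0"
    by (rule LIMSEQ_le) (use X less_imp_le in blast)
  then have gw: "g w \<le> g y" for y
    using c_le[of y] by simp
  have "f x = inner x w" for x
  proof (cases "x = 0")
    case False
    define t where "t = (f x - inner x w) / inner x x"
    have pos: "inner x x > 0" using False by simp
    have "0 \<le> g (w + t *\<^sub>R x) - g w" using gw by simp
    also have "\<dots> = 2 * t * (inner x w - f x) + t\<^sup>2 * inner x x"
      by (simp add: g_def scaleR add power2_norm_eq_inner inner_simps inner_commute
          power2_eq_square[of t] algebra_simps)
    also have "\<dots> = - ((f x - inner x w)\<^sup>2 / inner x x)"
      using pos by (simp add: t_def power2_eq_square field_simps)
    finally have "(f x - inner x w)\<^sup>2 / inner x x \<le> 0" by simp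
    then show ?thesis
      using pos by (simp add: divide_le_0_iff)
  qed simp
  then show ?thesis by blast
qed

lemma op_adjoint_unique:
  assumes "\<forall>x y. cinner (blinfun_apply T x) y = cinner x (blinfun_apply S y)"
  shows "op_adjoint T = S"
  unfolding op_adjoint_def
proof (rule the_equality)
  show "\<forall>x y. cinner (blinfun_apply T x) y = cinner x (blinfun_apply S y)"
    by (rule assms)
next
  fix R
  assume "\<forall>x y. cinner (blinfun_apply T x) y = cinner x (blinfun_apply R y)"
  with assms have "inner x (blinfun_apply R y) = inner x (blinfun_apply S y)" for x y
    by (metis Re_cinner)
  then show "R = S"
    by (intro blinfun_eqI) (metis vector_eq_ldot)
qed

lemma cinner_op_adjoint:
  fixes T :: "'h::complex_hilbert operator"
  assumes T: "T \<in> bounded_operators"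
  shows "cinner (blinfun_apply T x) y = cinner x (blinfun_apply (op_adjoint T) y)"
proof -
  have "\<exists>w. \<forall>x. inner (blinfun_apply T x) y = inner x w" for y
    by (intro riesz_representation bounded_linear_compose[OF bounded_linear_inner_left]
        blinfun.bounded_linear_right)
  then obtain S where S: "\<And>x y. inner (blinfun_apply T x) y = inner x (S y)" by metis
  have "bounded_linear S"
  proof (rule bounded_linear_intro)
    show "S (x + y) = S x + S y" for x y
    proof -
      have "inner z (S (x + y)) = inner z (S x + S y)" for z
        by (simp add: S[symmetric] inner_add_right)
      then show ?thesis by (metis vector_eq_ldot)
    qed
    show "S (r *\<^sub>R x) = r *\<^sub>R S x" for r x
    proof -
      have "inner z (S (r *\<^sub>R x)) = inner z (r *\<^sub>R S x)" for z
        by (simp add: S[symmetric])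
      then show ?thesis by (metis vector_eq_ldot)
    qed
    show "norm (S x) \<le> norm x * norm T" for x
    proof (cases "S x = 0")
      case False
      have "norm (S x) * norm (S x) = inner (blinfun_apply T (S x)) x"
        by (simp add: S power2_norm_eq_inner[symmetric] power2_eq_square)
      also have "\<dots> \<le> norm (blinfun_apply T (S x)) * norm x"
        by (rule norm_cauchy_schwarz)
      also have "\<dots> \<le> norm T * norm (S x) * norm x"
        by (intro mult_right_mono norm_blinfun) simp
      finally have "norm (S x) * norm (S x) \<le> (norm x * norm T) * norm (S x)"
        by (simp add: algebra_simps)
      with False show ?thesis by simp
    qed simp
  qed
  then have app: "blinfun_apply (Blinfun S) = S"
    by (rule bounded_linear_Blinfun_apply)
  have "cinner (blinfun_apply T x) y = cinner x (S y)" for x y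
  proof (rule complex_eqI)
    show "Re (cinner (blinfun_apply T x) y) = Re (cinner x (S y))"
      by (simp add: Re_cinner S)
    have "\<i> *\<^sub>C blinfun_apply T x = blinfun_apply T (\<i> *\<^sub>C x)"
      using T by (simp add: bounded_operators_def)
    then show "Im (cinner (blinfun_apply T x) y) = Im (cinner x (S y))"
      by (simp add: Im_cinner S)
  qed
  then have "op_adjoint T = Blinfun S"
    and "cinner (blinfun_apply T x) y = cinner x (S y)"
    by (auto intro!: op_adjoint_unique simp: app)
  then show ?thesis by (simp add: app)
qed

definition self_adjoint :: "'h::complex_hilbert operator \<Rightarrow> bool" where
  "self_adjoint T \<longleftrightarrow> T \<in> bounded_operators \<and> op_adjoint T = T"

definition positive_operator :: "'h::complex_hilbert operator \<Rightarrow> bool" where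
  "positive_operator T \<longleftrightarrow>
    self_adjoint T \<and> (\<forall>x. 0 \<le> Re (cinner (blinfun_apply T x) x))"

definition op_le :: "'h::complex_hilbert operator \<Rightarrow> 'h operator \<Rightarrow> bool" where
  "op_le S T \<longleftrightarrow> positive_operator (T - S)"

section \<open>Von Neumann algebras\<close>

definition commutant :: "'h::complex_hilbert operator set \<Rightarrow> 'h operator set" where
  "commutant N = {T \<in> bounded_operators. \<forall>S\<in>N. T o\<^sub>L S = S o\<^sub>L T}"

definition star_subalgebra :: "'h::complex_hilbert operator set \<Rightarrow> bool" where
  "star_subalgebra M \<longleftrightarrow>
    M \<subseteq> bounded_operators \<and> 0 \<in> M \<and>
    (\<forall>S\<in>M. \<forall>T\<in>M. S + T \<in> M \<and> S o\<^sub>L T \<in> M) \<and>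
    (\<forall>c. \<forall>T\<in>M. op_scaleC c T \<in> M) \<and>
    (\<forall>T\<in>M. op_adjoint T \<in> M)"

definition von_neumann_algebra :: "'h::complex_hilbert operator set \<Rightarrow> bool" where
  "von_neumann_algebra M \<longleftrightarrow> star_subalgebra M \<and> commutant (commutant M) = M"

definition projections :: "'h::complex_hilbert operator set \<Rightarrow> 'h operator set" where
  "projections M = {e \<in> M. self_adjoint e \<and> e o\<^sub>L e = e}"

definition unitaries :: "'h::complex_hilbert operator set \<Rightarrow> 'h operator set" where
  "unitaries M =
    {u \<in> M. op_adjoint u o\<^sub>L u = id_blinfun \<and> u o\<^sub>L op_adjoint u = id_blinfun}"

definition countably_decomposable :: "'h::complex_hilbert operator set \<Rightarrow> bool" where
  "countably_decomposable M \<longleftrightarrow>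
    (\<forall>P \<subseteq> projections M - {0}. pairwise (\<lambda>e f. e o\<^sub>L f = 0) P \<longrightarrow> countable P)"

text \<open>Murray-von Neumann equivalence, and finiteness of a projection relative to the algebra.\<close>

definition mvn_equiv ::
    "'h::complex_hilbert operator set \<Rightarrow> 'h operator \<Rightarrow> 'h operator \<Rightarrow> bool" where
  "mvn_equiv M p q \<longleftrightarrow> (\<exists>v\<in>M. op_adjoint v o\<^sub>L v = p \<and> v o\<^sub>L op_adjoint v = q)"

definition finite_projection :: "'h::complex_hilbert operator set \<Rightarrow> 'h operator \<Rightarrow> bool" where
  "finite_projection M p \<longleftrightarrow>
    p \<in> projections M \<and>
    (\<forall>q\<in>projections M. op_le q p \<and> mvn_equiv M p q \<longrightarrow> q = p)"

definition properly_infinite :: "'h::complex_hilbert operator set \<Rightarrow> bool" where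
  "properly_infinite M \<longleftrightarrow>
    (\<forall>p \<in> projections M \<inter> commutant M. p \<noteq> 0 \<longrightarrow> \<not> finite_projection M p)"

section \<open>Tracial weights\<close>

text \<open>
  A weight is a function on the positive cone; here it is a function on all operators whose values
  outside the cone are irrelevant. In \<open>ennreal\<close>, zero times infinity is zero.
\<close>

definition positive_cone :: "'h::complex_hilbert operator set \<Rightarrow> 'h operator set" where
  "positive_cone M = {x \<in> M. positive_operator x}"

definition weight ::
    "'h::complex_hilbert operator set \<Rightarrow> ('h operator \<Rightarrow> ennreal) \<Rightarrow> bool" where
  "weight M \<tau> \<longleftrightarrow>
    (\<forall>x\<in>positive_cone M. \<forall>y\<in>positive_cone M. \<tau> (x + y) = \<tau> x + \<tau> y) \<and>
    (\<forall>x\<in>positive_cone M. \<forall>r\<ge>0. \<tau> (r *\<^sub>R x) = ennreal r * \<tau> x)"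

definition tracial ::
    "'h::complex_hilbert operator set \<Rightarrow> ('h operator \<Rightarrow> ennreal) \<Rightarrow> bool" where
  "tracial M \<tau> \<longleftrightarrow> (\<forall>x\<in>M. \<tau> (op_adjoint x o\<^sub>L x) = \<tau> (x o\<^sub>L op_adjoint x))"

definition faithful ::
    "'h::complex_hilbert operator set \<Rightarrow> ('h operator \<Rightarrow> ennreal) \<Rightarrow> bool" where
  "faithful M \<tau> \<longleftrightarrow> (\<forall>x\<in>positive_cone M. \<tau> x = 0 \<longrightarrow> x = 0)"

text \<open>
  Normality: \<open>\<tau>\<close> preserves suprema of bounded increasing nets of positive elements. A net is
  replaced by its range, an upward directed set \<open>D\<close>; \<open>x\<close> is its least upper bound.
\<close>

definition normal_weight ::
    "'h::complex_hilbert operator set \<Rightarrow> ('h operator \<Rightarrow> ennreal) \<Rightarrow> bool" where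
  "normal_weight M \<tau> \<longleftrightarrow>
    (\<forall>D x. D \<subseteq> positive_cone M \<and> D \<noteq> {} \<and>
       (\<forall>y\<in>D. \<forall>z\<in>D. \<exists>w\<in>D. op_le y w \<and> op_le z w) \<and>
       x \<in> positive_cone M \<and> (\<forall>y\<in>D. op_le y x) \<and>
       (\<forall>z\<in>M. self_adjoint z \<and> (\<forall>y\<in>D. op_le y z) \<longrightarrow> op_le x z)
       \<longrightarrow> \<tau> x = (SUP y\<in>D. \<tau> y))"

definition semifinite ::
    "'h::complex_hilbert operator set \<Rightarrow> ('h operator \<Rightarrow> ennreal) \<Rightarrow> bool" where
  "semifinite M \<tau> \<longleftrightarrow>
    (\<forall>x\<in>positive_cone M. x \<noteq> 0 \<longrightarrow>
      (\<exists>y\<in>positive_cone M. y \<noteq> 0 \<and> op_le y x \<and> \<tau> y < \<infinity>))"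

definition faithful_normal_semifinite_tracial_weight ::
    "'h::complex_hilbert operator set \<Rightarrow> ('h operator \<Rightarrow> ennreal) \<Rightarrow> bool" where
  "faithful_normal_semifinite_tracial_weight M \<tau> \<longleftrightarrow>
    weight M \<tau> \<and> tracial M \<tau> \<and> faithful M \<tau> \<and> normal_weight M \<tau> \<and> semifinite M \<tau>"

section \<open>Norm ideals\<close>

definition PF ::
    "'h::complex_hilbert operator set \<Rightarrow> ('h operator \<Rightarrow> ennreal) \<Rightarrow> 'h operator set" where
  "PF M \<tau> = {e \<in> projections M. \<tau> e < \<infinity>}"

definition FI ::
    "'h::complex_hilbert operator set \<Rightarrow> ('h operator \<Rightarrow> ennreal) \<Rightarrow> 'h operator set" where
  "FI M \<tau> = {x o\<^sub>L e o\<^sub>L y | x e y. e \<in> PF M \<tau> \<and> x \<in> M \<and> y \<in> M}"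

definition KI ::
    "'h::complex_hilbert operator set \<Rightarrow> ('h operator \<Rightarrow> ennreal) \<Rightarrow> 'h operator set" where
  "KI M \<tau> = M \<inter> closure (FI M \<tau>)"

definition two_sided_ideal ::
    "'h::complex_hilbert operator set \<Rightarrow> 'h operator set \<Rightarrow> bool" where
  "two_sided_ideal M J \<longleftrightarrow>
    J \<subseteq> M \<and> 0 \<in> J \<and>
    (\<forall>x\<in>J. \<forall>y\<in>J. x + y \<in> J) \<and>
    (\<forall>c. \<forall>x\<in>J. op_scaleC c x \<in> J) \<and>
    (\<forall>m\<in>M. \<forall>x\<in>J. m o\<^sub>L x \<in> J \<and> x o\<^sub>L m \<in> J)"

definition is_norm_on ::
    "'h::complex_hilbert operator set \<Rightarrow> ('h operator \<Rightarrow> real) \<Rightarrow> bool" where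
  "is_norm_on J \<Phi> \<longleftrightarrow>
    (\<forall>x\<in>J. 0 \<le> \<Phi> x \<and> (\<Phi> x = 0 \<longleftrightarrow> x = 0)) \<and>
    (\<forall>c. \<forall>x\<in>J. \<Phi> (op_scaleC c x) = cmod c * \<Phi> x) \<and>
    (\<forall>x\<in>J. \<forall>y\<in>J. \<Phi> (x + y) \<le> \<Phi> x + \<Phi> y)"

definition complete_wrt ::
    "'h::complex_hilbert operator set \<Rightarrow> ('h operator \<Rightarrow> real) \<Rightarrow> bool" where
  "complete_wrt J \<Phi> \<longleftrightarrow>
    (\<forall>X :: nat \<Rightarrow> 'h operator. range X \<subseteq> J \<and>
       (\<forall>\<epsilon>>0. \<exists>N. \<forall>m\<ge>N. \<forall>n\<ge>N. \<Phi> (X m - X n) < \<epsilon>)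
       \<longrightarrow> (\<exists>x\<in>J. (\<lambda>n. \<Phi> (X n - x)) \<longlonglongrightarrow> 0))"

text \<open>Only the values of \<open>\<Phi>\<close> on \<open>J\<close> are constrained.\<close>

definition norm_ideal ::
    "'h::complex_hilbert operator set \<Rightarrow> ('h operator \<Rightarrow> ennreal) \<Rightarrow>
      'h operator set \<Rightarrow> ('h operator \<Rightarrow> real) \<Rightarrow> bool" where
  "norm_ideal M \<tau> J \<Phi> \<longleftrightarrow>
    two_sided_ideal M J \<and> is_norm_on J \<Phi> \<and>
    (\<forall>x\<in>J. \<forall>u\<in>unitaries M. \<forall>v\<in>unitaries M. \<Phi> (u o\<^sub>L x o\<^sub>L v) = \<Phi> x) \<and>
    (\<exists>c>0. \<forall>x\<in>J. \<Phi> x \<ge> c * norm x) \<and>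
    complete_wrt J \<Phi> \<and>
    FI M \<tau> \<subseteq> J \<and> J \<subseteq> KI M \<tau>"

text \<open>The closure of \<open>FI M \<tau>\<close> in \<open>J\<close> with respect to the norm \<open>\<Phi>\<close>.\<close>

definition norm_ideal_closure ::
    "'h::complex_hilbert operator set \<Rightarrow> ('h operator \<Rightarrow> ennreal) \<Rightarrow>
      'h operator set \<Rightarrow> ('h operator \<Rightarrow> real) \<Rightarrow> 'h operator set" where
  "norm_ideal_closure M \<tau> J \<Phi> = {x \<in> J. \<forall>\<epsilon>>0. \<exists>f\<in>FI M \<tau>. \<Phi> (x - f) < \<epsilon>}"

definition ratio_tends_to_zero ::
    "'h::complex_hilbert operator set \<Rightarrow> ('h operator \<Rightarrow> ennreal) \<Rightarrow>
      ('h operator \<Rightarrow> real) \<Rightarrow> bool" where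
  "ratio_tends_to_zero M \<tau> \<Phi> \<longleftrightarrow>
    (\<forall>\<eta>>0. \<exists>T>0. \<forall>e\<in>PF M \<tau>. enn2real (\<tau> e) > T \<longrightarrow> \<Phi> e / enn2real (\<tau> e) < \<eta>)"

text \<open>The series converges in the strong operator topology, that is, pointwise.\<close>

definition diagonal_operator ::
    "'h::complex_hilbert operator set \<Rightarrow> 'h operator \<Rightarrow> bool" where
  "diagonal_operator M d \<longleftrightarrow>
    d \<in> M \<and>
    (\<exists>(e :: nat \<Rightarrow> 'h operator) (l :: nat \<Rightarrow> complex).
       (\<forall>n. e n \<in> projections M) \<and>
       (\<forall>m n. m \<noteq> n \<longrightarrow> e m o\<^sub>L e n = 0) \<and>
       (\<forall>x. (\<lambda>n. l n *\<^sub>C blinfun_apply (e n) x) sums blinfun_apply d x))"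

end

theory Submission
  imports Defs
begin

text \<open>
  Cut the spectrum of \<open>a\<close> into \<open>n = 2\<^sup>m\<close> pieces of length \<open>O(1/n)\<close>, with spectral projections
  \<open>E\<^sub>j\<close>. For \<open>e\<close> of finite trace let \<open>P\<close> be the sum of the range projections of the \<open>E\<^sub>j e\<close>.
  Then \<open>P \<ge> e\<close>, \<open>\<tau>(P) \<le> n \<tau>(e)\<close>, and \<open>a\<close> differs from (a diagonal operator on \<open>P\<close>) \<open>\<oplus>\<close>
  \<open>(1 - P) a (1 - P)\<close> by operators \<open>R P\<close>, \<open>P R\<close>, \<open>P R P\<close> with \<open>\<parallel>R\<parallel> = O(1/n)\<close>. Their \<open>\<Phi>\<close>-norm
  is \<open>O(\<Phi>(P)/n)\<close>, which tends to \<open>0\<close> since \<open>\<Phi>(P) = o(n)\<close> by the limit condition. Proper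
  infiniteness enters only through \<open>\<tau>(1) = \<infinity>\<close>. Repeating this in the corner of \<open>1 - P\<close>, along a
  sequence of projections of finite trace that exhausts \<open>1\<close> and with summable errors, leaves a
  diagonal operator.
\<close>

section \<open>Operators and adjoints\<close>

text \<open>A projection of finite trace rarely commutes with \<open>a\<close>, and its commutator
  has no reason to be small in \<Phi>. Cutting \<open>e\<close> along the spectral pieces repairs
  this: the resulting P commutes with every E_j, hence with the step function built from them, and
  only the error R of the step function fails to respect P. The price is the trace: halving R
  doubles the bound on \<tau>(P), so a \<Phi> that grows linearly in the trace, as the trace norm
  does, would gain nothing from refinement. Sublinear growth is what breaks the tie. The spectral
  pieces arise by repeated bisection according to the sign of the current error, which is why their
  number is a power of two. Square roots, strong limits of powers and the double commutant property
  supply these signs inside the algebra; the same powers, taken of a defect operator, also yield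
  range projections together with their trace bound.\<close>

lemma cinner_add_right: "cinner x (y + z) = cinner x y + cinner x (z :: 'a :: complex_inner)"
  by (metis cinner_add_left cinner_commute complex_cnj_add)

lemma scaleC_zero_right [simp]: "c *\<^sub>C (0 :: 'a :: complex_inner) = 0"
  using scaleC_add_right[of c 0 0] by simp

lemma scaleC_minus_right: "c *\<^sub>C (- x) = - (c *\<^sub>C x :: 'a :: complex_inner)"
  by (metis add.right_inverse minus_unique scaleC_add_right scaleC_zero_right)

lemma scaleC_diff_right: "c *\<^sub>C (x - y) = c *\<^sub>C x - c *\<^sub>C (y :: 'a :: complex_inner)"
  by (metis (no_types) diff_conv_add_uminus scaleC_add_right scaleC_minus_right)

lemma cinner_scaleR_left: "cinner (r *\<^sub>R x) y = of_real r * cinner x y"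
  by (simp add: scaleR_scaleC cinner_scaleC_left)

lemma cinner_scaleR_right: "cinner x (r *\<^sub>R y) = of_real r * cinner x y"
  by (simp add: scaleR_scaleC cinner_scaleC_right)

lemma cinner_minus_left: "cinner (- x) y = - cinner x y"
  using cinner_scaleR_left[of "-1" x y] by simp

lemma cinner_minus_right: "cinner x (- y) = - cinner x y"
  using cinner_scaleR_right[of x "-1" y] by simp

lemma cinner_diff_left: "cinner (x - y) z = cinner x z - cinner y z"
  using cinner_add_left[of x "- y" z] by (simp add: cinner_minus_left)

lemma cinner_diff_right: "cinner x (y - z) = cinner x y - cinner x z"
  using cinner_add_right[of x y "- z"] by (simp add: cinner_minus_right)

lemma cinner_zero_left [simp]: "cinner 0 y = 0"
  using cinner_scaleR_left[of 0 0 y] by simp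

lemma cinner_zero_right [simp]: "cinner x 0 = 0"
  using cinner_scaleR_right[of x 0 0] by simp

lemmas cinner_simps = cinner_add_left cinner_add_right cinner_diff_left cinner_diff_right
  cinner_minus_left cinner_minus_right cinner_scaleR_left cinner_scaleR_right
  cinner_scaleC_left cinner_scaleC_right

lemma cinner_ext_left: "(\<And>x. cinner y x = cinner z x) \<Longrightarrow> y = z"
  by (metis Re_cinner vector_eq_rdot)

section \<open>Ring operations, complex scalars and complex linearity\<close>

lemmas op_add_left = bounded_bilinear.add_left[OF bounded_bilinear_blinfun_compose]
lemmas op_add_right = bounded_bilinear.add_right[OF bounded_bilinear_blinfun_compose]
lemmas op_diff_left = bounded_bilinear.diff_left[OF bounded_bilinear_blinfun_compose]
lemmas op_diff_right = bounded_bilinear.diff_right[OF bounded_bilinear_blinfun_compose]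
lemmas op_minus_left = bounded_bilinear.minus_left[OF bounded_bilinear_blinfun_compose]
lemmas op_minus_right = bounded_bilinear.minus_right[OF bounded_bilinear_blinfun_compose]
lemmas op_scaleR_left = bounded_bilinear.scaleR_left[OF bounded_bilinear_blinfun_compose]
lemmas op_scaleR_right = bounded_bilinear.scaleR_right[OF bounded_bilinear_blinfun_compose]
lemmas op_sum_left = bounded_bilinear.sum_left[OF bounded_bilinear_blinfun_compose]
lemmas op_sum_right = bounded_bilinear.sum_right[OF bounded_bilinear_blinfun_compose]

lemma op_assoc: "(R o\<^sub>L S) o\<^sub>L T = R o\<^sub>L (S o\<^sub>L T)"
  by (intro blinfun_eqI) simp

lemma op_id_left [simp]: "id_blinfun o\<^sub>L T = T" and op_id_right [simp]: "T o\<^sub>L id_blinfun = T"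
  by (intro blinfun_eqI; simp)+

lemmas op_ring = op_add_left op_add_right op_diff_left op_diff_right op_minus_left op_minus_right
  op_assoc

lemma bounded_operatorsD: "T \<in> bounded_operators \<Longrightarrow> T (c *\<^sub>C x) = c *\<^sub>C T x"
  by (simp add: bounded_operators_def)

lemma bounded_operators_compose [intro, simp]:
  "S \<in> bounded_operators \<Longrightarrow> T \<in> bounded_operators \<Longrightarrow> S o\<^sub>L T \<in> bounded_operators"
  by (simp add: bounded_operators_def)

lemma bounded_operators_add [intro, simp]:
  "S \<in> bounded_operators \<Longrightarrow> T \<in> bounded_operators \<Longrightarrow> S + T \<in> bounded_operators"
  by (simp add: bounded_operators_def blinfun.add_left scaleC_add_right)

lemma bounded_operators_diff [intro, simp]:
  "S \<in> bounded_operators \<Longrightarrow> T \<in> bounded_operators \<Longrightarrow> S - T \<in> bounded_operators"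
  by (simp add: bounded_operators_def blinfun.diff_left scaleC_diff_right)

lemma scaleR_scaleC_commute: "r *\<^sub>R c *\<^sub>C x = c *\<^sub>C r *\<^sub>R (x :: 'a :: complex_inner)"
  by (simp add: scaleR_scaleC scaleC_scaleC mult.commute)

lemma bounded_operators_scaleR [intro, simp]:
  "T \<in> bounded_operators \<Longrightarrow> r *\<^sub>R T \<in> bounded_operators"
  by (simp add: bounded_operators_def blinfun.scaleR_left scaleR_scaleC_commute)

lemma bounded_operators_scaleC [intro, simp]:
  "T \<in> bounded_operators \<Longrightarrow> op_scaleC c T \<in> bounded_operators"
  by (simp add: bounded_operators_def op_scaleC_apply scaleC_scaleC mult.commute)

lemma bounded_operators_0 [intro, simp]: "0 \<in> bounded_operators"
  and bounded_operators_id [intro, simp]: "id_blinfun \<in> bounded_operators"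
  by (simp_all add: bounded_operators_def)

lemma op_scaleC_of_real: "op_scaleC (of_real r) T = r *\<^sub>R T"
  by (intro blinfun_eqI) (simp add: op_scaleC_apply blinfun.scaleR_left scaleR_scaleC)

lemma op_scaleC_scaleC: "op_scaleC c (op_scaleC d T) = op_scaleC (c * d) T"
  by (intro blinfun_eqI) (simp add: op_scaleC_apply scaleC_scaleC)

lemma op_scaleC_left: "op_scaleC c S o\<^sub>L T = op_scaleC c (S o\<^sub>L T)"
  by (intro blinfun_eqI) (simp add: op_scaleC_apply)

lemma op_scaleC_right: "S \<in> bounded_operators \<Longrightarrow> S o\<^sub>L op_scaleC c T = op_scaleC c (S o\<^sub>L T)"
  by (intro blinfun_eqI) (simp add: op_scaleC_apply bounded_operatorsD)

lemma norm_op_scaleC_le: "norm (op_scaleC c T) \<le> cmod c * norm T"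
proof (rule norm_blinfun_bound)
  fix x
  have "norm (T x) \<le> norm T * norm x" by (rule norm_blinfun)
  then show "norm (op_scaleC c T x) \<le> cmod c * norm T * norm x"
    by (simp add: op_scaleC_apply norm_scaleC mult.assoc mult_left_mono)
qed simp

section \<open>Adjoints\<close>

lemma op_adjointI:
  fixes S T :: "'h::complex_hilbert operator"
  assumes "\<And>x y. cinner (T x) y = cinner x (S y)"
  shows "op_adjoint T = S"
  using assms by (intro op_adjoint_unique) blast

lemma cinner_op_adjoint_left:
  assumes "T \<in> bounded_operators"
  shows "cinner (op_adjoint T x) y = cinner x (T y)"
  by (metis assms cinner_commute cinner_op_adjoint)

lemma op_adjoint_bounded_operators [intro, simp]:
  assumes "T \<in> bounded_operators"
  shows "op_adjoint T \<in> bounded_operators"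
  unfolding bounded_operators_def
proof (intro CollectI allI)
  fix c x
  show "op_adjoint T (c *\<^sub>C x) = c *\<^sub>C op_adjoint T x"
    by (rule cinner_ext_left) (simp add: cinner_op_adjoint_left assms cinner_scaleC_left)
qed

lemma op_adjoint_op_adjoint [simp]:
  "T \<in> bounded_operators \<Longrightarrow> op_adjoint (op_adjoint T) = T"
  by (intro op_adjointI) (rule cinner_op_adjoint_left)

lemma op_adjoint_compose:
  assumes "S \<in> bounded_operators" "T \<in> bounded_operators"
  shows "op_adjoint (S o\<^sub>L T) = op_adjoint T o\<^sub>L op_adjoint S"
  by (intro op_adjointI) (simp add: cinner_op_adjoint assms)

lemma op_adjoint_add:
  assumes "S \<in> bounded_operators" "T \<in> bounded_operators"
  shows "op_adjoint (S + T) = op_adjoint S + op_adjoint T"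
  by (intro op_adjointI) (simp add: cinner_op_adjoint assms blinfun.add_left cinner_simps)

lemma op_adjoint_diff:
  assumes "S \<in> bounded_operators" "T \<in> bounded_operators"
  shows "op_adjoint (S - T) = op_adjoint S - op_adjoint T"
  by (intro op_adjointI) (simp add: cinner_op_adjoint assms blinfun.diff_left cinner_simps)

lemma op_adjoint_scaleR:
  assumes "T \<in> bounded_operators"
  shows "op_adjoint (r *\<^sub>R T) = r *\<^sub>R op_adjoint T"
  by (intro op_adjointI) (simp add: cinner_op_adjoint assms blinfun.scaleR_left cinner_simps)

lemma op_adjoint_scaleC:
  assumes "T \<in> bounded_operators"
  shows "op_adjoint (op_scaleC c T) = op_scaleC (cnj c) (op_adjoint T)"
  by (intro op_adjointI) (simp add: cinner_op_adjoint assms op_scaleC_apply cinner_simps)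

lemma op_adjoint_id [simp]: "op_adjoint id_blinfun = id_blinfun"
  and op_adjoint_0 [simp]: "op_adjoint 0 = 0"
  by (intro op_adjointI; simp)+

lemma norm_op_adjoint_le:
  fixes T :: "'h::complex_hilbert operator"
  assumes T: "T \<in> bounded_operators"
  shows "norm (op_adjoint T) \<le> norm T"
proof (rule norm_blinfun_bound)
  fix y
  let ?z = "op_adjoint T y"
  have "norm ?z * norm ?z = inner (T ?z) y"
    by (metis Re_cinner T cinner_op_adjoint dot_square_norm power2_eq_square)
  also have "\<dots> \<le> norm (T ?z) * norm y"
    by (rule norm_cauchy_schwarz)
  also have "\<dots> \<le> norm T * norm ?z * norm y"
    by (intro mult_right_mono norm_blinfun) simp
  finally have "norm ?z * norm ?z \<le> (norm T * norm y) * norm ?z"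
    by (simp add: ac_simps)
  then show "norm ?z \<le> norm T * norm y"
    by (cases "norm ?z = 0") (simp_all add: mult_le_cancel_right)
qed simp

section \<open>Self-adjoint and positive operators\<close>

lemma self_adjoint_bounded [dest]: "self_adjoint T \<Longrightarrow> T \<in> bounded_operators"
  by (simp add: self_adjoint_def)

lemma self_adjoint_cinner: "self_adjoint T \<Longrightarrow> cinner (T x) y = cinner x (T y)"
  by (metis self_adjoint_def cinner_op_adjoint)

lemma self_adjoint_inner: "self_adjoint T \<Longrightarrow> inner (T x) y = inner x (T y)"
  by (metis self_adjoint_cinner Re_cinner)

lemma self_adjoint_add [intro]: "self_adjoint S \<Longrightarrow> self_adjoint T \<Longrightarrow> self_adjoint (S + T)"
  by (simp add: self_adjoint_def op_adjoint_add)

lemma self_adjoint_diff [intro]: "self_adjoint S \<Longrightarrow> self_adjoint T \<Longrightarrow> self_adjoint (S - T)"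
  by (simp add: self_adjoint_def op_adjoint_diff)

lemma self_adjoint_scaleR [intro]: "self_adjoint T \<Longrightarrow> self_adjoint (r *\<^sub>R T)"
  by (simp add: self_adjoint_def op_adjoint_scaleR)

lemma self_adjoint_0 [intro, simp]: "self_adjoint 0"
  and self_adjoint_id [intro, simp]: "self_adjoint id_blinfun"
  by (simp_all add: self_adjoint_def)

lemma self_adjoint_sum: "(\<And>i. i \<in> A \<Longrightarrow> self_adjoint (f i)) \<Longrightarrow> self_adjoint (\<Sum>i\<in>A. f i)"
  by (induction A rule: infinite_finite_induct) auto

lemma self_adjoint_compose:
  "self_adjoint S \<Longrightarrow> self_adjoint T \<Longrightarrow> S o\<^sub>L T = T o\<^sub>L S \<Longrightarrow> self_adjoint (S o\<^sub>L T)"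
  by (simp add: self_adjoint_def op_adjoint_compose)

lemma self_adjoint_sandwich:
  "self_adjoint S \<Longrightarrow> T \<in> bounded_operators \<Longrightarrow> self_adjoint (op_adjoint T o\<^sub>L S o\<^sub>L T)"
  by (simp add: self_adjoint_def op_adjoint_compose op_assoc)

lemma self_adjoint_square: "self_adjoint T \<Longrightarrow> self_adjoint (T o\<^sub>L T)"
  by (simp add: self_adjoint_compose)

lemma positive_operator_iff:
  "positive_operator T \<longleftrightarrow> self_adjoint T \<and> (\<forall>x. 0 \<le> inner (T x) x)"
  by (simp add: positive_operator_def Re_cinner)

lemma positive_operator_adjoint_compose:
  assumes "T \<in> bounded_operators"
  shows "positive_operator (op_adjoint T o\<^sub>L T)"
  unfolding positive_operator_def
proof (intro conjI allI)
  show "self_adjoint (op_adjoint T o\<^sub>L T)"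
    using assms by (simp add: self_adjoint_def op_adjoint_compose)
  show "0 \<le> Re (cinner ((op_adjoint T o\<^sub>L T) x) x)" for x
    using assms by (simp add: cinner_op_adjoint_left Re_cinner)
qed

lemma positive_operator_add:
  "positive_operator S \<Longrightarrow> positive_operator T \<Longrightarrow> positive_operator (S + T)"
  by (auto simp: positive_operator_iff blinfun.add_left inner_add_left)

lemma positive_operator_scaleR: "positive_operator T \<Longrightarrow> 0 \<le> r \<Longrightarrow> positive_operator (r *\<^sub>R T)"
  by (auto simp: positive_operator_iff blinfun.scaleR_left)

lemma positive_operator_0 [simp]: "positive_operator 0"
  by (simp add: positive_operator_iff)

text \<open>Cauchy--Schwarz for the semi-inner product \<open>\<langle>T x, y\<rangle>\<close>, taken at \<open>y = T x\<close>.\<close>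

lemma positive_operator_norm_le:
  assumes T: "positive_operator T" and r: "norm T \<le> r"
  shows "(norm (T x))\<^sup>2 \<le> r * inner (T x) x"
proof -
  have sa: "self_adjoint T" and pos: "\<And>z. 0 \<le> inner (T z) z"
    using T by (auto simp: positive_operator_iff)
  let ?y = "T x"
  show ?thesis
  proof (cases "r = 0")
    case True
    then show ?thesis using r by simp
  next
    case False
    then have "r > 0" using r norm_ge_zero[of T] by linarith
    \<comment> \<open>Positivity at \<open>x - t T x\<close>. Once \<open>inner (T ?y) ?y\<close> is
      bounded by \<open>r\<close> times the square of \<open>norm ?y\<close>, the quadratic in
      \<open>t\<close> is smallest at \<open>t = 1/r\<close>.\<close>
    have q: "0 \<le> inner (T x) x - 2 * t * (norm ?y)\<^sup>2 + t\<^sup>2 * inner (T ?y) ?y" for t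
    proof -
      have "0 \<le> inner (T (x - t *\<^sub>R ?y)) (x - t *\<^sub>R ?y)" by (rule pos)
      also have "\<dots> = inner (T x) x - 2 * t * inner (T x) ?y + t\<^sup>2 * inner (T ?y) ?y"
        using self_adjoint_inner[OF sa, of ?y x]
        by (simp add: blinfun.diff_right blinfun.scaleR_right inner_simps inner_commute
            power2_eq_square algebra_simps)
      finally show ?thesis by (simp add: power2_norm_eq_inner)
    qed
    have "inner (T ?y) ?y \<le> norm (T ?y) * norm ?y" by (rule norm_cauchy_schwarz)
    also have "\<dots> \<le> (r * norm ?y) * norm ?y"
      by (intro mult_right_mono) (meson norm_blinfun order.trans mult_right_mono norm_ge_zero r, simp)
    finally have "inner (T ?y) ?y \<le> r * (norm ?y)\<^sup>2" by (simp add: power2_eq_square)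
    then have "(1/r)\<^sup>2 * inner (T ?y) ?y \<le> (1/r)\<^sup>2 * (r * (norm ?y)\<^sup>2)"
      by (intro mult_left_mono) auto
    also have "\<dots> = (1/r) * (norm ?y)\<^sup>2" using \<open>r > 0\<close> by (simp add: power2_eq_square)
    finally have "0 \<le> inner (T x) x - (1/r) * (norm ?y)\<^sup>2"
      using q[of "1/r"] by simp
    then show ?thesis using \<open>r > 0\<close> by (simp add: field_simps)
  qed
qed

lemma blinfun_contraction: "norm (T :: _ \<Rightarrow>\<^sub>L _) \<le> 1 \<Longrightarrow> norm (T x) \<le> norm x"
  by (metis mult_left_le_one_le norm_blinfun norm_ge_zero order_trans)

lemma norm_op_compose_le_one: "norm S \<le> 1 \<Longrightarrow> norm T \<le> 1 \<Longrightarrow> norm (S o\<^sub>L T) \<le> 1"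
  by (meson mult_le_one norm_blinfun_compose norm_ge_zero order_trans)

section \<open>Powers of an operator\<close>

primrec op_power :: "'h::complex_hilbert operator \<Rightarrow> nat \<Rightarrow> 'h operator" where
  "op_power T 0 = id_blinfun"
| "op_power T (Suc n) = T o\<^sub>L op_power T n"

lemma op_power_commute: "S o\<^sub>L T = T o\<^sub>L S \<Longrightarrow> S o\<^sub>L op_power T n = op_power T n o\<^sub>L S"
  by (induction n) (simp_all, metis op_assoc)

lemma op_power_add: "op_power T (m + n) = op_power T m o\<^sub>L op_power T n"
  by (induction m) (simp_all add: op_assoc)

lemma self_adjoint_op_power: "self_adjoint T \<Longrightarrow> self_adjoint (op_power T n)"
  by (induction n) (auto intro!: self_adjoint_compose op_power_commute)

lemma norm_op_power_le_one: "norm T \<le> 1 \<Longrightarrow> norm (op_power T n) \<le> 1"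
proof (induction n)
  case 0
  show ?case by (simp add: norm_blinfun_bound)
next
  case (Suc n)
  then show ?case by (simp add: norm_op_compose_le_one)
qed

section \<open>Square roots and kernel projections\<close>

text \<open>Records that \<open>S\<close> is a function of \<open>T\<close>. The property passes
  through sums, products and strong limits, and it puts \<open>S\<close> into every von Neumann
  algebra containing \<open>T\<close> as soon as \<open>S\<close> is complex linear.\<close>

definition bicommutes :: "'h::complex_hilbert operator \<Rightarrow> 'h operator \<Rightarrow> bool" where
  "bicommutes S T \<longleftrightarrow> (\<forall>R. R o\<^sub>L T = T o\<^sub>L R \<longrightarrow> R o\<^sub>L S = S o\<^sub>L R)"

lemma bicommutesD: "bicommutes S T \<Longrightarrow> R o\<^sub>L T = T o\<^sub>L R \<Longrightarrow> R o\<^sub>L S = S o\<^sub>L R"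
  by (simp add: bicommutes_def)

lemma bicommutes_refl: "bicommutes T T"
  by (simp add: bicommutes_def)

lemma bicommutes_trans: "bicommutes R S \<Longrightarrow> bicommutes S T \<Longrightarrow> bicommutes R T"
  by (simp add: bicommutes_def)

lemma bicommutes_commute: "bicommutes S T \<Longrightarrow> S o\<^sub>L T = T o\<^sub>L S"
  by (metis bicommutesD)

lemma bicommutes_add:
  assumes "bicommutes R T" "bicommutes S T" shows "bicommutes (R + S) T"
  unfolding bicommutes_def op_add_left op_add_right by (metis assms bicommutesD)

lemma bicommutes_diff:
  assumes "bicommutes R T" "bicommutes S T" shows "bicommutes (R - S) T"
  unfolding bicommutes_def op_diff_left op_diff_right by (metis assms bicommutesD)

lemma bicommutes_compose:
  assumes "bicommutes R T" "bicommutes S T" shows "bicommutes (R o\<^sub>L S) T"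
  unfolding bicommutes_def
proof (intro allI impI)
  fix U assume "U o\<^sub>L T = T o\<^sub>L U"
  then have "U o\<^sub>L R = R o\<^sub>L U" "U o\<^sub>L S = S o\<^sub>L U"
    using assms bicommutesD by blast+
  then show "U o\<^sub>L (R o\<^sub>L S) = R o\<^sub>L S o\<^sub>L U" by (metis op_assoc)
qed

lemma bicommutes_scaleR:
  assumes "bicommutes R T" shows "bicommutes (r *\<^sub>R R) T"
  unfolding bicommutes_def op_scaleR_left op_scaleR_right by (metis assms bicommutesD)

lemma bicommutes_id [simp]: "bicommutes id_blinfun T" and bicommutes_0 [simp]: "bicommutes 0 T"
  by (simp_all add: bicommutes_def)

lemmas bicommutes_intros = bicommutes_refl bicommutes_add bicommutes_diff bicommutes_compose
  bicommutes_scaleR bicommutes_id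

lemma bicommutes_sum: "(\<And>i. i \<in> A \<Longrightarrow> bicommutes (f i) T) \<Longrightarrow> bicommutes (\<Sum>i\<in>A. f i) T"
  by (induction A rule: infinite_finite_induct) (simp_all add: bicommutes_add)

text \<open>Pointwise limits inherit linearity; the common bound 1 on the norms makes the limit
  bounded.\<close>

lemma strong_limit_exists:
  fixes h :: "nat \<Rightarrow> 'h::complex_hilbert operator"
  assumes bo: "\<And>n. h n \<in> bounded_operators" and le: "\<And>n. norm (h n) \<le> 1"
    and C: "\<And>x. Cauchy (\<lambda>n. h n x)"
  obtains E where "E \<in> bounded_operators" "norm E \<le> 1" "\<And>x. (\<lambda>n. h n x) \<longlonglongrightarrow> E x"
proof -
  have "\<exists>y. (\<lambda>n. h n x) \<longlonglongrightarrow> y" for x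
    using C Cauchy_convergent_iff convergent_def by blast
  then obtain F where F: "\<And>x. (\<lambda>n. h n x) \<longlonglongrightarrow> F x" by metis
  have nF: "norm (F x) \<le> norm x" for x
    by (rule LIMSEQ_le_const2[OF tendsto_norm[OF F]]) (use le blinfun_contraction in blast)
  have bl: "bounded_linear F"
  proof (rule bounded_linear_intro)
    show "F (x + y) = F x + F y" for x y
      using F[of "x + y"] tendsto_add[OF F[of x] F[of y]]
      by (simp add: blinfun.add_right LIMSEQ_unique)
    show "F (r *\<^sub>R x) = r *\<^sub>R F x" for r x
      using F[of "r *\<^sub>R x"] tendsto_scaleR[OF tendsto_const F[of x], of r]
      by (simp add: blinfun.scaleR_right LIMSEQ_unique)
    show "norm (F x) \<le> norm x * 1" for x using nF by simp
  qed
  then have app: "blinfun_apply (Blinfun F) = F" by (rule bounded_linear_Blinfun_apply)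
  show thesis
  proof (rule that[of "Blinfun F"])
    show "(\<lambda>n. h n x) \<longlonglongrightarrow> Blinfun F x" for x using F app by simp
    show "norm (Blinfun F) \<le> 1" by (rule norm_blinfun_bound) (simp_all add: app nF)
    have "F (c *\<^sub>C x) = c *\<^sub>C F x" for c x
      using F[of "c *\<^sub>C x"] bounded_linear.tendsto[OF bounded_linear_scaleC F[of x], of c]
      by (simp add: bounded_operatorsD[OF bo] LIMSEQ_unique)
    then show "Blinfun F \<in> bounded_operators" by (simp add: bounded_operators_def app)
  qed
qed

lemma strong_limit_self_adjoint:
  fixes h :: "nat \<Rightarrow> 'h::complex_hilbert operator"
  assumes sa: "\<And>n. self_adjoint (h n)" and E: "E \<in> bounded_operators"
    and lim: "\<And>x. (\<lambda>n. h n x) \<longlonglongrightarrow> E x"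
  shows "self_adjoint E"
proof -
  have re: "inner (E x) y = inner x (E y)" for x y
  proof -
    have "(\<lambda>n. inner (h n x) y) \<longlonglongrightarrow> inner (E x) y" by (intro tendsto_intros lim)
    moreover have "(\<lambda>n. inner (h n x) y) \<longlonglongrightarrow> inner x (E y)"
      unfolding self_adjoint_inner[OF sa] by (intro tendsto_intros lim)
    ultimately show ?thesis by (rule LIMSEQ_unique)
  qed
  \<comment> \<open>Complex linearity of \<open>E\<close> recovers the imaginary part from the real
    inner product.\<close>
  have "cinner (E x) y = cinner x (E y)" for x y
    by (rule complex_eqI) (simp_all add: Re_cinner Im_cinner re bounded_operatorsD[OF E, symmetric])
  then show ?thesis using E by (simp add: self_adjoint_def op_adjointI)
qed

lemma strong_limit_bicommutes:
  assumes "\<And>n. bicommutes (h n) T" and lim: "\<And>x. (\<lambda>n. h n x) \<longlonglongrightarrow> blinfun_apply E x"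
  shows "bicommutes E T"
  unfolding bicommutes_def
proof (intro allI impI blinfun_eqI)
  fix R x assume R: "R o\<^sub>L T = T o\<^sub>L R"
  have "(\<lambda>n. R (h n x)) = (\<lambda>n. h n (R x))"
    using bicommutesD[OF assms(1) R] by (metis blinfun_apply_blinfun_compose)
  moreover have "(\<lambda>n. R (h n x)) \<longlonglongrightarrow> R (E x)"
    by (intro tendsto_intros lim)
  ultimately show "(R o\<^sub>L E) x = (E o\<^sub>L R) x"
    using lim[of "R x"] LIMSEQ_unique by fastforce
qed

text \<open>The square root of \<open>1 - x\<close> is \<open>1 - y\<close>, where \<open>y\<close> is the fixed point of
  \<open>y \<mapsto> (x + y\<^sup>2) / 2\<close>. The iterates are dominated in norm by those of the scalar iteration \<open>t\<close>
  for \<open>x = 1\<close>, which is bounded and increasing.\<close>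

lemma square_root_exists:
  fixes x :: "'h::complex_hilbert operator"
  assumes sa: "self_adjoint x" and nx: "norm x \<le> 1"
  obtains s where "positive_operator s" "s o\<^sub>L s = id_blinfun - x" "bicommutes s x"
proof -
  define t :: "nat \<Rightarrow> real" where "t = rec_nat 0 (\<lambda>_ r. (1 + r\<^sup>2) / 2)"
  have t0: "t 0 = 0" and tS: "t (Suc n) = (1 + (t n)\<^sup>2) / 2" for n by (simp_all add: t_def)
  have tb: "0 \<le> t n \<and> t n \<le> 1" for n
    by (induction n) (auto simp: t0 tS power_le_one)
  have tinc: "t n \<le> t (Suc n)" for n
  proof -
    have "0 \<le> (1 - t n)\<^sup>2" by simp
    then show ?thesis by (simp add: tS power2_diff)
  qed
  define y where "y = rec_nat 0 (\<lambda>_ z. (1/2) *\<^sub>R (x + (z o\<^sub>L z)))"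
  have y0: "y 0 = 0" and yS: "y (Suc n) = (1/2) *\<^sub>R (x + (y n o\<^sub>L y n))" for n
    by (simp_all add: y_def)
  have bic: "bicommutes (y n) x" for n
  proof (induction n)
    case 0 show ?case by (simp add: y0)
  next
    case (Suc n) then show ?case unfolding yS by (intro bicommutes_intros)
  qed
  have ysa: "self_adjoint (y n)" for n
    by (induction n) (simp add: y0, auto simp: yS intro!: self_adjoint_square sa)
  have ny: "norm (y n) \<le> t n" for n
  proof (induction n)
    case 0 show ?case by (simp add: y0 t0)
  next
    case (Suc n)
    have "norm (y n o\<^sub>L y n) \<le> (t n)\<^sup>2"
      unfolding power2_eq_square
      by (rule order_trans[OF norm_blinfun_compose mult_mono[OF Suc Suc]]) (use tb in auto)
    then have "norm (x + (y n o\<^sub>L y n)) \<le> 1 + (t n)\<^sup>2"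
      using nx norm_triangle_ineq[of x "y n o\<^sub>L y n"] by linarith
    then show ?case by (simp add: yS tS)
  qed
  have comm: "y m o\<^sub>L y n = y n o\<^sub>L y m" for m n
    by (metis bic bicommutesD)
  \<comment> \<open>The iterates commute, being in the bicommutant of \<open>x\<close>, so a
    difference of squares factors exactly as it does for the scalars \<open>t n\<close>.\<close>
  have step: "norm (y (Suc n) - y n) \<le> t (Suc n) - t n" for n
  proof (induction n)
    case 0 show ?case using nx by (simp add: y0 t0 yS tS)
  next
    case (Suc n)
    have "y (Suc (Suc n)) - y (Suc n)
        = (1/2) *\<^sub>R ((y (Suc n) o\<^sub>L y (Suc n)) - (y n o\<^sub>L y n))"
      by (simp only: yS[of "Suc n"] yS[of n] scaleR_diff_right[symmetric]) simp
    also have "(y (Suc n) o\<^sub>L y (Suc n)) - (y n o\<^sub>L y n)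
        = (y (Suc n) - y n) o\<^sub>L (y (Suc n) + y n)"
      by (simp add: op_ring comm[of n "Suc n"])
    finally have "norm (y (Suc (Suc n)) - y (Suc n))
        \<le> (1/2) * (norm (y (Suc n) - y n) * norm (y (Suc n) + y n))"
      by (simp add: norm_blinfun_compose)
    also have "\<dots> \<le> (1/2) * ((t (Suc n) - t n) * (t (Suc n) + t n))"
      using Suc tinc[of n] ny[of n] ny[of "Suc n"] norm_triangle_ineq[of "y (Suc n)" "y n"]
      by (intro mult_left_mono mult_mono) auto
    also have "\<dots> = t (Suc (Suc n)) - t (Suc n)"
      by (simp add: tS[of "Suc n"] tS[of n] power2_eq_square field_simps)
    finally show ?case .
  qed
  have step': "norm (y (n + k) - y n) \<le> t (n + k) - t n" for n k
  proof (induction k)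
    case (Suc k)
    have "y (n + Suc k) - y n = (y (Suc (n + k)) - y (n + k)) + (y (n + k) - y n)" by simp
    then have "norm (y (n + Suc k) - y n) \<le> norm (y (Suc (n + k)) - y (n + k)) + norm (y (n + k) - y n)"
      using norm_triangle_ineq by metis
    then show ?case using Suc step[of "n + k"] by simp
  qed simp
  have "incseq t" using tinc by (rule incseq_SucI)
  moreover have "Bseq t" using tb by (intro BseqI'[of t 1]) (auto simp: abs_le_iff intro: order_trans[of _ 0])
  ultimately have "convergent t" by (simp add: Bseq_monoseq_convergent incseq_imp_monoseq)
  then have Ct: "Cauchy t" by (rule convergent_Cauchy)
  have yb: "y n \<in> bounded_operators" for n using ysa by blast
  have ny1: "norm (y n) \<le> 1" for n using ny tb order_trans by blast
  have Cy: "Cauchy y"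
  proof (rule metric_CauchyI)
    fix e :: real assume "e > 0"
    then obtain N where N: "\<And>m n. m \<ge> N \<Longrightarrow> n \<ge> N \<Longrightarrow> dist (t m) (t n) < e"
      using metric_CauchyD[OF Ct] by blast
    have *: "dist (y m) (y n) < e" if "m \<ge> N" "n \<ge> N" "n \<le> m" for m n
    proof -
      have "norm (y m - y n) \<le> t m - t n" using step'[of n "m - n"] that by simp
      also have "\<dots> < e" using N[OF that(1,2)] by (simp add: dist_real_def)
      finally show ?thesis by (simp add: dist_norm)
    qed
    then have "\<forall>m\<ge>N. \<forall>n\<ge>N. dist (y m) (y n) < e"
      by (metis dist_commute linorder_le_cases)
    then show "\<exists>N. \<forall>m\<ge>N. \<forall>n\<ge>N. dist (y m) (y n) < e" by blast
  qed
  then have Cyx: "Cauchy (\<lambda>n. y n v)" for v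
    by (intro bounded_linear.Cauchy[OF blinfun.bounded_linear_left])
  obtain z where z: "z \<in> bounded_operators" "norm z \<le> 1" and lim: "\<And>v. (\<lambda>n. y n v) \<longlonglongrightarrow> z v"
    using strong_limit_exists[OF yb ny1 Cyx] by blast
  have zsa: "self_adjoint z" by (rule strong_limit_self_adjoint[OF ysa z(1) lim])
  have zb: "bicommutes z x" by (rule strong_limit_bicommutes[OF bic lim])
  have sq: "(z o\<^sub>L z) v = 2 *\<^sub>R z v - x v" for v
  proof -
    have "(\<lambda>n. y n (y n v)) \<longlonglongrightarrow> z (z v)"
    proof -
      \<comment> \<open>Multiplication is jointly strongly continuous on bounded sets:
        \<open>norm (y n) \<le> 1\<close> controls the outer factor here, and in the remaining term
        \<open>y n\<close> acts on the fixed vector \<open>z v\<close>.\<close>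
      have "(\<lambda>n. y n (y n v - z v)) \<longlonglongrightarrow> 0"
      proof (rule tendsto_norm_zero_cancel, rule tendsto_sandwich[OF _ _ tendsto_const])
        show "(\<lambda>n. norm (y n v - z v)) \<longlonglongrightarrow> 0"
          using lim[of v] by (simp add: LIM_zero_iff tendsto_norm_zero)
      qed (use blinfun_contraction[OF ny1] in auto)
      from tendsto_add[OF this lim[of "z v"]] show ?thesis
        by (simp add: blinfun.diff_right)
    qed
    then have "(\<lambda>n. (1/2) *\<^sub>R (x v + y n (y n v))) \<longlonglongrightarrow> (1/2) *\<^sub>R (x v + z (z v))"
      by (intro tendsto_scaleR tendsto_add tendsto_const)
    moreover have "(\<lambda>n. (1/2) *\<^sub>R (x v + y n (y n v))) = (\<lambda>n. y (Suc n) v)"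
      by (simp add: yS blinfun.scaleR_left blinfun.add_left)
    ultimately have "(1/2) *\<^sub>R (x v + z (z v)) = z v"
      using LIMSEQ_Suc[OF lim[of v]] LIMSEQ_unique by metis
    then have "2 *\<^sub>R (1/2) *\<^sub>R (x v + z (z v)) = 2 *\<^sub>R z v" by metis
    then show ?thesis by (simp add: algebra_simps)
  qed
  show thesis
  proof (rule that[of "id_blinfun - z"])
    show "(id_blinfun - z) o\<^sub>L (id_blinfun - z) = id_blinfun - x"
    proof (rule blinfun_eqI)
      fix v
      have "z (z v) = 2 *\<^sub>R z v - x v" using sq[of v] by simp
      then show "((id_blinfun - z) o\<^sub>L (id_blinfun - z)) v = (id_blinfun - x) v"
        by (simp add: blinfun.diff_left blinfun.diff_right scaleR_2)
    qed
    show "bicommutes (id_blinfun - z) x" by (intro bicommutes_intros zb)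
    have "inner (z v) v \<le> inner v v" for v
    proof -
      have "inner (z v) v \<le> norm (z v) * norm v" by (rule norm_cauchy_schwarz)
      also have "\<dots> \<le> norm v * norm v"
        using blinfun_contraction[OF z(2)] by (intro mult_right_mono) auto
      finally show ?thesis by (simp add: power2_norm_eq_inner[symmetric] power2_eq_square)
    qed
    then show "positive_operator (id_blinfun - z)"
      using zsa by (auto simp: positive_operator_iff blinfun.diff_left inner_diff_left)
  qed
qed

text \<open>The square of \<open>norm (w x)\<close> is that of \<open>norm x\<close> minus that of
  \<open>norm (T x)\<close>.\<close>

lemma norm_id_diff_adjoint_compose:
  fixes T :: "'h::complex_hilbert operator"
  assumes T: "T \<in> bounded_operators" "norm T \<le> 1" and w: "self_adjoint w"
    and ww: "w o\<^sub>L w = id_blinfun - (op_adjoint T o\<^sub>L T)"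
  shows "norm w \<le> 1"
proof (rule norm_blinfun_bound)
  fix x
  have "(norm (w x))\<^sup>2 = inner ((w o\<^sub>L w) x) x"
    by (simp add: power2_norm_eq_inner self_adjoint_inner[OF w])
  also have "\<dots> = (norm x)\<^sup>2 - (norm (T x))\<^sup>2"
  proof -
    have "inner (op_adjoint T (T x)) x = inner (T x) (T x)"
      by (metis Re_cinner T(1) cinner_op_adjoint_left)
    then show ?thesis
      by (simp add: ww blinfun.diff_left inner_diff_left power2_norm_eq_inner)
  qed
  also have "\<dots> \<le> (norm x)\<^sup>2" by simp
  finally show "norm (w x) \<le> 1 * norm x" by (simp add: power2_le_iff_abs_le)
qed simp

text \<open>\<open>w\<close> is the defect operator of \<open>T\<close>: it measures how far
  \<open>T\<close> is from being isometric, and the fixed vectors of \<open>w o\<^sub>L w\<close>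
  form the kernel of \<open>T\<close>.\<close>

lemma square_root_complement:
  fixes T :: "'h::complex_hilbert operator"
  assumes T: "T \<in> bounded_operators" "norm T \<le> 1"
  obtains w where "self_adjoint w" "norm w \<le> 1" "positive_operator w"
    "w o\<^sub>L w = id_blinfun - (op_adjoint T o\<^sub>L T)" "bicommutes w (op_adjoint T o\<^sub>L T)"
proof -
  have n: "norm (op_adjoint T o\<^sub>L T) \<le> 1"
    using norm_op_adjoint_le[OF T(1)] T(2) by (intro norm_op_compose_le_one) auto
  have "self_adjoint (op_adjoint T o\<^sub>L T)"
    using positive_operator_adjoint_compose[OF T(1)] by (simp add: positive_operator_iff)
  from square_root_exists[OF this n] obtain s where s: "positive_operator s"
    "s o\<^sub>L s = id_blinfun - (op_adjoint T o\<^sub>L T)" "bicommutes s (op_adjoint T o\<^sub>L T)" .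
  have "self_adjoint s" using s(1) by (simp add: positive_operator_iff)
  with norm_id_diff_adjoint_compose[OF T this s(2)] s show thesis by (intro that)
qed

text \<open>The inner product of \<open>h m x\<close> and \<open>h n x\<close> depends only on
  \<open>m + n\<close> and is a term of a decreasing sequence, which forces the Cauchy property.
  Even powers are taken because -1 may be an eigenvalue of \<open>w\<close>; the limit projects onto
  the fixed vectors of \<open>w o\<^sub>L w\<close>.\<close>

lemma op_power_limit_projection:
  fixes w :: "'h::complex_hilbert operator"
  assumes w: "self_adjoint w" "norm w \<le> 1"
  obtains E where "self_adjoint E" "E o\<^sub>L E = E" "w o\<^sub>L w o\<^sub>L E = E" "bicommutes E w"
    "\<And>x. (\<lambda>n. op_power w (2 * n) x) \<longlonglongrightarrow> E x" "\<And>x. w (w x) = x \<Longrightarrow> E x = x"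
proof -
  define h where "h n = op_power w (2 * n)" for n
  have hsa: "self_adjoint (h n)" for n unfolding h_def by (rule self_adjoint_op_power[OF w(1)])
  have hn: "norm (h n) \<le> 1" for n unfolding h_def by (rule norm_op_power_le_one[OF w(2)])
  have hb: "h n \<in> bounded_operators" for n using hsa by blast
  have C: "Cauchy (\<lambda>n. h n x)" for x
  proof -
    define \<alpha> where "\<alpha> n = (norm (op_power w n x))\<^sup>2" for n
    have dec: "decseq \<alpha>"
      by (rule decseq_SucI) (auto simp: \<alpha>_def intro!: power_mono blinfun_contraction w)
    have "Bseq \<alpha>"
    proof (rule BseqI')
      show "norm (\<alpha> n) \<le> \<alpha> 0" for n
        using decseqD[OF dec, of 0 n] by (simp add: \<alpha>_def)
    qed
    then have "convergent \<alpha>" by (simp add: Bseq_monoseq_convergent decseq_imp_monoseq[OF dec])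
    then obtain L where L: "\<alpha> \<longlonglongrightarrow> L" by (auto simp: convergent_def)
    have ip: "inner (h m x) (h n x) = \<alpha> (m + n)" for m n
    proof -
      have "op_power w m o\<^sub>L h n = op_power w n o\<^sub>L op_power w (m + n)"
        unfolding h_def op_power_add[symmetric] by (rule arg_cong[of _ _ "op_power w"]) simp
      moreover have "h m = op_power w m o\<^sub>L op_power w m"
        by (simp add: h_def mult_2 op_power_add)
      ultimately have e: "op_power w m (h n x) = op_power w n (op_power w (m + n) x)"
        and e': "h m x = op_power w m (op_power w m x)"
        by (metis blinfun_apply_blinfun_compose)+
      have "inner (h m x) (h n x) = inner (op_power w m x) (op_power w n (op_power w (m + n) x))"
        unfolding e' using self_adjoint_inner[OF self_adjoint_op_power[OF w(1)]] e by metis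
      also have "\<dots> = inner (op_power w n (op_power w m x)) (op_power w (m + n) x)"
        using self_adjoint_inner[OF self_adjoint_op_power[OF w(1)]] by metis
      also have "op_power w n (op_power w m x) = op_power w (m + n) x"
        by (metis op_power_add add.commute blinfun_apply_blinfun_compose)
      finally show ?thesis by (simp add: \<alpha>_def power2_norm_eq_inner)
    qed
    have d: "(norm (h m x - h n x))\<^sup>2 = \<alpha> (m + m) - 2 * \<alpha> (m + n) + \<alpha> (n + n)" for m n
      by (simp add: power2_norm_eq_inner inner_diff_left inner_diff_right ip inner_commute[of "h n x" "h m x"] add.commute)
    show ?thesis
    proof (rule metric_CauchyI)
      fix e :: real assume "e > 0"
      \<comment> \<open>The three values of \<open>\<alpha>\<close> in \<open>d\<close> have
        coefficients 1, -2 and 1, of absolute sum four.\<close>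
      then have "e\<^sup>2 / 4 > 0" by simp
      then obtain N where N: "\<And>n. n \<ge> N \<Longrightarrow> \<bar>\<alpha> n - L\<bar> < e\<^sup>2 / 4"
        using LIMSEQ_D[OF L] by (metis real_norm_def)
      have "dist (h m x) (h n x) < e" if "m \<ge> N" "n \<ge> N" for m n
      proof -
        have "(norm (h m x - h n x))\<^sup>2 < e\<^sup>2"
          unfolding d using N[of "m + m"] N[of "m + n"] N[of "n + n"] that by linarith
        then show ?thesis using \<open>e > 0\<close> by (simp add: dist_norm power2_less_imp_less)
      qed
      then show "\<exists>N. \<forall>m\<ge>N. \<forall>n\<ge>N. dist (h m x) (h n x) < e" by blast
    qed
  qed
  obtain E where E: "E \<in> bounded_operators" "norm E \<le> 1" and lim: "\<And>x. (\<lambda>n. h n x) \<longlonglongrightarrow> E x"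
    using strong_limit_exists[OF hb hn C] by blast
  have wwE: "w (w (E x)) = E x" for x
  proof -
    have "(\<lambda>n. w (w (h n x))) \<longlonglongrightarrow> w (w (E x))" by (intro tendsto_intros lim)
    moreover have "(\<lambda>n. w (w (h n x))) = (\<lambda>n. h (Suc n) x)" by (simp add: h_def)
    ultimately show ?thesis using LIMSEQ_Suc[OF lim[of x]] LIMSEQ_unique by metis
  qed
  have fixE: "E x = x" if "w (w x) = x" for x
  proof -
    have "h n x = x" for n
      by (induction n) (simp_all add: h_def, metis blinfun_apply_blinfun_compose op_power.simps(2)
          op_power_commute that)
    then show ?thesis using lim[of x] by (simp add: LIMSEQ_const_iff)
  qed
  show thesis
  proof (rule that[of E])
    show "self_adjoint E" by (rule strong_limit_self_adjoint[OF hsa E(1) lim])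
    show "E o\<^sub>L E = E" by (rule blinfun_eqI) (simp add: fixE wwE)
    show "w o\<^sub>L w o\<^sub>L E = E" by (rule blinfun_eqI) (simp add: wwE)
    have "bicommutes (h n) w" for n
      unfolding bicommutes_def h_def using op_power_commute by blast
    then show "bicommutes E w" by (rule strong_limit_bicommutes[OF _ lim])
    show "(\<lambda>n. op_power w (2 * n) x) \<longlonglongrightarrow> E x" for x using lim by (simp add: h_def)
  qed (rule fixE)
qed

text \<open>The fixed vectors of \<open>w o\<^sub>L w\<close> are those killed by
  \<open>op_adjoint T o\<^sub>L T\<close>, that is, by \<open>T\<close>. The approximating powers
  are part of the result because the trace of a range projection is computed along them.\<close>

lemma kernel_projection:
  fixes T :: "'h::complex_hilbert operator"
  assumes T: "T \<in> bounded_operators" "norm T \<le> 1"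
  obtains w E where "self_adjoint w" "norm w \<le> 1" "w o\<^sub>L w = id_blinfun - (op_adjoint T o\<^sub>L T)"
    "bicommutes w (op_adjoint T o\<^sub>L T)"
    "self_adjoint E" "E o\<^sub>L E = E" "T o\<^sub>L E = 0" "bicommutes E (op_adjoint T o\<^sub>L T)"
    "\<And>x. (\<lambda>n. op_power w (2 * n) x) \<longlonglongrightarrow> E x" "\<And>x. T x = 0 \<Longrightarrow> E x = x"
proof -
  obtain w where w: "self_adjoint w" "norm w \<le> 1" "positive_operator w"
    "w o\<^sub>L w = id_blinfun - (op_adjoint T o\<^sub>L T)" "bicommutes w (op_adjoint T o\<^sub>L T)"
    using square_root_complement[OF T] .
  obtain E where E: "self_adjoint E" "E o\<^sub>L E = E" "w o\<^sub>L w o\<^sub>L E = E" "bicommutes E w"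
    and lim: "\<And>x. (\<lambda>n. op_power w (2 * n) x) \<longlonglongrightarrow> E x" and E_fix: "\<And>x. w (w x) = x \<Longrightarrow> E x = x"
    using op_power_limit_projection[OF w(1,2)] by blast
  show thesis
  proof (rule that[OF w(1,2,4,5) E(1,2) _ _ lim])
    show "T o\<^sub>L E = 0"
    proof (rule blinfun_eqI)
      fix x
      have "op_adjoint T (T (E x)) = 0"
      proof -
        have "E x = (w o\<^sub>L w o\<^sub>L E) x" by (simp only: E(3))
        also have "\<dots> = E x - op_adjoint T (T (E x))"
          unfolding w(4) by (simp add: blinfun.diff_left)
        finally show ?thesis by simp
      qed
      then have "inner (T (E x)) (T (E x)) = 0"
        by (metis Re_cinner T(1) cinner_op_adjoint cinner_zero_right zero_complex.sel(1))
      then show "(T o\<^sub>L E) x = blinfun_apply 0 x" by simp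
    qed
    show "bicommutes E (op_adjoint T o\<^sub>L T)" using E(4) w(5) by (rule bicommutes_trans)
    show "E x = x" if "T x = 0" for x
    proof (rule E_fix)
      have "w (w x) = (w o\<^sub>L w) x" by simp
      then show "w (w x) = x" unfolding w(4) using that by (simp add: blinfun.diff_left)
    qed
  qed
qed

section \<open>Spectral approximation\<close>

text \<open>The square of \<open>g\<close> is written as \<open>1 - x\<close>, to which
  \<open>square_root_exists\<close> applies. That \<open>x\<close> is a contraction follows vector
  by vector from \<open>norm (g (g v)) \<le> norm (g v)\<close>.\<close>

lemma absolute_value_exists:
  fixes g :: "'h::complex_hilbert operator"
  assumes g: "self_adjoint g" "norm g \<le> 1"
  obtains s where "positive_operator s" "s o\<^sub>L s = g o\<^sub>L g" "bicommutes s g" "norm s \<le> norm g"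
proof -
  define x where "x = id_blinfun - (g o\<^sub>L g)"
  have xsa: "self_adjoint x" unfolding x_def using self_adjoint_square[OF g(1)] by blast
  have "norm x \<le> 1"
  proof (rule norm_blinfun_bound)
    fix v
    have "(norm (x v))\<^sup>2 = (norm v)\<^sup>2 - 2 * inner (g (g v)) v + (norm (g (g v)))\<^sup>2"
      by (simp add: x_def blinfun.diff_left power2_norm_eq_inner inner_diff_left inner_diff_right
          inner_commute)
    also have "inner (g (g v)) v = (norm (g v))\<^sup>2"
      by (simp add: self_adjoint_inner[OF g(1)] power2_norm_eq_inner)
    finally have e: "(norm (x v))\<^sup>2 = (norm v)\<^sup>2 - 2 * (norm (g v))\<^sup>2 + (norm (g (g v)))\<^sup>2" .
    have "(norm (g (g v)))\<^sup>2 \<le> (norm (g v))\<^sup>2"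
      using blinfun_contraction[OF g(2)] by (intro power_mono) auto
    then have "(norm (x v))\<^sup>2 \<le> (norm v)\<^sup>2" unfolding e using zero_le_power2[of "norm (g v)"] by linarith
    then show "norm (x v) \<le> 1 * norm v" by (simp add: power2_le_iff_abs_le)
  qed simp
  then obtain s where s: "positive_operator s" "s o\<^sub>L s = id_blinfun - x" "bicommutes s x"
    using square_root_exists[OF xsa] by blast
  have ss: "s o\<^sub>L s = g o\<^sub>L g" by (simp add: s(2) x_def)
  have "bicommutes x g" unfolding x_def by (intro bicommutes_intros)
  then have bic: "bicommutes s g" using s(3) bicommutes_trans by blast
  have ssa: "self_adjoint s" using s(1) by (simp add: positive_operator_iff)
  have "norm s \<le> norm g"
  proof (rule norm_blinfun_bound)
    fix v
    have "(norm (s v))\<^sup>2 = inner ((s o\<^sub>L s) v) v"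
      by (simp add: self_adjoint_inner[OF ssa] power2_norm_eq_inner)
    also have "\<dots> = (norm (g v))\<^sup>2"
      unfolding ss by (simp add: self_adjoint_inner[OF g(1)] power2_norm_eq_inner)
    finally have "norm (s v) = norm (g v)" by (simp add: power2_eq_iff_nonneg)
    then show "norm (s v) \<le> norm g * norm v" by (simp add: norm_blinfun)
  qed simp
  then show thesis using that s(1) ss bic by blast
qed

text \<open>\<open>E\<close> is the kernel projection of the negative part
  \<open>T = (s - g)/2\<close>, so \<open>g\<close> and \<open>s\<close> agree on its range. Since
  \<open>T\<close> also kills the range of \<open>s + g\<close>, that range lies under
  \<open>E\<close>; together these give \<open>2 s E = s + g\<close>. Rescaling reduces the claim to
  contractions.\<close>

lemma sign_decomposition:
  fixes g :: "'h::complex_hilbert operator"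
  assumes g: "self_adjoint g"
  obtains E s where "self_adjoint E" "E o\<^sub>L E = E" "bicommutes E g"
    "positive_operator s" "bicommutes s g" "norm s \<le> norm g"
    "g = s o\<^sub>L (2 *\<^sub>R E - id_blinfun)"
proof -
  have unit: "\<exists>E s. self_adjoint E \<and> E o\<^sub>L E = E \<and> bicommutes E g \<and> positive_operator s \<and>
      bicommutes s g \<and> norm s \<le> norm g \<and> g = s o\<^sub>L (2 *\<^sub>R E - id_blinfun)"
    if g: "self_adjoint g" "norm g \<le> 1" for g :: "'h operator"
  proof -
    obtain s where s: "positive_operator s" "s o\<^sub>L s = g o\<^sub>L g" "bicommutes s g" "norm s \<le> norm g"
      using absolute_value_exists[OF g] .
    have ssa: "self_adjoint s" using s(1) by (simp add: positive_operator_iff)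
    have sg: "s o\<^sub>L g = g o\<^sub>L s" using bicommutes_commute[OF s(3)] .
    define T where "T = (1/2) *\<^sub>R (s - g)"
    have Tsa: "self_adjoint T" unfolding T_def using ssa g(1) by blast
    then have Tb: "T \<in> bounded_operators" and Tad: "op_adjoint T = T" by (auto simp: self_adjoint_def)
    have "norm T \<le> 1"
      using norm_triangle_ineq4[of s g] s(4) g(2) by (simp add: T_def)
    from kernel_projection[OF Tb this] obtain E where E: "self_adjoint E" "E o\<^sub>L E = E" "T o\<^sub>L E = 0"
      "bicommutes E (T o\<^sub>L T)" and fixE: "\<And>x. T x = 0 \<Longrightarrow> E x = x"
      unfolding Tad by metis
    have "bicommutes T g" unfolding T_def by (intro bicommutes_intros s(3))
    then have "bicommutes (T o\<^sub>L T) g" by (intro bicommutes_intros)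
    then have Eg: "bicommutes E g" using E(4) bicommutes_trans by blast
    have "2 *\<^sub>R (T o\<^sub>L E) = (s o\<^sub>L E) - (g o\<^sub>L E)"
      by (simp add: T_def op_scaleR_left op_diff_left)
    then have gE: "g o\<^sub>L E = s o\<^sub>L E" using E(3) by simp
    have "E ((s + g) x) = (s + g) x" for x
    proof (rule fixE)
      have "T o\<^sub>L (s + g) = (1/2) *\<^sub>R ((s o\<^sub>L s) - (g o\<^sub>L g))"
        by (simp add: T_def op_scaleR_left op_ring sg scaleR_diff_right scaleR_add_right)
      then have "T o\<^sub>L (s + g) = 0" by (simp add: s(2))
      then show "T ((s + g) x) = 0"
        by (metis blinfun_apply_blinfun_compose zero_blinfun.rep_eq)
    qed
    then have "E o\<^sub>L (s + g) = s + g" by (intro blinfun_eqI) simp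
    moreover have "E o\<^sub>L g = g o\<^sub>L E" "E o\<^sub>L s = s o\<^sub>L E"
      using bicommutes_commute[OF Eg] bicommutesD[OF s(3), of E] by simp_all
    ultimately have "(s o\<^sub>L E) + (s o\<^sub>L E) = s + g" by (simp add: op_add_right gE)
    then have "g = s o\<^sub>L (2 *\<^sub>R E - id_blinfun)"
      by (simp add: op_diff_right op_scaleR_right op_add_right scaleR_2)
    then show ?thesis using E(1,2) Eg s(1,3,4) by blast
  qed
  show thesis
  proof (cases "g = 0")
    case True
    show thesis by (rule that[of 0 0]) (simp_all add: True)
  next
    case False
    define r where "r = norm g"
    have r: "r > 0" using False by (simp add: r_def)
    define g' where "g' = (1/r) *\<^sub>R g"
    have g': "self_adjoint g'" "norm g' \<le> 1" using g r by (auto simp: g'_def r_def)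
    have gg': "g = r *\<^sub>R g'" using r by (simp add: g'_def)
    from unit[OF g'] obtain E s where Es: "self_adjoint E" "E o\<^sub>L E = E" "bicommutes E g'"
      "positive_operator s" "bicommutes s g'" "norm s \<le> norm g'" "g' = s o\<^sub>L (2 *\<^sub>R E - id_blinfun)"
      by blast
    have "bicommutes g' g" unfolding g'_def by (intro bicommutes_intros)
    show thesis
    proof (rule that[of E "r *\<^sub>R s"])
      show "bicommutes E g" "bicommutes (r *\<^sub>R s) g"
        using Es(3,5) \<open>bicommutes g' g\<close> bicommutes_trans bicommutes_scaleR by blast+
      show "positive_operator (r *\<^sub>R s)" using Es(4) r by (simp add: positive_operator_scaleR)
      show "norm (r *\<^sub>R s) \<le> norm g" using Es(6) r by (simp add: gg')
      show "g = r *\<^sub>R s o\<^sub>L (2 *\<^sub>R E - id_blinfun)"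
        unfolding op_scaleR_left Es(7)[symmetric] by (rule gg')
    qed (use Es in auto)
  qed
qed

lemma norm_projection_reflection_le:
  assumes E: "self_adjoint E" "E o\<^sub>L E = E"
  shows "norm (2 *\<^sub>R E - id_blinfun) \<le> 1"
proof (rule norm_blinfun_bound)
  fix v
  have EE: "inner (E v) (E v) = inner (E v) v"
    by (metis E blinfun_apply_blinfun_compose self_adjoint_inner)
  have "(norm ((2 *\<^sub>R E - id_blinfun) v))\<^sup>2 = (norm v)\<^sup>2"
    unfolding power2_norm_eq_inner
    by (simp add: blinfun.diff_left blinfun.scaleR_left inner_diff_left inner_diff_right EE
        inner_commute[of v "E v"])
  then show "norm ((2 *\<^sub>R E - id_blinfun) v) \<le> 1 * norm v" by (simp add: power2_eq_iff_nonneg)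
qed simp

text \<open>The spectrum of \<open>s\<close> lies between 0 and \<open>r\<close>, and
  \<open>r/2\<close> is the midpoint. After squaring, the claim is exactly
  \<open>positive_operator_norm_le\<close>.\<close>

lemma norm_positive_operator_shift_le:
  assumes s: "positive_operator s" and r: "norm s \<le> r"
  shows "norm (s - (r/2) *\<^sub>R id_blinfun) \<le> r/2"
proof (rule norm_blinfun_bound)
  have "0 \<le> r" using r norm_ge_zero order_trans by blast
  then show "0 \<le> r/2" by simp
  fix v
  have "(norm ((s - (r/2) *\<^sub>R id_blinfun) v))\<^sup>2
      = (norm (s v))\<^sup>2 - r * inner (s v) v + (r/2)\<^sup>2 * (norm v)\<^sup>2"
    unfolding power2_norm_eq_inner
    by (simp add: blinfun.diff_left blinfun.scaleR_left inner_diff_left inner_diff_right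
        inner_commute[of v "s v"] power2_eq_square algebra_simps)
  also have "\<dots> \<le> (r/2 * norm v)\<^sup>2"
    using positive_operator_norm_le[OF s r, of v] by (simp add: power_mult_distrib power_divide)
  finally show "norm ((s - (r/2) *\<^sub>R id_blinfun) v) \<le> r/2 * norm v"
    by (rule power2_le_imp_le) (use \<open>0 \<le> r\<close> in simp)
qed

text \<open>The bisection step: keep the sign of \<open>g\<close> and replace its absolute value by
  the midpoint \<open>r/2\<close>.\<close>

lemma self_adjoint_halving:
  fixes g :: "'h::complex_hilbert operator"
  assumes g: "self_adjoint g" and r: "norm g \<le> r"
  obtains E where "self_adjoint E" "E o\<^sub>L E = E" "bicommutes E g"
    "norm (g - (r/2) *\<^sub>R (2 *\<^sub>R E - id_blinfun)) \<le> r/2"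
proof -
  obtain E s where Es: "self_adjoint E" "E o\<^sub>L E = E" "bicommutes E g"
    "positive_operator s" "bicommutes s g" "norm s \<le> norm g" "g = s o\<^sub>L (2 *\<^sub>R E - id_blinfun)"
    using sign_decomposition[OF g] .
  have "g - (r/2) *\<^sub>R (2 *\<^sub>R E - id_blinfun)
      = (s - (r/2) *\<^sub>R id_blinfun) o\<^sub>L (2 *\<^sub>R E - id_blinfun)"
    unfolding op_diff_left op_scaleR_left op_id_left Es(7)[symmetric] ..
  also have "norm \<dots> \<le> r/2 * 1"
    by (rule order_trans[OF norm_blinfun_compose], rule mult_mono)
      (use norm_positive_operator_shift_le[OF Es(4)] norm_projection_reflection_le[OF Es(1,2)] Es(6) r
        order_trans[OF norm_ge_zero r] in auto)
  finally show thesis using that Es by simp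
qed

lemma sum_lessThan_add:
  fixes h :: "nat \<Rightarrow> 'a::comm_monoid_add"
  shows "(\<Sum>j<n + k. h j) = (\<Sum>j<n. h j) + (\<Sum>j<k. h (n + j))"
  by (induction k) (simp_all add: ac_simps)

text \<open>Orthogonality and the sum concern the indices below \<open>n\<close>; the other
  conditions are demanded of every index, so that they can be used without a side condition on
  \<open>j\<close>.\<close>

definition spectral_partition ::
    "'h::complex_hilbert operator \<Rightarrow> nat \<Rightarrow> (nat \<Rightarrow> 'h operator) \<Rightarrow> bool" where
  "spectral_partition b n E \<longleftrightarrow>
    (\<forall>j. self_adjoint (E j) \<and> E j o\<^sub>L E j = E j \<and> bicommutes (E j) b) \<and>
    (\<forall>i<n. \<forall>j<n. i \<noteq> j \<longrightarrow> E i o\<^sub>L E j = 0) \<and> (\<Sum>j<n. E j) = id_blinfun"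

text \<open>Every piece is split by the sign projection of the current error, which doubles the
  number of pieces and halves the error bound. The coefficients move by half that bound each time,
  and the bound on \<open>l j\<close> is the resulting geometric sum; it later keeps all eigenvalues
  of the diagonal operator at most \<open>norm a\<close> in modulus.\<close>

lemma spectral_approximation:
  fixes b :: "'h::complex_hilbert operator"
  assumes b: "self_adjoint b"
  shows "\<exists>E l. spectral_partition b (2 ^ m) E \<and> (\<forall>j. \<bar>l j\<bar> \<le> norm b - norm b / 2 ^ m) \<and>
    norm (b - (\<Sum>j<2 ^ m. l j *\<^sub>R E j)) \<le> norm b / 2 ^ m"
proof (induction m)
  case 0
  have "spectral_partition b (2 ^ 0) (\<lambda>_. id_blinfun)"
    by (simp add: spectral_partition_def)
  then show ?case
    by (intro exI[of _ "\<lambda>_. id_blinfun"] exI[of _ "\<lambda>_. 0"]) simp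
next
  case (Suc m)
  then obtain E l where sp: "spectral_partition b (2 ^ m) E"
    and l: "\<And>j. \<bar>l j\<bar> \<le> norm b - norm b / 2 ^ m"
    and approx: "norm (b - (\<Sum>j<2 ^ m. l j *\<^sub>R E j)) \<le> norm b / 2 ^ m"
    by blast
  have E: "self_adjoint (E j)" "E j o\<^sub>L E j = E j" "bicommutes (E j) b" for j
    using sp by (simp_all add: spectral_partition_def)
  have orth: "i < 2 ^ m \<Longrightarrow> j < 2 ^ m \<Longrightarrow> i \<noteq> j \<Longrightarrow> E i o\<^sub>L E j = 0" for i j
    using sp by (simp add: spectral_partition_def)
  have sumE: "(\<Sum>j<2 ^ m. E j) = id_blinfun"
    using sp by (simp add: spectral_partition_def)
  define N :: nat where "N = 2 ^ m"
  define r where "r = norm b / 2 ^ m"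
  define g where "g = b - (\<Sum>j<2 ^ m. l j *\<^sub>R E j)"
  have gsa: "self_adjoint g" unfolding g_def by (intro self_adjoint_diff b self_adjoint_sum) (use E in auto)
  have gb: "bicommutes g b" unfolding g_def by (intro bicommutes_intros bicommutes_sum E)
  obtain F where F: "self_adjoint F" "F o\<^sub>L F = F" "bicommutes F g"
    and half: "norm (g - (r/2) *\<^sub>R (2 *\<^sub>R F - id_blinfun)) \<le> r/2"
    using self_adjoint_halving[OF gsa approx[folded g_def r_def]] .
  have Fb: "bicommutes F b" using F(3) gb bicommutes_trans by blast
  have FE: "F o\<^sub>L E j = E j o\<^sub>L F" for j
    using bicommutesD[OF Fb] bicommutes_commute[OF E(3)] by metis
  define G where "G = id_blinfun - F"
  have G: "self_adjoint G" "G o\<^sub>L G = G" "bicommutes G b" "F o\<^sub>L G = 0" "G o\<^sub>L F = 0"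
    unfolding G_def using F(1,2) Fb by (auto simp: op_ring intro!: bicommutes_intros)
  have GE: "G o\<^sub>L E j = E j o\<^sub>L G" for j by (simp add: G_def op_diff_left op_diff_right FE)
  define E' where "E' j = (if j < N then E j o\<^sub>L F else E (j - N) o\<^sub>L G)" for j
  \<comment> \<open>The reflection \<open>2 F - 1\<close> is 1 on \<open>F\<close> and -1 on
    \<open>G\<close>; hence the two signs of the shift.\<close>
  define l' where "l' j = (if j < N then l j + r/2 else l (j - N) - r/2)" for j
  have N2: "2 ^ Suc m = N + N" by (simp add: N_def)
  have s1: "(\<Sum>j<N. E j) = id_blinfun" using sumE by (simp add: N_def)
  have "self_adjoint (E' j) \<and> E' j o\<^sub>L E' j = E' j \<and> bicommutes (E' j) b" for j
  proof (intro conjI)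
    show "self_adjoint (E' j)"
      unfolding E'_def using E(1) F(1) G(1) FE GE by (auto intro!: self_adjoint_compose)
    have "E i o\<^sub>L F o\<^sub>L (E i o\<^sub>L F) = (E i o\<^sub>L E i) o\<^sub>L (F o\<^sub>L F)"
      "E i o\<^sub>L G o\<^sub>L (E i o\<^sub>L G) = (E i o\<^sub>L E i) o\<^sub>L (G o\<^sub>L G)" for i
      by (metis FE op_assoc, metis GE op_assoc)
    then show "E' j o\<^sub>L E' j = E' j" unfolding E'_def by (simp add: E(2) F(2) G(2))
    show "bicommutes (E' j) b"
      unfolding E'_def using E(3) Fb G(3) by (auto intro!: bicommutes_intros)
  qed
  moreover have "\<bar>l' j\<bar> \<le> norm b - norm b / 2 ^ Suc m" for j
  proof -
    have r2: "norm b / 2 ^ Suc m = r / 2" and "0 \<le> r" by (simp_all add: r_def)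
    then show ?thesis
      using l[of j, folded r_def] l[of "j - N", folded r_def] unfolding r2 l'_def by auto
  qed
  moreover have "E' i o\<^sub>L E' j = 0" if "i < 2 ^ Suc m" "j < 2 ^ Suc m" "i \<noteq> j" for i j
  proof -
    have c: "E i o\<^sub>L A o\<^sub>L (E j o\<^sub>L B) = (E i o\<^sub>L E j) o\<^sub>L (A o\<^sub>L B)"
      if "A \<in> {F, G}" for A B i j
    proof -
      have "A o\<^sub>L E j = E j o\<^sub>L A" using that FE GE by blast
      then show ?thesis by (metis op_assoc)
    qed
    show ?thesis
      using that orth[folded N_def, of i j] orth[folded N_def, of "i - N" "j - N"] G(4,5)
      unfolding E'_def N2 by (auto simp: c)
  qed
  moreover have "(\<Sum>j<2 ^ Suc m. E' j) = id_blinfun"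
  proof -
    have "(\<Sum>j<2 ^ Suc m. E' j) = (\<Sum>j<N. E j o\<^sub>L F) + (\<Sum>j<N. E j o\<^sub>L G)"
      unfolding N2 sum_lessThan_add by (simp add: E'_def)
    also have "\<dots> = F + G" by (simp add: op_sum_left[symmetric] s1)
    finally show ?thesis by (simp add: G_def)
  qed
  moreover have "b - (\<Sum>j<2 ^ Suc m. l' j *\<^sub>R E' j) = g - (r/2) *\<^sub>R (2 *\<^sub>R F - id_blinfun)"
  proof -
    have "(\<Sum>j<2 ^ Suc m. l' j *\<^sub>R E' j)
        = (\<Sum>j<N. (l j + r/2) *\<^sub>R (E j o\<^sub>L F)) + (\<Sum>j<N. (l j - r/2) *\<^sub>R (E j o\<^sub>L G))"
      unfolding N2 sum_lessThan_add by (simp add: E'_def l'_def)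
    also have "\<dots> = ((\<Sum>j<N. l j *\<^sub>R E j) o\<^sub>L F) + (r/2) *\<^sub>R ((\<Sum>j<N. E j) o\<^sub>L F)
        + (((\<Sum>j<N. l j *\<^sub>R E j) o\<^sub>L G) - (r/2) *\<^sub>R ((\<Sum>j<N. E j) o\<^sub>L G))"
      by (simp add: op_sum_left op_scaleR_left scaleR_add_left scaleR_diff_left sum.distrib
          sum_subtractf scaleR_sum_right)
    also have "\<dots> = (\<Sum>j<N. l j *\<^sub>R E j) + (r/2) *\<^sub>R (F - G)"
      unfolding s1 by (simp add: G_def op_diff_right scaleR_diff_right)
    also have "F - G = 2 *\<^sub>R F - id_blinfun" by (simp add: G_def scaleR_2)
    finally show ?thesis by (simp add: g_def N_def)
  qed
  then have "norm (b - (\<Sum>j<2 ^ Suc m. l' j *\<^sub>R E' j)) \<le> norm b / 2 ^ Suc m"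
    using half by (simp add: r_def)
  ultimately show ?case unfolding spectral_partition_def by blast
qed

section \<open>Von Neumann algebras with a trace\<close>

locale von_neumann =
  fixes M :: "'h::complex_hilbert operator set"
  assumes vna: "von_neumann_algebra M"
begin

lemma M_bounded: "T \<in> M \<Longrightarrow> T \<in> bounded_operators"
  and M_0 [simp]: "0 \<in> M"
  and M_add: "S \<in> M \<Longrightarrow> T \<in> M \<Longrightarrow> S + T \<in> M"
  and M_compose: "S \<in> M \<Longrightarrow> T \<in> M \<Longrightarrow> S o\<^sub>L T \<in> M"
  and M_scaleC: "T \<in> M \<Longrightarrow> op_scaleC c T \<in> M"
  and M_adjoint: "T \<in> M \<Longrightarrow> op_adjoint T \<in> M"
  using vna by (auto simp: von_neumann_algebra_def star_subalgebra_def)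

lemma M_scaleR: "T \<in> M \<Longrightarrow> r *\<^sub>R T \<in> M"
  by (metis M_scaleC op_scaleC_of_real)

lemma M_diff: "S \<in> M \<Longrightarrow> T \<in> M \<Longrightarrow> S - T \<in> M"
  using M_add[of S "(-1) *\<^sub>R T"] M_scaleR[of T "-1"] by simp

lemma M_eq: "commutant (commutant M) = M"
  using vna by (simp add: von_neumann_algebra_def)

lemma M_id [simp]: "id_blinfun \<in> M"
proof -
  have "id_blinfun \<in> commutant (commutant M)" by (simp add: commutant_def[of "commutant M"])
  then show ?thesis by (simp add: M_eq)
qed

lemma M_sum: "(\<And>i. i \<in> A \<Longrightarrow> f i \<in> M) \<Longrightarrow> (\<Sum>i\<in>A. f i) \<in> M"
  by (induction A rule: infinite_finite_induct) (auto intro: M_add)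

lemma M_op_power: "T \<in> M \<Longrightarrow> op_power T n \<in> M"
  by (induction n) (auto intro: M_compose)

lemmas M_intros = M_add M_compose M_scaleC M_adjoint M_scaleR M_diff M_id M_sum M_op_power M_0

text \<open>Whatever commutes with all of \<open>M\<close> commutes with \<open>T\<close>, hence
  with \<open>S\<close>. This is how square roots, spectral projections and kernel projections get
  into \<open>M\<close>.\<close>

lemma M_bicommutes:
  assumes "T \<in> M" "bicommutes S T" "S \<in> bounded_operators"
  shows "S \<in> M"
proof -
  have "S o\<^sub>L R = R o\<^sub>L S" if "R \<in> commutant M" for R
    using that assms(1) bicommutesD[OF assms(2), of R] by (auto simp: commutant_def)
  then have "S \<in> commutant (commutant M)"
    using assms(3) by (simp add: commutant_def[of "commutant M"])
  then show ?thesis by (simp add: M_eq)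
qed

lemma M_strong_limit:
  fixes h :: "nat \<Rightarrow> 'h operator"
  assumes h: "\<And>n. h n \<in> M" and E: "E \<in> bounded_operators" and lim: "\<And>x. (\<lambda>n. h n x) \<longlonglongrightarrow> E x"
  shows "E \<in> M"
proof -
  have "E o\<^sub>L R = R o\<^sub>L E" if R: "R \<in> commutant M" for R
  proof (rule blinfun_eqI)
    fix x
    have "(\<lambda>n. R (h n x)) \<longlonglongrightarrow> R (E x)" by (intro blinfun.tendsto tendsto_const lim)
    moreover have "R (h n x) = h n (R x)" for n
      using R h by (metis (mono_tags, lifting) commutant_def mem_Collect_eq blinfun_apply_blinfun_compose)
    ultimately have "(\<lambda>n. h n (R x)) \<longlonglongrightarrow> R (E x)" by simp
    then show "(E o\<^sub>L R) x = (R o\<^sub>L E) x" using lim[of "R x"] LIMSEQ_unique by fastforce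
  qed
  then have "E \<in> commutant (commutant M)"
    using E by (simp add: commutant_def[of "commutant M"])
  then show ?thesis by (simp add: M_eq)
qed

section \<open>Projections and the positive cone\<close>

lemma projectionsD:
  assumes "e \<in> projections M"
  shows "e \<in> M" "self_adjoint e" "e o\<^sub>L e = e" "op_adjoint e = e" "e \<in> bounded_operators"
  using assms by (auto simp: projections_def self_adjoint_def)

lemma projections_0 [simp]: "0 \<in> projections M"
  and projections_id [simp]: "id_blinfun \<in> projections M"
  by (simp_all add: projections_def)

lemma projection_complement: "e \<in> projections M \<Longrightarrow> id_blinfun - e \<in> projections M"
  by (auto simp: projections_def op_ring intro: M_diff)

text \<open>Taking adjoints reverses the product. With \<open>g = 0\<close> one-sided orthogonality
  becomes two-sided, and with \<open>g\<close> one of the factors the same happens to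
  domination.\<close>

lemma projection_swap:
  assumes "e \<in> projections M" "f \<in> projections M" "e o\<^sub>L f = g" "self_adjoint g"
  shows "f o\<^sub>L e = g"
  using assms projectionsD[OF assms(1)] projectionsD[OF assms(2)]
  by (metis op_adjoint_compose self_adjoint_def)

lemma projections_add:
  assumes e: "e \<in> projections M" and f: "f \<in> projections M" and ef: "e o\<^sub>L f = 0"
  shows "e + f \<in> projections M"
  using assms projection_swap[OF e f ef]
  by (auto simp: projections_def op_ring intro: M_add)

lemma projections_diff:
  assumes e: "e \<in> projections M" and f: "f \<in> projections M" and ef: "e o\<^sub>L f = f"
  shows "e - f \<in> projections M"
  using assms projection_swap[OF e f ef]
  by (auto simp: projections_def op_ring intro: M_diff)

lemma projections_sum:
  assumes "finite A" "\<And>i. i \<in> A \<Longrightarrow> f i \<in> projections M"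
    "\<And>i j. i \<in> A \<Longrightarrow> j \<in> A \<Longrightarrow> i \<noteq> j \<Longrightarrow> f i o\<^sub>L f j = 0"
  shows "(\<Sum>i\<in>A. f i) \<in> projections M"
  using assms
proof (induction A rule: finite_induct)
  case (insert a A)
  have "f a o\<^sub>L (\<Sum>i\<in>A. f i) = 0"
    using insert.hyps insert.prems(2) by (auto simp: op_sum_right intro!: sum.neutral)
  then show ?case
    using insert by (simp add: projections_add)
qed simp

lemma norm_projection_le:
  assumes "e \<in> projections M"
  shows "norm e \<le> 1"
proof (rule norm_blinfun_bound)
  fix x
  have "norm (e x) * norm (e x) = inner (e x) x"
    using projectionsD(2,3)[OF assms]
    by (metis blinfun_apply_blinfun_compose power2_eq_square power2_norm_eq_inner self_adjoint_inner)
  also have "\<dots> \<le> norm (e x) * norm x" by (rule norm_cauchy_schwarz)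
  finally show "norm (e x) \<le> 1 * norm x"
    by (cases "norm (e x) = 0") auto
qed simp

lemma positive_coneI: "x \<in> M \<Longrightarrow> positive_operator x \<Longrightarrow> x \<in> positive_cone M"
  by (simp add: positive_cone_def)

lemma positive_cone_adjoint_compose: "x \<in> M \<Longrightarrow> op_adjoint x o\<^sub>L x \<in> positive_cone M"
  by (intro positive_coneI M_compose M_adjoint positive_operator_adjoint_compose M_bounded)

lemma positive_cone_compose_adjoint: "x \<in> M \<Longrightarrow> x o\<^sub>L op_adjoint x \<in> positive_cone M"
  using positive_cone_adjoint_compose[OF M_adjoint] M_bounded by simp

lemma positive_cone_add: "x \<in> positive_cone M \<Longrightarrow> y \<in> positive_cone M \<Longrightarrow> x + y \<in> positive_cone M"
  by (auto simp: positive_cone_def positive_operator_add intro: M_add)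

lemma positive_cone_projection: "e \<in> projections M \<Longrightarrow> e \<in> positive_cone M"
  using positive_cone_adjoint_compose[of e] projectionsD by metis

end

section \<open>The trace and range projections\<close>

locale tracial_von_neumann = von_neumann +
  fixes \<tau> :: "'h::complex_hilbert operator \<Rightarrow> ennreal"
  assumes fnstw: "faithful_normal_semifinite_tracial_weight M \<tau>"
begin

lemma trace_add: "x \<in> positive_cone M \<Longrightarrow> y \<in> positive_cone M \<Longrightarrow> \<tau> (x + y) = \<tau> x + \<tau> y"
  and trace_scaleR: "x \<in> positive_cone M \<Longrightarrow> r \<ge> 0 \<Longrightarrow> \<tau> (r *\<^sub>R x) = ennreal r * \<tau> x"
  and trace_adjoint_commute: "x \<in> M \<Longrightarrow> \<tau> (op_adjoint x o\<^sub>L x) = \<tau> (x o\<^sub>L op_adjoint x)"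
  and trace_faithful: "x \<in> positive_cone M \<Longrightarrow> \<tau> x = 0 \<Longrightarrow> x = 0"
  using fnstw
  by (simp_all add: faithful_normal_semifinite_tracial_weight_def weight_def tracial_def faithful_def)

lemma trace_0 [simp]: "\<tau> 0 = 0"
  using trace_scaleR[of 0 0] positive_cone_projection[OF projections_0] by simp

lemma trace_mono:
  assumes x: "x \<in> positive_cone M" and y: "y \<in> positive_cone M" and le: "op_le x y"
  shows "\<tau> x \<le> \<tau> y"
proof -
  have "y - x \<in> positive_cone M"
    using assms by (auto simp: positive_cone_def op_le_def intro: M_diff)
  from trace_add[OF x this] show ?thesis by simp
qed

lemma trace_projection_mono:
  assumes "e \<in> projections M" "f \<in> projections M" "f o\<^sub>L e = e"
  shows "\<tau> e \<le> \<tau> f"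
  using positive_cone_projection[OF projections_diff[OF assms(2,1,3)]]
  by (intro trace_mono positive_cone_projection assms(1,2)) (simp add: op_le_def positive_cone_def)

text \<open>Normality for sequences: the strong limit of an increasing sequence is its least upper
  bound, because the quadratic forms converge pointwise.\<close>

lemma trace_limit_le:
  assumes y: "\<And>n. y n \<in> positive_cone M" and inc: "\<And>n. positive_operator (y (Suc n) - y n)"
    and x: "x \<in> positive_cone M" and lim: "\<And>v. (\<lambda>n. y n v) \<longlonglongrightarrow> blinfun_apply x v"
    and c: "\<And>n. \<tau> (y n) \<le> c"
  shows "\<tau> x \<le> c"
proof -
  have ysa: "self_adjoint (y n)" and xsa: "self_adjoint x" for n
    using y x by (auto simp: positive_cone_def positive_operator_iff)
  have le: "op_le (y m) (y (m + k))" for m k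
  proof (induction k)
    case (Suc k)
    have "y (m + Suc k) - y m = (y (Suc (m + k)) - y (m + k)) + (y (m + k) - y m)" by simp
    then show ?case
      using Suc inc[of "m + k"] positive_operator_add unfolding op_le_def by metis
  qed (simp add: op_le_def)
  have dir: "\<exists>w\<in>range y. op_le (y m) w \<and> op_le (y n) w" for m n
    using le[of m n] le[of n m] by (metis add.commute rangeI)
  have iny: "inner (y m v) v \<le> inner (y (m + k) v) v" for m k v
    using le[of m k] by (auto simp: op_le_def positive_operator_iff blinfun.diff_left inner_diff_left)
  have up: "op_le (y n) x" for n
  proof -
    have "inner (y n v) v \<le> inner (x v) v" for v
    proof (rule LIMSEQ_le_const)
      show "(\<lambda>n. inner (y n v) v) \<longlonglongrightarrow> inner (x v) v" by (intro tendsto_inner lim tendsto_const)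
      show "\<exists>N. \<forall>k\<ge>N. inner (y n v) v \<le> inner (y k v) v"
        using iny le_Suc_ex by blast
    qed
    then show ?thesis
      using ysa xsa by (auto simp: op_le_def positive_operator_iff blinfun.diff_left inner_diff_left)
  qed
  have least: "op_le x z" if z: "self_adjoint z" "\<And>n. op_le (y n) z" for z
  proof -
    have "inner (x v) v \<le> inner (z v) v" for v
    proof (rule LIMSEQ_le_const2)
      show "(\<lambda>n. inner (y n v) v) \<longlonglongrightarrow> inner (x v) v" by (intro tendsto_inner lim tendsto_const)
      show "\<exists>N. \<forall>k\<ge>N. inner (y k v) v \<le> inner (z v) v"
        using z(2) by (auto simp: op_le_def positive_operator_iff blinfun.diff_left inner_diff_left)
    qed
    then show ?thesis
      using z(1) xsa by (auto simp: op_le_def positive_operator_iff blinfun.diff_left inner_diff_left)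
  qed
  have "normal_weight M \<tau>"
    using fnstw by (simp add: faithful_normal_semifinite_tracial_weight_def)
  then have "\<tau> x = (SUP z\<in>range y. \<tau> z)"
    unfolding normal_weight_def by (rule allE[of _ "range y"], elim allE[of _ x] impE)
      (use y dir x up least in auto)
  also have "\<dots> \<le> c" using c by (auto intro: SUP_least)
  finally show ?thesis .
qed

text \<open>With \<open>v\<^sup>2 = 1 - T\<^sup>*T\<close> and \<open>w\<^sup>2 = 1 - TT\<^sup>*\<close>, the operators \<open>1 - w\<^sup>2\<^sup>n\<close> increase to the
  range projection of \<open>T\<close>. The increments of \<open>1 - w\<^sup>2\<^sup>n\<close> and \<open>1 - v\<^sup>2\<^sup>n\<close> are \<open>X X\<^sup>*\<close> and \<open>X\<^sup>* X\<close>
  for \<open>X = T v\<^sup>n\<close>, so these have the same trace, and \<open>1 - v\<^sup>2\<^sup>n \<le> e\<close>.\<close>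

lemma contraction_range_projection:
  assumes T: "T \<in> M" "norm T \<le> 1" and e: "e \<in> projections M" and Te: "T o\<^sub>L e = T"
  obtains R where "R \<in> projections M" "R o\<^sub>L T = T" "\<tau> R \<le> \<tau> e"
    "\<And>F. F \<in> bounded_operators \<Longrightarrow> F o\<^sub>L T = T \<Longrightarrow> F o\<^sub>L R = R"
proof -
  note Tb = M_bounded[OF T(1)] and e' = projectionsD[OF e]
  let ?S = "op_adjoint T"
  have Sb: "?S \<in> bounded_operators" and SM: "?S \<in> M" and SS: "op_adjoint ?S = T"
    using Tb M_adjoint[OF T(1)] by auto
  have nS: "norm ?S \<le> 1" using norm_op_adjoint_le[OF Tb] T(2) by linarith
  obtain w E where w: "self_adjoint w" "norm w \<le> 1" "w o\<^sub>L w = id_blinfun - (T o\<^sub>L ?S)"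
    "bicommutes w (T o\<^sub>L ?S)" and E: "self_adjoint E" "E o\<^sub>L E = E" "?S o\<^sub>L E = 0" "bicommutes E (T o\<^sub>L ?S)"
    and lim: "\<And>x. (\<lambda>n. op_power w (2 * n) x) \<longlonglongrightarrow> E x" and Efix: "\<And>x. ?S x = 0 \<Longrightarrow> E x = x"
    using kernel_projection[OF Sb nS, unfolded SS] by blast
  obtain v where v: "self_adjoint v" "v o\<^sub>L v = id_blinfun - (?S o\<^sub>L T)" "bicommutes v (?S o\<^sub>L T)"
    using square_root_complement[OF Tb T(2)] by blast
  have TSM: "T o\<^sub>L ?S \<in> M" "?S o\<^sub>L T \<in> M" using T(1) SM by (auto intro: M_compose)
  have wM: "w \<in> M" and EM: "E \<in> M" and vM: "v \<in> M"
    using M_bicommutes TSM w(1,4) E(1,4) v(1,3) by blast+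
  define W where "W n = op_power w n" for n
  define V where "V n = op_power v n" for n
  have WM: "W n \<in> M" and VM: "V n \<in> M" for n by (simp_all add: W_def V_def M_op_power wM vM)
  have Wsa: "self_adjoint (W n)" and Vsa: "self_adjoint (V n)" for n
    by (simp_all add: W_def V_def self_adjoint_op_power w(1) v(1))
  then have Wad: "op_adjoint (W n) = W n" and Vad: "op_adjoint (V n) = V n"
    and Wb: "W n \<in> bounded_operators" and Vb: "V n \<in> bounded_operators" for n
    by (auto simp: self_adjoint_def)
  have W2: "W (2 * n) = W n o\<^sub>L W n" and V2: "V (2 * n) = V n o\<^sub>L V n" for n
    by (simp_all add: W_def V_def mult_2 op_power_add)
  have WS: "W (2 * Suc n) = W (2 * n) o\<^sub>L (w o\<^sub>L w)" for n
    using op_power_add[of w "2 * n" 2] by (simp add: W_def numeral_2_eq_2)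
  have VS: "V (2 * Suc n) = V n o\<^sub>L (v o\<^sub>L v) o\<^sub>L V n" for n
  proof -
    have n: "2 * Suc n = n + Suc (Suc n)" by simp
    show ?thesis
      by (simp only: n V_def op_power_add op_power.simps op_assoc)
  qed
  have VS': "V (2 * Suc n) = v o\<^sub>L v o\<^sub>L V (2 * n)" for n
    by (simp add: V_def op_assoc)
  \<comment> \<open>With S the adjoint of \<open>T\<close>, this lifts
    \<open>T (1 - S T) = (1 - T S) T\<close> to powers. Even powers are compared because they are
    powers of \<open>v o\<^sub>L v\<close> and \<open>w o\<^sub>L w\<close>.\<close>
  have TV: "T o\<^sub>L V (2 * n) = W (2 * n) o\<^sub>L T" for n
  proof (induction n)
    case 0 then show ?case by (simp add: W_def V_def)
  next
    case (Suc n)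
    have "T o\<^sub>L V (2 * Suc n) = (T o\<^sub>L (v o\<^sub>L v)) o\<^sub>L V (2 * n)" by (simp only: VS' op_assoc)
    also have "T o\<^sub>L (v o\<^sub>L v) = (w o\<^sub>L w) o\<^sub>L T" by (simp add: v(2) w(3) op_ring)
    also have "\<dots> o\<^sub>L V (2 * n) = (w o\<^sub>L w) o\<^sub>L W (2 * n) o\<^sub>L T" by (simp add: op_assoc Suc)
    also have "(w o\<^sub>L w) o\<^sub>L W (2 * n) = W (2 * Suc n)" by (simp add: W_def op_assoc)
    finally show ?case .
  qed
  define X where "X n = T o\<^sub>L V n" for n
  have XM: "X n \<in> M" for n by (simp add: X_def M_compose T(1) VM)
  have Xad: "op_adjoint (X n) = V n o\<^sub>L ?S" for n
    by (simp add: X_def op_adjoint_compose Tb Vb Vad)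
  have XX: "X n o\<^sub>L op_adjoint (X n) = W (2 * n) - W (2 * Suc n)" for n
  proof -
    have "X n o\<^sub>L op_adjoint (X n) = (T o\<^sub>L V (2 * n)) o\<^sub>L ?S" unfolding Xad unfolding X_def V2 by (simp only: op_assoc)
    also have "\<dots> = W (2 * n) o\<^sub>L (T o\<^sub>L ?S)" unfolding TV by (simp only: op_assoc)
    also have "\<dots> = W (2 * n) - W (2 * Suc n)" by (simp only: WS w(3) op_ring) simp
    finally show ?thesis .
  qed
  have XX': "op_adjoint (X n) o\<^sub>L X n = V (2 * n) - V (2 * Suc n)" for n
  proof -
    have "op_adjoint (X n) o\<^sub>L X n = V n o\<^sub>L (?S o\<^sub>L T) o\<^sub>L V n" unfolding Xad unfolding X_def by (simp only: op_assoc)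
    also have "\<dots> = V (2 * n) - V (2 * Suc n)" unfolding VS v(2) unfolding V2 by (simp add: op_ring)
    finally show ?thesis .
  qed
  \<comment> \<open>Additivity of \<open>\<tau>\<close> is available on the positive cone, so
    membership is carried along in the induction; both sequences start at 0.\<close>
  have WV: "id_blinfun - W (2 * n) \<in> positive_cone M \<and> id_blinfun - V (2 * n) \<in> positive_cone M \<and>
      \<tau> (id_blinfun - W (2 * n)) = \<tau> (id_blinfun - V (2 * n))" for n
  proof (induction n)
    case 0
    show ?case using positive_cone_projection[OF projections_0] by (simp add: W_def V_def)
  next
    case (Suc n)
    have a: "id_blinfun - W (2 * Suc n) = (id_blinfun - W (2 * n)) + (X n o\<^sub>L op_adjoint (X n))"
      and b: "id_blinfun - V (2 * Suc n) = (id_blinfun - V (2 * n)) + (op_adjoint (X n) o\<^sub>L X n)"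
      unfolding XX XX' by simp_all
    have c: "X n o\<^sub>L op_adjoint (X n) \<in> positive_cone M" "op_adjoint (X n) o\<^sub>L X n \<in> positive_cone M"
      by (simp_all add: positive_cone_adjoint_compose positive_cone_compose_adjoint XM)
    show ?case unfolding a b using Suc c
      by (simp add: positive_cone_add trace_add trace_adjoint_commute XM)
  qed
  have Ve: "\<tau> (id_blinfun - V (2 * n)) \<le> \<tau> e" for n
  proof (rule trace_mono)
    show "id_blinfun - V (2 * n) \<in> positive_cone M" using WV by blast
    show "e \<in> positive_cone M" by (rule positive_cone_projection[OF e])
    \<comment> \<open>\<open>T\<close> kills the complement of \<open>e\<close>, so
      \<open>v o\<^sub>L v\<close> and its powers act there as the identity. This makes
      \<open>e - (1 - V (2 * n))\<close> the compression of \<open>V (2 * n)\<close> to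
      \<open>e\<close>, which is positive.\<close>
    have "V (2 * n) o\<^sub>L (id_blinfun - e) = id_blinfun - e"
    proof (induction n)
      case 0 then show ?case by (simp add: V_def)
    next
      case (Suc n)
      have "V (2 * Suc n) o\<^sub>L (id_blinfun - e) = v o\<^sub>L v o\<^sub>L (id_blinfun - e)"
        unfolding VS' op_assoc[of _ "V (2 * n)"] Suc ..
      also have "\<dots> = id_blinfun - e" unfolding v(2) by (simp add: op_ring Te)
      finally show ?case .
    qed
    then have Ve: "V (2 * n) o\<^sub>L e = V (2 * n) - (id_blinfun - e)"
      by (simp add: op_diff_right algebra_simps)
    have "e o\<^sub>L V (2 * n) = op_adjoint (V (2 * n) o\<^sub>L e)"
      by (simp add: op_adjoint_compose Vb Vad e')
    also have "\<dots> = V (2 * n) o\<^sub>L e"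
      unfolding Ve by (simp add: op_adjoint_diff Vb Vad e')
    finally have "V (2 * n) o\<^sub>L e = e o\<^sub>L V (2 * n) o\<^sub>L e" by (simp add: op_assoc e')
    also have "\<dots> = op_adjoint (V n o\<^sub>L e) o\<^sub>L (V n o\<^sub>L e)"
      by (simp add: V2 op_assoc op_adjoint_compose Vb Vad e')
    finally have "e - (id_blinfun - V (2 * n)) = op_adjoint (V n o\<^sub>L e) o\<^sub>L (V n o\<^sub>L e)"
      using Ve by (simp add: algebra_simps)
    then show "op_le (id_blinfun - V (2 * n)) e"
      unfolding op_le_def using positive_operator_adjoint_compose[of "V n o\<^sub>L e"] Vb e'(5) by simp
  qed
  \<comment> \<open>\<open>E\<close> projects onto the kernel of the adjoint of \<open>T\<close>,
    whose orthogonal complement is the closure of the range of \<open>T\<close>.\<close>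
  define R where "R = id_blinfun - E"
  have "E \<in> projections M" using EM E(1,2) by (simp add: projections_def)
  then have RP: "R \<in> projections M" unfolding R_def by (rule projection_complement)
  show thesis
  proof (rule that[OF RP])
    have "E o\<^sub>L T = op_adjoint (?S o\<^sub>L E)"
      using E(1) by (simp add: op_adjoint_compose Sb SS self_adjoint_def)
    then show "R o\<^sub>L T = T" by (simp add: R_def op_diff_left E(3))
    show "\<tau> R \<le> \<tau> e"
    proof (rule trace_limit_le)
      show "id_blinfun - W (2 * n) \<in> positive_cone M" for n using WV by blast
      have "(id_blinfun - W (2 * Suc n)) - (id_blinfun - W (2 * n)) = X n o\<^sub>L op_adjoint (X n)" for n
        unfolding XX by simp
      then show "positive_operator ((id_blinfun - W (2 * Suc n)) - (id_blinfun - W (2 * n)))" for n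
        using positive_cone_compose_adjoint[OF XM] by (simp add: positive_cone_def)
      show "R \<in> positive_cone M" by (rule positive_cone_projection[OF RP])
      show "(\<lambda>n. (id_blinfun - W (2 * n)) x) \<longlonglongrightarrow> R x" for x
        unfolding R_def blinfun.diff_left W_def by (intro tendsto_diff tendsto_const lim)
      show "\<tau> (id_blinfun - W (2 * n)) \<le> \<tau> e" for n using WV Ve by metis
    qed
    fix F :: "'h operator" assume F: "F \<in> bounded_operators" "F o\<^sub>L T = T"
    \<comment> \<open>Minimality is proved on the adjoint side: the range of
      \<open>1 - op_adjoint F\<close> lies in the kernel of \<open>?S\<close>, so \<open>E\<close>
      fixes it.\<close>
    have "?S o\<^sub>L op_adjoint F = ?S" using F Tb by (metis op_adjoint_compose)
    then have "?S (x - op_adjoint F x) = 0" for x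
      by (metis blinfun.diff_right blinfun_apply_blinfun_compose diff_self)
    then have "E o\<^sub>L (id_blinfun - op_adjoint F) = id_blinfun - op_adjoint F"
      by (intro blinfun_eqI) (simp add: Efix blinfun.diff_left)
    then have "R o\<^sub>L op_adjoint F = R"
      by (simp add: R_def op_diff_left op_diff_right algebra_simps)
    then show "F o\<^sub>L R = R"
      using F(1) projectionsD[OF RP] by (metis op_adjoint_compose op_adjoint_op_adjoint op_adjoint_bounded_operators)
  qed
qed

lemma range_projection:
  assumes T: "T \<in> M" and e: "e \<in> projections M" and Te: "T o\<^sub>L e = T"
  obtains R where "R \<in> projections M" "R o\<^sub>L T = T" "\<tau> R \<le> \<tau> e"
    "\<And>F. F \<in> bounded_operators \<Longrightarrow> F o\<^sub>L T = T \<Longrightarrow> F o\<^sub>L R = R"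
proof -
  \<comment> \<open>The summand 1 keeps \<open>c\<close> positive when \<open>T = 0\<close>.\<close>
  define c where "c = 1 + norm T"
  have c: "c > 0" by (simp add: c_def add_pos_nonneg)
  define T' where "T' = (1/c) *\<^sub>R T"
  have T': "T' \<in> M" "T' o\<^sub>L e = T'" using T Te by (auto simp: T'_def M_scaleR op_scaleR_left)
  have "norm T' \<le> 1" using c by (simp add: T'_def c_def field_simps)
  obtain R where R: "R \<in> projections M" "R o\<^sub>L T' = T'" "\<tau> R \<le> \<tau> e"
    "\<And>F. F \<in> bounded_operators \<Longrightarrow> F o\<^sub>L T' = T' \<Longrightarrow> F o\<^sub>L R = R"
    using contraction_range_projection[OF T'(1) \<open>norm T' \<le> 1\<close> e T'(2)] by blast
  have iff: "F o\<^sub>L T' = T' \<longleftrightarrow> F o\<^sub>L T = T" for F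
    using c by (simp add: T'_def op_scaleR_right)
  show thesis using that R unfolding iff by blast
qed


section \<open>Joins of projections and operators with support of finite trace\<close>

lemma PF_iff: "e \<in> PF M \<tau> \<longleftrightarrow> e \<in> projections M \<and> \<tau> e < \<infinity>"
  by (simp add: PF_def)

lemma PF_0 [simp]: "0 \<in> PF M \<tau>"
  by (simp add: PF_iff)

text \<open>Only the part of \<open>G\<close> outside \<open>P\<close> is added, through the range
  projection of \<open>(1 - P) G\<close>. Minimality makes this projection orthogonal to
  \<open>P\<close>, and its trace is at most that of \<open>G\<close>.\<close>

lemma projections_join:
  assumes P: "P \<in> projections M" and G: "G \<in> projections M"
  obtains V where "V \<in> projections M" "V o\<^sub>L P = P" "V o\<^sub>L G = G" "\<tau> V \<le> \<tau> P + \<tau> G"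
proof -
  note P' = projectionsD[OF P] and G' = projectionsD[OF G]
  define T where "T = (id_blinfun - P) o\<^sub>L G"
  have TM: "T \<in> M" unfolding T_def by (intro M_intros P' G')
  have TG: "T o\<^sub>L G = T" by (simp add: T_def op_assoc G')
  obtain R where R: "R \<in> projections M" "R o\<^sub>L T = T" "\<tau> R \<le> \<tau> G"
    and Rmin: "\<And>F. F \<in> bounded_operators \<Longrightarrow> F o\<^sub>L T = T \<Longrightarrow> F o\<^sub>L R = R"
    using range_projection[OF TM G TG] by blast
  have "(id_blinfun - P) o\<^sub>L T = T" by (simp add: T_def op_ring P' op_assoc[symmetric])
  then have "(id_blinfun - P) o\<^sub>L R = R" using Rmin P' by blast
  then have PR: "P o\<^sub>L R = 0" by (simp add: op_diff_left)
  have RP: "R o\<^sub>L P = 0" using projection_swap[OF P R(1) PR] by simp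
  have "R o\<^sub>L G = R o\<^sub>L T" by (simp add: T_def op_ring RP op_assoc[symmetric])
  then have RG: "R o\<^sub>L G = G - (P o\<^sub>L G)" using R(2) by (simp add: T_def op_diff_left)
  show thesis
  proof (rule that[of "P + R"])
    show "P + R \<in> projections M" by (rule projections_add[OF P R(1) PR])
    show "(P + R) o\<^sub>L P = P" by (simp add: op_add_left P' RP)
    show "(P + R) o\<^sub>L G = G" by (simp add: op_add_left RG)
    show "\<tau> (P + R) \<le> \<tau> P + \<tau> G"
      using trace_add[of P R] R positive_cone_projection P by (simp add: add_left_mono)
  qed
qed

lemma PF_join:
  assumes P: "P \<in> PF M \<tau>" and G: "G \<in> PF M \<tau>"
  obtains V where "V \<in> PF M \<tau>" "V o\<^sub>L P = P" "V o\<^sub>L G = G" "\<tau> V \<le> \<tau> P + \<tau> G"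
proof -
  obtain V where V: "V \<in> projections M" "V o\<^sub>L P = P" "V o\<^sub>L G = G" "\<tau> V \<le> \<tau> P + \<tau> G"
    using projections_join[of P G] P G by (auto simp: PF_iff)
  have "\<tau> V < \<infinity>" using V(4) P G by (auto simp: PF_iff ennreal_add_eq_top intro: le_less_trans)
  then show thesis using V that by (simp add: PF_iff)
qed

text \<open>The range of \<open>x e y\<close> lies under the range projection of \<open>x e\<close>,
  whose trace is at most that of \<open>e\<close>. In this form closure under sums reduces to
  joining two projections.\<close>

lemma FI_iff: "z \<in> FI M \<tau> \<longleftrightarrow> z \<in> M \<and> (\<exists>G\<in>PF M \<tau>. G o\<^sub>L z = z)"
proof
  assume "z \<in> FI M \<tau>"
  then obtain x e y where z: "z = x o\<^sub>L e o\<^sub>L y" "e \<in> PF M \<tau>" "x \<in> M" "y \<in> M"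
    by (auto simp: FI_def)
  have e: "e \<in> projections M" "\<tau> e < \<infinity>" using z(2) by (auto simp: PF_iff)
  have "x o\<^sub>L e \<in> M" "(x o\<^sub>L e) o\<^sub>L e = x o\<^sub>L e"
    using z(3) projectionsD[OF e(1)] by (auto simp: op_assoc intro: M_compose)
  then obtain R where R: "R \<in> projections M" "R o\<^sub>L (x o\<^sub>L e) = x o\<^sub>L e" "\<tau> R \<le> \<tau> e"
    using range_projection[OF _ e(1)] by blast
  have "R o\<^sub>L z = z" unfolding z(1) op_assoc[symmetric] R(2)[unfolded op_assoc[symmetric]] ..
  moreover have "z \<in> M" using z projectionsD[OF e(1)] by (auto intro: M_compose)
  moreover have "R \<in> PF M \<tau>" using R(1,3) e(2) by (simp add: PF_iff le_less_trans)
  ultimately show "z \<in> M \<and> (\<exists>G\<in>PF M \<tau>. G o\<^sub>L z = z)" by blast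
next
  assume "z \<in> M \<and> (\<exists>G\<in>PF M \<tau>. G o\<^sub>L z = z)"
  then obtain G where "z \<in> M" "G \<in> PF M \<tau>" "z = id_blinfun o\<^sub>L G o\<^sub>L z" by auto
  then show "z \<in> FI M \<tau>" unfolding FI_def using M_id by blast
qed

lemma FI_add:
  assumes "x \<in> FI M \<tau>" "y \<in> FI M \<tau>"
  shows "x + y \<in> FI M \<tau>"
proof -
  obtain P G where P: "P \<in> PF M \<tau>" "P o\<^sub>L x = x" and G: "G \<in> PF M \<tau>" "G o\<^sub>L y = y"
    using assms unfolding FI_iff by blast
  obtain V where V: "V \<in> PF M \<tau>" "V o\<^sub>L P = P" "V o\<^sub>L G = G" using PF_join[OF P(1) G(1)] by blast
  have "V o\<^sub>L x = x" "V o\<^sub>L y = y" using P(2) G(2) V(2,3) by (metis op_assoc)+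
  then have "V o\<^sub>L (x + y) = x + y" by (simp add: op_add_right)
  then show ?thesis using assms V(1) unfolding FI_iff by (auto intro: M_add)
qed

lemma FI_0 [simp]: "0 \<in> FI M \<tau>"
  unfolding FI_iff by (intro conjI bexI[of _ 0]) simp_all

lemma FI_sum: "(\<And>i. i \<in> A \<Longrightarrow> f i \<in> FI M \<tau>) \<Longrightarrow> (\<Sum>i\<in>A. f i) \<in> FI M \<tau>"
  by (induction A rule: infinite_finite_induct) (auto intro: FI_add)

text \<open>The subprojection is the spectral projection for \<open>(\<parallel>y\<parallel>/2, \<infinity>)\<close> of a positive \<open>y \<le> p\<close> of
  finite trace.\<close>

lemma nonzero_PF_subprojection:
  assumes p: "p \<in> projections M" "p \<noteq> 0"
  obtains g where "g \<in> PF M \<tau>" "g \<noteq> 0" "g o\<^sub>L p = g"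
proof -
  have "semifinite M \<tau>" using fnstw by (simp add: faithful_normal_semifinite_tracial_weight_def)
  then obtain y where y: "y \<in> positive_cone M" "y \<noteq> 0" "op_le y p" "\<tau> y < \<infinity>"
    using positive_cone_projection[OF p(1)] p(2) unfolding semifinite_def by blast
  have yM: "y \<in> M" and ypos: "positive_operator y" and ysa: "self_adjoint y"
    using y(1) by (auto simp: positive_cone_def positive_operator_iff)
  have yin: "0 \<le> inner (y v) v" for v using ypos by (simp add: positive_operator_iff)
  note p' = projectionsD[OF p(1)]
  define r where "r = norm y"
  have r: "r > 0" using y(2) by (simp add: r_def)
  define g where "g = y - (r/2) *\<^sub>R id_blinfun"
  have gsa: "self_adjoint g" unfolding g_def using ysa by blast
  obtain E s where E: "self_adjoint E" "E o\<^sub>L E = E" "bicommutes E g" and s: "positive_operator s"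
    "bicommutes s g" and gs: "g = s o\<^sub>L (2 *\<^sub>R E - id_blinfun)"
    using sign_decomposition[OF gsa] by blast
  have sin: "0 \<le> inner (s v) v" for v using s by (simp add: positive_operator_iff)
  have gy: "bicommutes g y" unfolding g_def by (intro bicommutes_intros)
  have Ey: "bicommutes E y" using E(3) gy bicommutes_trans by blast
  have EM: "E \<in> M" using M_bicommutes[OF yM Ey] E(1) by blast
  have EP: "E \<in> projections M" using E EM by (simp add: projections_def)
  have Eyc: "E o\<^sub>L y = y o\<^sub>L E" using bicommutes_commute[OF Ey] by simp
  have sE: "E o\<^sub>L s = s o\<^sub>L E" using bicommutesD[OF s(2)] bicommutes_commute[OF E(3)] by blast
  have gE: "g o\<^sub>L E = s o\<^sub>L E" unfolding gs by (simp add: op_ring op_scaleR_left E(2) scaleR_2 op_add_right)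
  \<comment> \<open>\<open>E = 0\<close> would mean \<open>y \<le> r/2\<close>. By
    \<open>positive_operator_norm_le\<close> the norm of \<open>y\<close> would then be at most
    \<open>sqrt (1/2) * r\<close>, short of \<open>r = norm y\<close>.\<close>
  have E0: "E \<noteq> 0"
  proof
    assume "E = 0"
    then have "s = (r/2) *\<^sub>R id_blinfun - y" using gs by (simp add: op_minus_right g_def minus_equation_iff algebra_simps)
    then have le: "inner (y v) v \<le> r/2 * (norm v)\<^sup>2" for v
      using sin[of v] by (simp add: blinfun.diff_left blinfun.scaleR_left inner_diff_left power2_norm_eq_inner)
    have "norm (y v) \<le> sqrt (1/2) * r * norm v" for v
    proof (rule power2_le_imp_le)
      have "(norm (y v))\<^sup>2 \<le> r * inner (y v) v"
        by (rule positive_operator_norm_le[OF ypos]) (simp add: r_def)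
      also have "\<dots> \<le> r * (r/2 * (norm v)\<^sup>2)" using le r by (intro mult_left_mono) auto
      also have "\<dots> = (sqrt (1/2) * r * norm v)\<^sup>2" by (simp add: power_mult_distrib real_sqrt_divide power_divide power2_eq_square)
      finally show "(norm (y v))\<^sup>2 \<le> (sqrt (1/2) * r * norm v)\<^sup>2" .
      show "0 \<le> sqrt (1/2) * r * norm v" using r by simp
    qed
    then have "norm y \<le> sqrt (1/2) * r" using r by (intro norm_blinfun_bound) auto
    then have "1 * r \<le> sqrt (1/2) * r" by (simp add: r_def)
    then have "1 \<le> sqrt (1/2)" using r by (simp only: mult_le_cancel_right)
    moreover have "sqrt (1/2) < 1" by simp
    ultimately show False by linarith
  qed
  \<comment> \<open>A Chebyshev estimate: \<open>(r/2) E \<le> y E \<le> y\<close>.\<close>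
  have trE: "\<tau> E < \<infinity>"
  proof -
    have EyE: "y o\<^sub>L E = op_adjoint E o\<^sub>L y o\<^sub>L E" using E Eyc by (simp add: self_adjoint_def op_assoc)
    have pE: "positive_operator (op_adjoint E o\<^sub>L x o\<^sub>L E)" if "positive_operator x" "E \<in> bounded_operators" for x E
      using that self_adjoint_sandwich[of x E]
      by (auto simp: positive_operator_iff cinner_op_adjoint_left Re_cinner[symmetric])
    have yE: "y o\<^sub>L E \<in> positive_cone M"
      unfolding EyE using pE[OF ypos] E(1) EM yM by (auto intro!: positive_coneI M_intros)
    define F where "F = id_blinfun - E"
    have F: "F \<in> projections M" unfolding F_def by (rule projection_complement[OF EP])
    have "y - (y o\<^sub>L E) = y o\<^sub>L F" by (simp add: F_def op_diff_right)
    moreover have "F o\<^sub>L y = y o\<^sub>L F" by (simp add: F_def op_diff_right op_diff_left Eyc)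
    ultimately have "y - (y o\<^sub>L E) = op_adjoint F o\<^sub>L y o\<^sub>L F"
      using projectionsD[OF F] by (simp add: op_assoc)
    then have "op_le (y o\<^sub>L E) y" unfolding op_le_def using pE[OF ypos] projectionsD[OF F] by metis
    then have "\<tau> (y o\<^sub>L E) \<le> \<tau> y" by (intro trace_mono yE y(1))
    have "y o\<^sub>L E = (r/2) *\<^sub>R E + (g o\<^sub>L E)" by (simp add: g_def op_diff_left op_scaleR_left)
    also have "g o\<^sub>L E = op_adjoint E o\<^sub>L s o\<^sub>L E" unfolding gE using E sE by (simp add: self_adjoint_def op_assoc)
    finally have "(y o\<^sub>L E) - (r/2) *\<^sub>R E = op_adjoint E o\<^sub>L s o\<^sub>L E"
      by (simp only: add_diff_cancel_left')
    then have "op_le ((r/2) *\<^sub>R E) (y o\<^sub>L E)" unfolding op_le_def using pE[OF s(1)] E(1) by auto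
    moreover have Ec: "E \<in> positive_cone M" by (rule positive_cone_projection[OF EP])
    moreover have "(r/2) *\<^sub>R E \<in> positive_cone M"
      using Ec r by (auto simp: positive_cone_def intro: M_scaleR positive_operator_scaleR)
    ultimately have "\<tau> ((r/2) *\<^sub>R E) \<le> \<tau> (y o\<^sub>L E)" using yE by (intro trace_mono)
    also have "\<dots> \<le> \<tau> y" by fact
    finally have "ennreal (r/2) * \<tau> E < \<infinity>"
      using y(4) r trace_scaleR[OF Ec, of "r/2"] by (auto intro: le_less_trans)
    then show ?thesis using r by (auto simp: ennreal_mult_less_top)
  qed
  \<comment> \<open>If \<open>p u = 0\<close> then \<open>y u = 0\<close>, and
    \<open>z = E u\<close> is killed by \<open>y\<close> too. So \<open>g z = - (r/2) z\<close>,
    while \<open>g\<close> agrees with the positive \<open>s\<close> on the range of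
    \<open>E\<close>; hence \<open>z = 0\<close>.\<close>
  have "E o\<^sub>L (id_blinfun - p) = 0"
  proof (rule blinfun_eqI)
    fix v
    define u where "u = (id_blinfun - p) v"
    define z where "z = E u"
    have pu: "p u = 0"
      by (metis (no_types, lifting) blinfun.diff_left blinfun.diff_right blinfun_apply_blinfun_compose blinfun_apply_id_blinfun diff_self p'(3) u_def)
    have "inner (y u) u \<le> inner (p u) u"
      using y(3) by (auto simp: op_le_def positive_operator_iff blinfun.diff_left inner_diff_left)
    then have "inner (y u) u = 0" using yin[of u] pu by simp
    then have "y u = 0" using positive_operator_norm_le[OF ypos order_refl, of u] by simp
    then have "y z = 0"
      unfolding z_def by (metis Eyc blinfun.zero_right blinfun_apply_blinfun_compose)
    then have gz: "g z = - (r/2) *\<^sub>R z" by (simp add: g_def blinfun.diff_left blinfun.scaleR_left)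
    have Ez: "E z = z" unfolding z_def by (metis E(2) blinfun_apply_blinfun_compose)
    have "s z = g z" using gE Ez by (metis blinfun_apply_blinfun_compose)
    then have "0 \<le> - (r/2) * inner z z" using sin[of z] gz by simp
    then have "inner z z \<le> 0" using r by (simp add: mult_le_0_iff zero_le_mult_iff)
    then have "z = 0" by (metis inner_eq_zero_iff inner_ge_zero order_antisym)
    then show "(E o\<^sub>L (id_blinfun - p)) v = blinfun_apply 0 v" by (simp add: z_def u_def)
  qed
  then have "E o\<^sub>L p = E" by (simp add: op_diff_right)
  then show thesis using that[of E] EP trE E0 by (simp add: PF_iff)
qed

text \<open>Expresses that the supremum of the \<open>e n\<close> is 1, in the form in which it is
  applied: a limit projection orthogonal to all of them vanishes.\<close>

definition exhausting :: "(nat \<Rightarrow> 'h operator) \<Rightarrow> bool" where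
  "exhausting e \<longleftrightarrow> (\<forall>q\<in>projections M. (\<forall>n. q o\<^sub>L e n = 0) \<longrightarrow> q = 0)"

text \<open>A maximal orthogonal family of nonzero projections of finite trace is countable by
  hypothesis, and semifiniteness would enlarge it if some nonzero projection were orthogonal to all
  its members.\<close>

lemma exhausting_sequence:
  assumes cd: "countably_decomposable M"
  obtains e :: "nat \<Rightarrow> 'h operator" where "\<And>n. e n \<in> PF M \<tau>" "\<And>m n. m \<noteq> n \<Longrightarrow> e m o\<^sub>L e n = 0"
    "exhausting e"
proof -
  define A where "A = {P. P \<subseteq> PF M \<tau> - {0} \<and> pairwise (\<lambda>e f. e o\<^sub>L f = 0) P}"
  have "\<exists>P\<in>A. \<forall>X\<in>A. P \<subseteq> X \<longrightarrow> X = P"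
  proof (rule subset_Zorn_nonempty)
    show "A \<noteq> {}" unfolding A_def by (rule ex_in_conv[THEN iffD1], rule exI[of _ "{}"]) simp
    fix C assume C: "C \<noteq> {}" "subset.chain A C"
    then have CA: "C \<subseteq> A" by (simp add: subset_chain_def)
    have "pairwise (\<lambda>e f. e o\<^sub>L f = 0) (\<Union>C)"
    proof (rule pairwiseI)
      fix x z assume "x \<in> \<Union>C" "z \<in> \<Union>C" "x \<noteq> z"
      then obtain X Z where XZ: "X \<in> C" "x \<in> X" "Z \<in> C" "z \<in> Z" by blast
      then have "X \<subseteq> Z \<or> Z \<subseteq> X" using C(2) by (auto simp: subset_chain_def)
      then obtain Y where "Y \<in> C" "x \<in> Y" "z \<in> Y" using XZ by blast
      then show "x o\<^sub>L z = 0" using CA \<open>x \<noteq> z\<close> by (auto simp: A_def pairwise_def)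
    qed
    then show "\<Union>C \<in> A" using CA by (auto simp: A_def)
  qed
  then obtain P where PA: "P \<in> A" and Pmax: "\<forall>X\<in>A. P \<subseteq> X \<longrightarrow> X = P" by blast
  then have P: "P \<subseteq> PF M \<tau> - {0}" "pairwise (\<lambda>e f. e o\<^sub>L f = 0) P" by (simp_all add: A_def)
  have Pproj: "P \<subseteq> projections M - {0}" using P(1) by (auto simp: PF_iff)
  then have cP: "countable P" using cd P(2) by (auto simp: countably_decomposable_def)
  define e where "e n = (if n \<in> to_nat_on P ` P then from_nat_into P n else 0)" for n
  have eP: "e n \<in> P \<or> e n = 0" for n
    using cP by (auto simp: e_def)
  have Pe: "x \<in> range e" if "x \<in> P" for x
    using that cP by (intro range_eqI[of _ _ "to_nat_on P x"]) (simp add: e_def)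
  show thesis
  proof (rule that[of e])
    show "e n \<in> PF M \<tau>" for n using eP[of n] P(1) PF_0 by auto
    show "e m o\<^sub>L e n = 0" if "m \<noteq> n" for m n
    proof (cases "m \<in> to_nat_on P ` P \<and> n \<in> to_nat_on P ` P")
      case True
      then obtain x z where "x \<in> P" "z \<in> P" "m = to_nat_on P x" "n = to_nat_on P z" by blast
      with that cP have "e m = x" "e n = z" "x \<noteq> z" by (auto simp: e_def)
      with \<open>x \<in> P\<close> \<open>z \<in> P\<close> P(2) show ?thesis by (auto simp: pairwise_def)
    next
      case False then show ?thesis by (auto simp: e_def)
    qed
    show "exhausting e"
      unfolding exhausting_def
    proof (intro ballI impI)
      fix q assume q: "q \<in> projections M" "\<forall>n. q o\<^sub>L e n = 0"
      have qP: "q o\<^sub>L x = 0" if "x \<in> P" for x using Pe[OF that] q(2) by auto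
      show "q = 0"
      proof (rule ccontr)
        assume "q \<noteq> 0"
        then obtain g where g: "g \<in> PF M \<tau>" "g \<noteq> 0" "g o\<^sub>L q = g"
          using nonzero_PF_subprojection[OF q(1)] by blast
        have gP: "g \<in> projections M" using g(1) by (simp add: PF_iff)
        have gx: "g o\<^sub>L x = 0" "x o\<^sub>L g = 0" if "x \<in> P" for x
        proof -
          show *: "g o\<^sub>L x = 0" using qP[OF that] g(3) by (metis op_assoc blinfun_compose_zero(2))
          show "x o\<^sub>L g = 0" using projection_swap[OF gP _ *] that Pproj by auto
        qed
        have "insert g P \<in> A"
          using P g(1,2) gx by (auto simp: A_def pairwise_insert)
        then have "g \<in> P" using Pmax by blast
        then have "g o\<^sub>L g = 0" using gx by blast
        then show False using g(2) projectionsD[OF gP] by simp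
      qed
    qed
  qed
qed

text \<open>The squared distance of \<open>Q m x\<close> and \<open>Q n x\<close> is a difference of
  terms of a decreasing sequence, so a strong limit exists. It is a projection in \<open>M\<close>
  orthogonal to every \<open>e i\<close>.\<close>

lemma decreasing_projections_tendsto_0:
  assumes Q: "\<And>n. Q n \<in> projections M" and dec: "\<And>n. Q n o\<^sub>L Q (Suc n) = Q (Suc n)"
    and e: "\<And>i n. i < n \<Longrightarrow> Q n o\<^sub>L e i = 0"
    and exh: "exhausting e"
  shows "(\<lambda>n. Q n x) \<longlonglongrightarrow> 0"
proof -
  note Q' = projectionsD[OF Q]
  have decm: "Q m o\<^sub>L Q (m + k) = Q (m + k)" for m k
  proof (induction k)
    case (Suc k)
    have "Q m o\<^sub>L Q (m + Suc k) = (Q m o\<^sub>L Q (m + k)) o\<^sub>L Q (Suc (m + k))" by (simp add: dec op_assoc)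
    then show ?case by (simp add: Suc dec)
  qed (simp add: Q')
  have C: "Cauchy (\<lambda>n. Q n x)" for x
  proof -
    define \<alpha> where "\<alpha> n = (norm (Q n x))\<^sup>2" for n
    have in1: "inner (Q m x) (Q (m + k) x) = \<alpha> (m + k)" for m k
    proof -
      have "inner (Q m x) (Q (m + k) x) = inner x (Q (m + k) x)"
        by (metis Q'(2) decm blinfun_apply_blinfun_compose self_adjoint_inner)
      also have "\<dots> = inner (Q (m + k) x) (Q (m + k) x)"
        by (metis Q'(2,3) blinfun_apply_blinfun_compose self_adjoint_inner)
      finally show ?thesis by (simp add: \<alpha>_def power2_norm_eq_inner)
    qed
    have d: "(norm (Q m x - Q (m + k) x))\<^sup>2 = \<alpha> m - \<alpha> (m + k)" for m k
    proof -
      have "(norm (Q m x - Q (m + k) x))\<^sup>2 = \<alpha> m - 2 * inner (Q m x) (Q (m + k) x) + \<alpha> (m + k)"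
        by (simp add: \<alpha>_def power2_norm_eq_inner inner_diff_left inner_diff_right inner_commute)
      then show ?thesis unfolding in1 by simp
    qed
    have dec\<alpha>: "decseq \<alpha>"
    proof (rule decseq_SucI)
      show "\<alpha> (Suc n) \<le> \<alpha> n" for n
        using d[of n 1] zero_le_power2[of "norm (Q n x - Q (n + 1) x)"] by simp
    qed
    have "Bseq \<alpha>"
      by (rule BseqI'[of _ "\<alpha> 0"]) (use decseqD[OF dec\<alpha>, of 0] in \<open>simp add: \<alpha>_def\<close>)
    then have "convergent \<alpha>" by (simp add: Bseq_monoseq_convergent decseq_imp_monoseq[OF dec\<alpha>])
    then have C\<alpha>: "Cauchy \<alpha>" by (rule convergent_Cauchy)
    show ?thesis
    proof (rule metric_CauchyI)
      fix \<epsilon> :: real assume "\<epsilon> > 0"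
      then have "\<epsilon>\<^sup>2 > 0" by simp
      then obtain N where N: "\<And>m n. m \<ge> N \<Longrightarrow> n \<ge> N \<Longrightarrow> dist (\<alpha> m) (\<alpha> n) < \<epsilon>\<^sup>2"
        using metric_CauchyD[OF C\<alpha>] by blast
      have *: "dist (Q m x) (Q n x) < \<epsilon>" if mn: "m \<ge> N" "n \<ge> N" "m \<le> n" for m n
      proof -
        obtain k where k: "n = m + k" using mn(3) le_Suc_ex by blast
        have "(norm (Q m x - Q n x))\<^sup>2 < \<epsilon>\<^sup>2"
          unfolding k d using N[OF mn(1,2)] by (simp add: dist_real_def k)
        then show ?thesis using \<open>\<epsilon> > 0\<close> by (simp add: dist_norm power2_less_imp_less)
      qed
      then have "\<forall>m\<ge>N. \<forall>n\<ge>N. dist (Q m x) (Q n x) < \<epsilon>"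
        by (metis dist_commute linorder_le_cases)
      then show "\<exists>N. \<forall>m\<ge>N. \<forall>n\<ge>N. dist (Q m x) (Q n x) < \<epsilon>" by blast
    qed
  qed
  obtain R where R: "R \<in> bounded_operators" and lim: "\<And>x. (\<lambda>n. Q n x) \<longlonglongrightarrow> R x"
    using strong_limit_exists[OF Q'(5) norm_projection_le[OF Q] C] by blast
  have Rsa: "self_adjoint R" by (rule strong_limit_self_adjoint[OF Q'(2) R lim])
  have RM: "R \<in> M" by (rule M_strong_limit[OF Q'(1) R lim])
  \<comment> \<open>All later \<open>Q\<close> lie under \<open>Q m\<close>, so \<open>Q m\<close>
    fixes the limit; idempotence of \<open>R\<close> follows by letting \<open>m\<close>
    grow.\<close>
  have QR: "Q m (R y) = R y" for m y
  proof -
    have "(\<lambda>k. Q m (Q (k + m) y)) \<longlonglongrightarrow> Q m (R y)"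
      by (rule blinfun.tendsto[OF tendsto_const LIMSEQ_ignore_initial_segment[OF lim]])
    moreover have "Q m (Q (k + m) y) = Q (k + m) y" for k
      using decm[of m k] by (metis add.commute blinfun_apply_blinfun_compose)
    moreover have "(\<lambda>k. Q (k + m) y) \<longlonglongrightarrow> R y" by (rule LIMSEQ_ignore_initial_segment[OF lim])
    ultimately show ?thesis using LIMSEQ_unique by fastforce
  qed
  have "R (R y) = R y" for y
    using lim[of "R y"] QR[of _ y] by (simp add: LIMSEQ_const_iff)
  then have "R o\<^sub>L R = R" by (intro blinfun_eqI) simp
  then have RP: "R \<in> projections M" using RM Rsa by (simp add: projections_def)
  have "R o\<^sub>L e i = 0" for i
  proof (rule blinfun_eqI)
    fix y
    have "(\<lambda>k. Q (k + Suc i) (e i y)) \<longlonglongrightarrow> R (e i y)" by (rule LIMSEQ_ignore_initial_segment[OF lim])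
    moreover have "Q (k + Suc i) (e i y) = 0" for k
    proof -
      have "i < k + Suc i" by simp
      from arg_cong[OF e[OF this], of "\<lambda>S. S y"] show ?thesis by simp
    qed
    ultimately have "R (e i y) = 0" by (simp add: LIMSEQ_const_iff)
    then show "(R o\<^sub>L e i) y = blinfun_apply 0 y" by simp
  qed
  then have "R = 0" using exh RP by (simp add: exhausting_def)
  then show ?thesis using lim[of x] by simp
qed

text \<open>If the trace of 1 were finite, an equivalence of 1 with a subprojection \<open>q\<close>
  would give \<open>1 - q\<close> trace 0, so faithfulness would make the central projection 1
  finite. \<open>nz\<close> excludes the zero space, where proper infiniteness holds
  vacuously.\<close>

lemma trace_id_infinite:
  assumes inf: "properly_infinite M" and nz: "(id_blinfun :: 'h operator) \<noteq> 0"
  shows "\<tau> id_blinfun = \<infinity>"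
proof (rule ccontr)
  assume "\<tau> id_blinfun \<noteq> \<infinity>"
  then have fin: "\<tau> id_blinfun < \<infinity>" by (simp add: top.not_eq_extremum)
  have "finite_projection M id_blinfun"
    unfolding finite_projection_def
  proof (intro conjI ballI impI)
    fix q assume q: "q \<in> projections M" "op_le q id_blinfun \<and> mvn_equiv M id_blinfun q"
    then obtain v where v: "v \<in> M" "op_adjoint v o\<^sub>L v = id_blinfun" "v o\<^sub>L op_adjoint v = q"
      by (auto simp: mvn_equiv_def)
    then have e: "\<tau> id_blinfun = \<tau> q" using trace_adjoint_commute[OF v(1)] by simp
    have c: "id_blinfun - q \<in> positive_cone M" by (intro positive_cone_projection projection_complement q)
    have "\<tau> id_blinfun = \<tau> q + \<tau> (id_blinfun - q)"
      using trace_add[OF positive_cone_projection[OF q(1)] c] by simp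
    then have "\<tau> (id_blinfun - q) = 0" using e fin by (auto simp: ennreal_add_left_cancel)
    then have "id_blinfun - q = 0" by (rule trace_faithful[OF c])
    then show "q = id_blinfun" by simp
  qed simp
  moreover have "id_blinfun \<in> commutant M"
    by (simp add: commutant_def)
  ultimately show False using inf nz by (auto simp: properly_infinite_def)
qed

text \<open>The partial sums of an exhausting family increase strongly to 1, so by normality a
  common bound on their traces would bound the trace of 1.\<close>

lemma PF_trace_unbounded:
  assumes cd: "countably_decomposable M" and inf: "properly_infinite M"
    and nz: "(id_blinfun :: 'h operator) \<noteq> 0"
  obtains G where "G \<in> PF M \<tau>" "enn2real (\<tau> G) > T"
proof -
  obtain e where ePF: "\<And>n. e n \<in> PF M \<tau>" and orth: "\<And>m n. m \<noteq> n \<Longrightarrow> e m o\<^sub>L e n = 0"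
    and exh: "exhausting e"
    using exhausting_sequence[OF cd] by blast
  have eP: "e n \<in> projections M" and ef: "\<tau> (e n) < \<infinity>" for n using ePF[of n] by (simp_all add: PF_iff)
  define S where "S n = (\<Sum>i<n. e i)" for n
  have SP: "S n \<in> projections M" for n unfolding S_def by (intro projections_sum) (use eP orth in auto)
  have Se: "S n o\<^sub>L e i = (if i < n then e i else 0)" for n i
    by (induction n) (auto simp: S_def op_add_left orth projectionsD[OF eP] less_Suc_eq)
  have SS: "S n o\<^sub>L S n = S n" for n using SP projectionsD by blast
  have SSuc: "S (Suc n) = S n + e n" for n by (simp add: S_def)
  have eS: "e n o\<^sub>L S n = 0" for n
    using projection_swap[OF SP eP, of n n 0] Se[of n n] by simp
  have tS: "\<tau> (S n) < \<infinity>" for n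
  proof (induction n)
    case (Suc n)
    then show ?case
      unfolding SSuc using trace_add[OF positive_cone_projection[OF SP] positive_cone_projection[OF eP]] ef
      by simp
  qed (simp add: S_def)
  have lim: "(\<lambda>n. (id_blinfun - S n) x) \<longlonglongrightarrow> 0" for x
  proof (rule decreasing_projections_tendsto_0[OF _ _ _ exh])
    show "id_blinfun - S n \<in> projections M" for n by (intro projection_complement SP)
    show "(id_blinfun - S n) o\<^sub>L (id_blinfun - S (Suc n)) = id_blinfun - S (Suc n)" for n
      using Se[of n n] by (simp add: SSuc op_ring SS)
    show "(id_blinfun - S n) o\<^sub>L e i = 0" if "i < n" for i n
      using that by (simp add: op_diff_left Se)
  qed
  have lim': "(\<lambda>n. S n x) \<longlonglongrightarrow> id_blinfun x" for x
    using tendsto_diff[OF tendsto_const[of x] lim[of x]] by (simp add: blinfun.diff_left)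
  show thesis
  proof (rule ccontr)
    assume "\<not> thesis"
    then have "enn2real (\<tau> (S n)) \<le> T" for n
      using that[of "S n"] SP[of n] tS[of n] by (cases "enn2real (\<tau> (S n)) \<le> T") (simp_all add: PF_iff)
    then have "\<tau> (S n) \<le> ennreal T" for n
      using tS[of n] by (metis ennreal_enn2real ennreal_leI infinity_ennreal_def)
    then have "\<tau> id_blinfun \<le> ennreal T"
      by (intro trace_limit_le[OF positive_cone_projection[OF SP] _ positive_cone_projection lim'])
        (use positive_cone_projection[OF eP] in \<open>auto simp: SSuc positive_cone_def\<close>)
    then show False using trace_id_infinite[OF inf nz] by (simp add: top_unique)
  qed
qed

end

section \<open>Norm ideals\<close>

locale normed_ideal = tracial_von_neumann M \<tau>
  for M :: "'h::complex_hilbert operator set" and \<tau> :: "'h operator \<Rightarrow> ennreal" +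
  fixes J :: "'h operator set" and \<Phi> :: "'h operator \<Rightarrow> real"
  assumes ni: "norm_ideal M \<tau> J \<Phi>"
begin

section \<open>Elementary rules for the ideal and its norm\<close>

lemma J_M: "x \<in> J \<Longrightarrow> x \<in> M"
  and J_0 [simp]: "0 \<in> J"
  and J_add: "x \<in> J \<Longrightarrow> y \<in> J \<Longrightarrow> x + y \<in> J"
  and J_scaleC: "x \<in> J \<Longrightarrow> op_scaleC c x \<in> J"
  and J_left: "m \<in> M \<Longrightarrow> x \<in> J \<Longrightarrow> m o\<^sub>L x \<in> J"
  and J_right: "m \<in> M \<Longrightarrow> x \<in> J \<Longrightarrow> x o\<^sub>L m \<in> J"
  and FI_J: "x \<in> FI M \<tau> \<Longrightarrow> x \<in> J"
  using ni by (auto simp: norm_ideal_def two_sided_ideal_def)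

lemma \<Phi>_nonneg: "x \<in> J \<Longrightarrow> 0 \<le> \<Phi> x"
  and \<Phi>_scaleC: "x \<in> J \<Longrightarrow> \<Phi> (op_scaleC c x) = cmod c * \<Phi> x"
  and \<Phi>_triangle: "x \<in> J \<Longrightarrow> y \<in> J \<Longrightarrow> \<Phi> (x + y) \<le> \<Phi> x + \<Phi> y"
  using ni by (simp_all add: norm_ideal_def is_norm_on_def)

lemma \<Phi>_0 [simp]: "\<Phi> 0 = 0"
  using ni J_0 by (simp add: norm_ideal_def is_norm_on_def)

lemma \<Phi>_unitary:
  "x \<in> J \<Longrightarrow> u \<in> unitaries M \<Longrightarrow> v \<in> unitaries M \<Longrightarrow> \<Phi> (u o\<^sub>L x o\<^sub>L v) = \<Phi> x"
  using ni by (simp add: norm_ideal_def)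

lemma J_scaleR: "x \<in> J \<Longrightarrow> r *\<^sub>R x \<in> J"
  by (metis J_scaleC op_scaleC_of_real)

lemma \<Phi>_scaleR: "x \<in> J \<Longrightarrow> \<Phi> (r *\<^sub>R x) = \<bar>r\<bar> * \<Phi> x"
  by (metis \<Phi>_scaleC op_scaleC_of_real norm_of_real)

lemma J_diff: "x \<in> J \<Longrightarrow> y \<in> J \<Longrightarrow> x - y \<in> J"
  using J_add[of x "(-1) *\<^sub>R y"] J_scaleR[of y "-1"] by simp

lemma \<Phi>_triangle_diff: "x \<in> J \<Longrightarrow> y \<in> J \<Longrightarrow> \<Phi> (x - y) \<le> \<Phi> x + \<Phi> y"
  using \<Phi>_triangle[of x "(-1) *\<^sub>R y"] J_scaleR[of y "-1"] \<Phi>_scaleR[of y "-1"] by simp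

lemma \<Phi>_minus_commute: "x \<in> J \<Longrightarrow> y \<in> J \<Longrightarrow> \<Phi> (x - y) = \<Phi> (y - x)"
  using \<Phi>_scaleR[of "x - y" "-1"] J_diff[of x y] by simp

lemma unitary_id [simp]: "id_blinfun \<in> unitaries M"
  by (simp add: unitaries_def)

lemma op_scaleC_minus: "op_scaleC (- c) T = - op_scaleC c T"
  by (intro blinfun_eqI)
    (metis blinfun.minus_left op_scaleC_apply op_scaleC_of_real op_scaleC_scaleC
      mult_minus1 of_real_1 of_real_minus scaleR_minus1_left)

lemma op_scaleC_diff: "op_scaleC c (S - T) = op_scaleC c S - op_scaleC c T"
  by (intro blinfun_eqI) (simp add: op_scaleC_apply blinfun.diff_left scaleC_diff_right)

lemma op_scaleC_one [simp]: "op_scaleC 1 T = T"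
  using op_scaleC_of_real[of 1 T] by simp

text \<open>The operator form of writing a cosine as the mean of two conjugate exponentials: the
  unitaries are \<open>x + i w\<close> and \<open>x - i w\<close>, where \<open>w\<close> is the
  square root of \<open>1 - x o\<^sub>L x\<close> and commutes with \<open>x\<close>.\<close>

lemma self_adjoint_contraction_unitaries:
  assumes x: "x \<in> M" "self_adjoint x" "norm x \<le> 1"
  obtains u v where "u \<in> unitaries M" "v \<in> unitaries M" "x = (1/2) *\<^sub>R (u + v)"
proof -
  have xb: "x \<in> bounded_operators" and xad: "op_adjoint x = x" using x(2) by (auto simp: self_adjoint_def)
  obtain w where w: "self_adjoint w" "w o\<^sub>L w = id_blinfun - (x o\<^sub>L x)" "bicommutes w (x o\<^sub>L x)"
    using square_root_complement[OF xb x(3)] unfolding xad by blast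
  have wM: "w \<in> M" using M_bicommutes[OF M_compose[OF x(1,1)] w(3)] w(1) by blast
  have wb: "w \<in> bounded_operators" and wad: "op_adjoint w = w" using w(1) by (auto simp: self_adjoint_def)
  have xw: "x o\<^sub>L w = w o\<^sub>L x" using bicommutesD[OF w(3), of x] by (simp add: op_assoc)
  have prod: "(x + op_scaleC c w) o\<^sub>L (x + op_scaleC (- c) w) = id_blinfun" if "c * c = -1" for c
    using that w(2)
    by (simp add: op_ring op_scaleC_left op_scaleC_right xb wb op_scaleC_scaleC op_scaleC_diff
        op_scaleC_minus xw)
  have "x + op_scaleC \<i> w \<in> unitaries M" "x + op_scaleC (- \<i>) w \<in> unitaries M"
    using prod[of \<i>] prod[of "- \<i>"] x(1) wM
    by (auto simp: unitaries_def op_adjoint_add op_adjoint_scaleC xb wb xad wad intro: M_intros)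
  moreover have "x = (1/2) *\<^sub>R ((x + op_scaleC \<i> w) + (x + op_scaleC (- \<i>) w))"
    by (simp add: op_scaleC_minus scaleR_2[symmetric])
  ultimately show thesis by (rule that)
qed

lemma \<Phi>_mult_self_adjoint_contraction:
  assumes x: "x \<in> M" "self_adjoint x" "norm x \<le> 1" and y: "y \<in> J"
  shows "\<Phi> (x o\<^sub>L y) \<le> \<Phi> y" "\<Phi> (y o\<^sub>L x) \<le> \<Phi> y"
proof -
  obtain u v where u: "u \<in> unitaries M" and v: "v \<in> unitaries M" and xuv: "x = (1/2) *\<^sub>R (u + v)"
    using self_adjoint_contraction_unitaries[OF x] .
  have M: "u \<in> M" "v \<in> M" using u v by (auto simp: unitaries_def)
  have "\<Phi> (x o\<^sub>L y) = 1/2 * \<Phi> ((u o\<^sub>L y) + (v o\<^sub>L y))"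
    using M y by (simp add: xuv op_scaleR_left op_add_left \<Phi>_scaleR J_left J_add)
  also have "\<dots> \<le> 1/2 * (\<Phi> (u o\<^sub>L y) + \<Phi> (v o\<^sub>L y))"
    using \<Phi>_triangle[OF J_left[OF M(1) y] J_left[OF M(2) y]] by simp
  finally show "\<Phi> (x o\<^sub>L y) \<le> \<Phi> y"
    using \<Phi>_unitary[OF y u unitary_id] \<Phi>_unitary[OF y v unitary_id] by simp
  have "\<Phi> (y o\<^sub>L x) = 1/2 * \<Phi> ((y o\<^sub>L u) + (y o\<^sub>L v))"
    using M y by (simp add: xuv op_scaleR_right op_add_right \<Phi>_scaleR J_right J_add)
  also have "\<dots> \<le> 1/2 * (\<Phi> (y o\<^sub>L u) + \<Phi> (y o\<^sub>L v))"
    using \<Phi>_triangle[OF J_right[OF M(1) y] J_right[OF M(2) y]] by simp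
  finally show "\<Phi> (y o\<^sub>L x) \<le> \<Phi> y"
    using \<Phi>_unitary[OF y unitary_id u] \<Phi>_unitary[OF y unitary_id v] by simp
qed

lemma cartesian_decomposition:
  assumes x: "x \<in> M"
  obtains h k where "h \<in> M" "k \<in> M" "self_adjoint h" "self_adjoint k" "norm h \<le> norm x"
    "norm k \<le> norm x" "x = h + op_scaleC \<i> k"
proof -
  note xb = M_bounded[OF x]
  define h where "h = (1/2) *\<^sub>R (x + op_adjoint x)"
  define k where "k = (1/2) *\<^sub>R op_scaleC (- \<i>) (x - op_adjoint x)"
  show thesis
  proof (rule that)
    show "h \<in> M" "k \<in> M" unfolding h_def k_def by (intro M_intros x)+
    show "self_adjoint h"
      using xb by (simp add: self_adjoint_def h_def op_adjoint_scaleR op_adjoint_add add.commute)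
    have "op_scaleC \<i> (op_adjoint x - x) = op_scaleC (- \<i>) (x - op_adjoint x)"
      by (intro blinfun_eqI) (simp add: op_scaleC_minus op_scaleC_apply blinfun.minus_left blinfun.diff_left scaleC_diff_right)
    then show "self_adjoint k"
      using xb by (simp add: self_adjoint_def k_def op_adjoint_scaleR op_adjoint_scaleC op_adjoint_diff)
    have ad: "norm (op_adjoint x) \<le> norm x" by (rule norm_op_adjoint_le[OF xb])
    show "norm h \<le> norm x" using norm_triangle_ineq[of x "op_adjoint x"] ad by (simp add: h_def)
    show "norm k \<le> norm x"
      using norm_triangle_ineq4[of x "op_adjoint x"] ad norm_op_scaleC_le[of "- \<i>" "x - op_adjoint x"]
      by (simp add: k_def)
    have "op_scaleC \<i> k = (1/2) *\<^sub>R (x - op_adjoint x)"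
      unfolding k_def op_scaleC_of_real[symmetric] op_scaleC_scaleC by simp
    then show "x = h + op_scaleC \<i> k"
      by (simp add: h_def scaleR_add_right[symmetric] scaleR_2[symmetric])
  qed
qed

text \<open>Unitary invariance reaches general multipliers by writing self-adjoint contractions as
  means of two unitaries and \<open>x\<close> through its two self-adjoint parts. The latter costs
  the factor 2.\<close>

lemma \<Phi>_mult_le:
  assumes x: "x \<in> M" and y: "y \<in> J"
  shows "\<Phi> (x o\<^sub>L y) \<le> 2 * norm x * \<Phi> y" "\<Phi> (y o\<^sub>L x) \<le> 2 * norm x * \<Phi> y"
proof -
  have sa: "\<Phi> (h o\<^sub>L y) \<le> norm x * \<Phi> y \<and> \<Phi> (y o\<^sub>L h) \<le> norm x * \<Phi> y"
    if h: "h \<in> M" "self_adjoint h" "norm h \<le> norm x" for h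
  proof (cases "norm x = 0")
    case True
    then show ?thesis using h by simp
  next
    case False
    then have c: "norm x > 0" by simp
    define h' where "h' = (1 / norm x) *\<^sub>R h"
    have h': "h' \<in> M" "self_adjoint h'" "norm h' \<le> 1" and hh: "h = norm x *\<^sub>R h'"
      using h c by (auto simp: h'_def intro: M_scaleR)
    have "\<Phi> (h o\<^sub>L y) = norm x * \<Phi> (h' o\<^sub>L y)" "\<Phi> (y o\<^sub>L h) = norm x * \<Phi> (y o\<^sub>L h')"
      unfolding hh using h'(1) y by (simp_all add: op_scaleR_left op_scaleR_right \<Phi>_scaleR J_left J_right)
    then show ?thesis
      using \<Phi>_mult_self_adjoint_contraction[OF h' y] c by (simp add: mult_left_mono)
  qed
  obtain h k where hk: "h \<in> M" "k \<in> M" "self_adjoint h" "self_adjoint k" "norm h \<le> norm x"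
    "norm k \<le> norm x" "x = h + op_scaleC \<i> k"
    using cartesian_decomposition[OF x] .
  have yb: "y \<in> bounded_operators" using M_bounded J_M y by blast
  have "x o\<^sub>L y = (h o\<^sub>L y) + op_scaleC \<i> (k o\<^sub>L y)"
    unfolding hk(7) by (simp add: op_add_left op_scaleC_left)
  then have "\<Phi> (x o\<^sub>L y) \<le> \<Phi> (h o\<^sub>L y) + \<Phi> (k o\<^sub>L y)"
    using \<Phi>_triangle[OF J_left[OF hk(1) y] J_scaleC[OF J_left[OF hk(2) y]], of \<i>]
      \<Phi>_scaleC[OF J_left[OF hk(2) y], of \<i>] by simp
  then show "\<Phi> (x o\<^sub>L y) \<le> 2 * norm x * \<Phi> y"
    using sa[OF hk(1,3,5)] sa[OF hk(2,4,6)] by linarith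
  have "y o\<^sub>L x = (y o\<^sub>L h) + op_scaleC \<i> (y o\<^sub>L k)"
    unfolding hk(7) by (simp add: op_add_right op_scaleC_right yb)
  then have "\<Phi> (y o\<^sub>L x) \<le> \<Phi> (y o\<^sub>L h) + \<Phi> (y o\<^sub>L k)"
    using \<Phi>_triangle[OF J_right[OF hk(1) y] J_scaleC[OF J_right[OF hk(2) y]], of \<i>]
      \<Phi>_scaleC[OF J_right[OF hk(2) y], of \<i>] by simp
  then show "\<Phi> (y o\<^sub>L x) \<le> 2 * norm x * \<Phi> y"
    using sa[OF hk(1,3,5)] sa[OF hk(2,4,6)] by linarith
qed

lemma FI_compose_PF: "P \<in> PF M \<tau> \<Longrightarrow> x \<in> M \<Longrightarrow> y \<in> M \<Longrightarrow> x o\<^sub>L P o\<^sub>L y \<in> FI M \<tau>"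
  by (auto simp: FI_def)

lemma PF_FI: "P \<in> PF M \<tau> \<Longrightarrow> P \<in> FI M \<tau>"
  using FI_compose_PF[of P id_blinfun id_blinfun] by simp

text \<open>Joining \<open>P\<close> with a fixed \<open>G\<close> of large finite trace makes the ratio condition applicable to
  every \<open>P\<close> of finite trace, at the cost of an additive constant.\<close>

lemma \<Phi>_PF_le:
  assumes cd: "countably_decomposable M" and inf: "properly_infinite M"
    and ratio: "ratio_tends_to_zero M \<tau> \<Phi>" and \<eta>: "\<eta> > 0"
  obtains C where "C \<ge> 0" "\<And>P. P \<in> PF M \<tau> \<Longrightarrow> \<Phi> P \<le> C + \<eta> * enn2real (\<tau> P)"
proof (cases "(id_blinfun :: 'h operator) = 0")
  \<comment> \<open>The zero space carries no projection of large trace, but there every operator is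
    0.\<close>
  case True
  show thesis
  proof (rule that[of 0])
    fix P :: "'h operator"
    have "P = 0" using op_id_left[of P] unfolding True by simp
    then show "\<Phi> P \<le> 0 + \<eta> * enn2real (\<tau> P)" by simp
  qed simp
next
  case False
  \<comment> \<open>Half of \<open>\<eta>\<close> absorbs the factor 2 lost when
    \<open>P = P V\<close> is estimated by \<open>\<Phi>_mult_le\<close>.\<close>
  obtain T where T: "T > 0"
    "\<And>e. e \<in> PF M \<tau> \<Longrightarrow> enn2real (\<tau> e) > T \<Longrightarrow> \<Phi> e / enn2real (\<tau> e) < \<eta> / 2"
    using ratio \<eta> unfolding ratio_tends_to_zero_def by (metis half_gt_zero)
  obtain G where G: "G \<in> PF M \<tau>" "enn2real (\<tau> G) > T" using PF_trace_unbounded[OF cd inf False] .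
  define C where "C = \<eta> * enn2real (\<tau> G)"
  have "\<Phi> P \<le> C + \<eta> * enn2real (\<tau> P)" if P: "P \<in> PF M \<tau>" for P
  proof -
    obtain V where V: "V \<in> PF M \<tau>" "V o\<^sub>L P = P" "V o\<^sub>L G = G" "\<tau> V \<le> \<tau> P + \<tau> G"
      using PF_join[OF P G(1)] .
    have pr: "P \<in> projections M" "V \<in> projections M" "G \<in> projections M"
      and fin: "\<tau> P < \<infinity>" "\<tau> V < \<infinity>" "\<tau> G < \<infinity>"
      using P V(1) G(1) by (auto simp: PF_iff)
    have "\<tau> G \<le> \<tau> V" by (rule trace_projection_mono[OF pr(3,2) V(3)])
    then have "enn2real (\<tau> G) \<le> enn2real (\<tau> V)" using fin by (intro enn2real_mono) auto
    then have tV: "enn2real (\<tau> V) > T" using G(2) by linarith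
    then have "\<Phi> V \<le> \<eta> / 2 * enn2real (\<tau> V)"
      using T(2)[OF V(1) tV] T(1) by (simp add: pos_divide_less_eq)
    also have "enn2real (\<tau> V) \<le> enn2real (\<tau> P + \<tau> G)"
      using V(4) fin by (intro enn2real_mono) auto
    also have "\<dots> = enn2real (\<tau> P) + enn2real (\<tau> G)"
      using fin by (simp add: enn2real_plus)
    finally have 1: "2 * \<Phi> V \<le> \<eta> * (enn2real (\<tau> P) + enn2real (\<tau> G))" using \<eta> by (simp add: mult_left_mono)
    have VJ: "V \<in> J" by (intro FI_J PF_FI V(1))
    have "P o\<^sub>L V = P" using projection_swap[OF pr(2,1) V(2)] projectionsD(2)[OF pr(1)] by blast
    then have "\<Phi> P \<le> 2 * norm P * \<Phi> V"
      using \<Phi>_mult_le(1)[OF projectionsD(1)[OF pr(1)] VJ] by simp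
    also have "\<dots> \<le> 2 * 1 * \<Phi> V"
      using norm_projection_le[OF pr(1)] \<Phi>_nonneg[OF VJ] by (intro mult_right_mono mult_left_mono) auto
    finally show ?thesis using 1 by (simp add: C_def algebra_simps)
  qed
  moreover have "C \<ge> 0" using \<eta> by (simp add: C_def)
  ultimately show thesis using that by blast
qed

subsection \<open>Splitting off a diagonal block\<close>

lemma FI_scaleR:
  assumes "x \<in> FI M \<tau>" shows "r *\<^sub>R x \<in> FI M \<tau>"
  using assms unfolding FI_iff by (auto simp: op_scaleR_right intro: M_scaleR)

lemma FI_diff: "x \<in> FI M \<tau> \<Longrightarrow> y \<in> FI M \<tau> \<Longrightarrow> x - y \<in> FI M \<tau>"
  using FI_add[of x "(-1) *\<^sub>R y"] FI_scaleR[of y "-1"] by simp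

text \<open>With \<open>P\<close> the sum of the \<open>f j\<close>, this is the error in replacing
  the corner of \<open>Q\<close> by the corner of \<open>Q - P\<close> plus the diagonal part. The
  two corners telescope when blocks are iterated.\<close>

definition remainder ::
    "'h operator \<Rightarrow> 'h operator \<Rightarrow> nat \<Rightarrow> (nat \<Rightarrow> 'h operator) \<Rightarrow> (nat \<Rightarrow> real) \<Rightarrow> 'h operator" where
  "remainder a Q n f l = (Q o\<^sub>L a o\<^sub>L Q)
    - ((Q - (\<Sum>j<n. f j)) o\<^sub>L a o\<^sub>L (Q - (\<Sum>j<n. f j))) - (\<Sum>j<n. l j *\<^sub>R f j)"

text \<open>The condition on \<open>e\<close> makes the next corner orthogonal to \<open>e\<close>,
  so iterating along an exhausting sequence leaves nothing; the bound on \<open>l j\<close> is the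
  same for all blocks.\<close>

definition diagonal_block ::
    "'h operator \<Rightarrow> 'h operator \<Rightarrow> 'h operator \<Rightarrow> real \<Rightarrow>
      nat \<Rightarrow> (nat \<Rightarrow> 'h operator) \<Rightarrow> (nat \<Rightarrow> real) \<Rightarrow> bool" where
  "diagonal_block a Q e \<delta> n f l \<longleftrightarrow>
    (\<forall>j<n. f j \<in> projections M \<and> \<bar>l j\<bar> \<le> norm a \<and> Q o\<^sub>L f j = f j) \<and>
    (\<forall>i<n. \<forall>j<n. i \<noteq> j \<longrightarrow> f i o\<^sub>L f j = 0) \<and>
    (Q - (\<Sum>j<n. f j)) o\<^sub>L e = 0 \<and>
    remainder a Q n f l \<in> FI M \<tau> \<and> \<Phi> (remainder a Q n f l) \<le> \<delta>"

text \<open>The projections \<open>f j\<close> are the range projections of \<open>E j Q e\<close> for a spectral partition \<open>E\<close> of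
  \<open>b = Q a Q\<close> into \<open>2\<^sup>m\<close> pieces. With \<open>P = \<Sum> f j\<close> and \<open>R = b - \<Sum> l j E j\<close> the remainder is
  \<open>R P + P R - P R P\<close>, so its \<open>\<Phi>\<close>-norm is at most \<open>8 \<parallel>R\<parallel> \<Phi>(P)\<close>, where \<open>\<parallel>R\<parallel> = O(2\<^sup>-\<^sup>m)\<close> and
  \<open>\<tau>(P) \<le> 2\<^sup>m \<tau>(e)\<close>, hence \<open>\<Phi>(P) = o(2\<^sup>m)\<close>.\<close>

lemma diagonal_block_exists:
  assumes cd: "countably_decomposable M" and inf: "properly_infinite M"
    and ratio: "ratio_tends_to_zero M \<tau> \<Phi>"
    and a: "a \<in> M" "self_adjoint a" and Q: "Q \<in> projections M" and e: "e \<in> PF M \<tau>" and \<delta>: "\<delta> > 0"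
  shows "\<exists>n f l. diagonal_block a Q e \<delta> n f l"
proof -
  note Q' = projectionsD[OF Q]
  have eP: "e \<in> projections M" and efin: "\<tau> e < \<infinity>" using e by (auto simp: PF_iff)
  note e' = projectionsD[OF eP]
  define b where "b = Q o\<^sub>L a o\<^sub>L Q"
  have bM: "b \<in> M" unfolding b_def by (intro M_intros a Q')
  have bsa: "self_adjoint b"
    using self_adjoint_sandwich[OF a(2) Q'(5)] by (simp add: b_def Q'(4))
  have Qb: "Q o\<^sub>L b = b" and bQ: "b o\<^sub>L Q = b"
    unfolding b_def using Q'(3) by (simp_all add: op_assoc) (simp add: op_assoc[symmetric])
  have nb: "norm b \<le> norm a"
  proof -
    have "norm b \<le> norm (Q o\<^sub>L a) * norm Q" unfolding b_def by (rule norm_blinfun_compose)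
    also have "\<dots> \<le> (norm Q * norm a) * norm Q" by (intro mult_right_mono norm_blinfun_compose) simp
    also have "\<dots> \<le> (1 * norm a) * 1"
      by (intro mult_mono mult_right_mono norm_projection_le[OF Q]) auto
    finally show ?thesis by simp
  qed
  define t where "t = enn2real (\<tau> e)"
  have t0: "t \<ge> 0" by (simp add: t_def)
  define \<beta> where "\<beta> = norm b + 1"
  have \<beta>0: "\<beta> > 0" by (simp add: \<beta>_def add_nonneg_pos)
  \<comment> \<open>The final bound is
    \<open>8 * \<beta> * C / 2 ^ m + 8 * \<beta> * \<eta> * t\<close>. This \<open>\<eta>\<close>
    makes the second term at most \<open>\<delta> / 2\<close>; it determines \<open>C\<close>, after
    which \<open>m\<close> is chosen for the first term. The 1 added in \<open>\<beta>\<close> and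
    in \<open>t + 1\<close> avoids division by 0.\<close>
  define \<eta> where "\<eta> = \<delta> / (16 * \<beta> * (t + 1))"
  have \<eta>0: "\<eta> > 0" using \<delta> \<beta>0 t0 by (simp add: \<eta>_def)
  obtain C where C: "C \<ge> 0" "\<And>P. P \<in> PF M \<tau> \<Longrightarrow> \<Phi> P \<le> C + \<eta> * enn2real (\<tau> P)"
    using \<Phi>_PF_le[OF cd inf ratio \<eta>0] by blast
  obtain m :: nat where m: "16 * \<beta> * C / \<delta> < 2 ^ m"
    using real_arch_pow[of 2 "16 * \<beta> * C / \<delta>"] by auto
  obtain E l where sp: "spectral_partition b (2 ^ m) E" and l: "\<And>j. \<bar>l j\<bar> \<le> norm b - norm b / 2 ^ m"
    and approx: "norm (b - (\<Sum>j<2 ^ m. l j *\<^sub>R E j)) \<le> norm b / 2 ^ m"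
    using spectral_approximation[OF bsa, of m] by blast
  define n :: nat where "n = 2 ^ m"
  have Esa: "self_adjoint (E j)" and Ei: "E j o\<^sub>L E j = E j" and Eb: "bicommutes (E j) b" for j
    using sp by (simp_all add: spectral_partition_def)
  have Eorth: "i < n \<Longrightarrow> j < n \<Longrightarrow> i \<noteq> j \<Longrightarrow> E i o\<^sub>L E j = 0" for i j
    using sp by (simp add: spectral_partition_def n_def)
  have Esum: "(\<Sum>j<n. E j) = id_blinfun"
    using sp by (simp add: spectral_partition_def n_def)
  have EM: "E j \<in> M" for j using M_bicommutes[OF bM Eb] Esa by blast
  have EP: "E j \<in> projections M" for j using EM Esa Ei by (simp add: projections_def)
  have QE: "Q o\<^sub>L E j = E j o\<^sub>L Q" for j using bicommutesD[OF Eb] Qb bQ by simp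
  define T where "T j = E j o\<^sub>L Q o\<^sub>L e" for j
  have TM: "T j \<in> M" for j unfolding T_def by (intro M_intros EM Q' e')
  have Te: "T j o\<^sub>L e = T j" for j by (simp add: T_def op_assoc e')
  have ET: "E j o\<^sub>L T j = T j" for j by (simp add: T_def op_assoc[symmetric] Ei)
  have QT: "Q o\<^sub>L T j = T j" for j
    by (simp add: T_def op_assoc[symmetric] QE) (simp add: op_assoc Q' op_assoc[symmetric, of Q Q])
  \<comment> \<open>Minimality of the range projection transfers domination by \<open>E j\<close>
    and by \<open>Q\<close> from \<open>T j\<close> to it.\<close>
  have "\<exists>R. R \<in> projections M \<and> R o\<^sub>L T j = T j \<and> \<tau> R \<le> \<tau> e \<and> E j o\<^sub>L R = R \<and> Q o\<^sub>L R = R" for j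
  proof -
    obtain R where R: "R \<in> projections M" "R o\<^sub>L T j = T j" "\<tau> R \<le> \<tau> e"
      "\<And>F. F \<in> bounded_operators \<Longrightarrow> F o\<^sub>L T j = T j \<Longrightarrow> F o\<^sub>L R = R"
      using range_projection[OF TM eP Te] by blast
    show ?thesis using R(1-3) R(4)[OF M_bounded[OF EM] ET] R(4)[OF Q'(5) QT] by blast
  qed
  then obtain f where f: "\<And>j. f j \<in> projections M" and fT: "\<And>j. f j o\<^sub>L T j = T j"
    and f\<tau>: "\<And>j. \<tau> (f j) \<le> \<tau> e" and Ef: "\<And>j. E j o\<^sub>L f j = f j" and Qf: "\<And>j. Q o\<^sub>L f j = f j"
    by metis
  note f' = projectionsD[OF f]
  have fE: "f j o\<^sub>L E j = f j" for j using projection_swap[OF EP f Ef f'(2)] .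
  have Ef0: "E j o\<^sub>L f i = 0" if "i < n" "j < n" "i \<noteq> j" for i j
  proof -
    have "E j o\<^sub>L f i = (E j o\<^sub>L E i) o\<^sub>L f i" by (simp add: op_assoc Ef)
    then show ?thesis using Eorth[of j i] that by simp
  qed
  have ff0: "f i o\<^sub>L f j = 0" if "i < n" "j < n" "i \<noteq> j" for i j
  proof -
    have "f i o\<^sub>L f j = f i o\<^sub>L (E i o\<^sub>L f j)" by (simp add: op_assoc[symmetric] fE)
    then show ?thesis using Ef0[of j i] that by simp
  qed
  define P where "P = (\<Sum>j<n. f j)"
  have PP: "P \<in> projections M" unfolding P_def by (intro projections_sum) (use f ff0 in auto)
  note P' = projectionsD[OF PP]
  have Ptr: "\<tau> P \<le> of_nat n * \<tau> e"
  proof -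
    have "(\<Sum>j<k. f j) \<in> positive_cone M \<and> \<tau> (\<Sum>j<k. f j) \<le> of_nat k * \<tau> e" for k
    proof (induction k)
      case 0 show ?case using positive_cone_projection[OF projections_0] by simp
    next
      case (Suc k)
      then have "\<tau> (\<Sum>j<Suc k. f j) = \<tau> (\<Sum>j<k. f j) + \<tau> (f k)"
        using trace_add positive_cone_projection[OF f] by simp
      also have "\<dots> \<le> of_nat k * \<tau> e + \<tau> e" using Suc f\<tau> by (intro add_mono) auto
      finally show ?case
        using Suc positive_cone_add positive_cone_projection[OF f] by (simp add: algebra_simps)
    qed
    then show ?thesis by (simp add: P_def)
  qed
  have nfin: "of_nat n * \<tau> e < \<infinity>" using efin by (simp add: ennreal_mult_less_top of_nat_less_top)
  then have PPF: "P \<in> PF M \<tau>" using PP Ptr by (auto simp: PF_iff intro: le_less_trans)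
  have QP: "Q o\<^sub>L P = P" by (simp add: P_def op_sum_right Qf)
  have PQ: "P o\<^sub>L Q = P" using projection_swap[OF Q PP QP P'(2)] .
  have PT: "P o\<^sub>L T j = T j" if "j < n" for j
  proof -
    have "f i o\<^sub>L T j = (if i = j then T j else 0)" if "i < n" for i
    proof (cases "i = j")
      case False
      have "f i o\<^sub>L T j = (f i o\<^sub>L f j) o\<^sub>L T j" by (simp add: op_assoc fT)
      then show ?thesis using ff0[OF that \<open>j < n\<close> False] False by simp
    qed (simp add: fT)
    then have "P o\<^sub>L T j = (\<Sum>i<n. if i = j then T j else 0)" by (simp add: P_def op_sum_left)
    then show ?thesis using that by simp
  qed
  \<comment> \<open>The pieces \<open>E j\<close> sum to 1, so \<open>P\<close> fixes all of
    \<open>Q e\<close>; this is what makes \<open>Q - P\<close> orthogonal to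
    \<open>e\<close>.\<close>
  have "Q o\<^sub>L e = (\<Sum>j<n. T j)"
    unfolding T_def op_assoc op_sum_left[symmetric] Esum by simp
  then have "P o\<^sub>L (Q o\<^sub>L e) = Q o\<^sub>L e" by (simp add: op_sum_right PT)
  then have Pe: "P o\<^sub>L e = Q o\<^sub>L e" by (simp add: op_assoc[symmetric] PQ)
  define D where "D = (\<Sum>j<n. l j *\<^sub>R E j)"
  define L where "L = (\<Sum>j<n. l j *\<^sub>R f j)"
  define R where "R = b - D"
  have DM: "D \<in> M" unfolding D_def by (intro M_intros EM)
  have RM: "R \<in> M" unfolding R_def by (intro M_intros bM DM)
  \<comment> \<open>Because \<open>f j\<close> lies under \<open>E j\<close> alone, \<open>P\<close>
    commutes with every \<open>E j\<close>, and so \<open>D\<close> has no part between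
    \<open>P\<close> and its complement.\<close>
  have EjP: "E j o\<^sub>L P = f j" if "j < n" for j
  proof -
    have "E j o\<^sub>L P = (\<Sum>i<n. if i = j then f j else 0)"
      unfolding P_def op_sum_right using that Ef Ef0 by (intro sum.cong) auto
    then show ?thesis using that by simp
  qed
  have PEj: "P o\<^sub>L E j = f j" if "j < n" for j using projection_swap[OF EP PP EjP[OF that] f'(2)] .
  have Pf: "P o\<^sub>L f j = f j" if "j < n" for j
    using EjP[OF that] PEj[OF that] P'(3) by (metis op_assoc)
  have DP: "D o\<^sub>L P = L" by (simp add: D_def L_def op_sum_left op_scaleR_left EjP)
  have PD: "P o\<^sub>L D = L" by (simp add: D_def L_def op_sum_right op_scaleR_right PEj)
  have PL: "P o\<^sub>L L = L" by (simp add: L_def op_sum_right op_scaleR_right Pf)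
  have corner: "(Q - P) o\<^sub>L a o\<^sub>L (Q - P) = (Q - P) o\<^sub>L b o\<^sub>L (Q - P)"
  proof -
    have QQP: "Q o\<^sub>L (Q - P) = Q - P" "(Q - P) o\<^sub>L Q = Q - P"
      by (simp_all add: op_diff_left op_diff_right Q' QP PQ)
    have "(Q - P) o\<^sub>L b o\<^sub>L (Q - P) = ((Q - P) o\<^sub>L Q) o\<^sub>L a o\<^sub>L (Q o\<^sub>L (Q - P))"
      unfolding b_def by (simp only: op_assoc)
    then show ?thesis unfolding QQP by simp
  qed
  \<comment> \<open>Compressing \<open>b\<close> to \<open>Q - P\<close> removes
    \<open>b P + P b - P b P\<close>, and the three terms contributed by \<open>D\<close> combine to
    exactly one \<open>L\<close>.\<close>
  have rem: "remainder a Q n f l = (R o\<^sub>L P) + (P o\<^sub>L R) - (P o\<^sub>L (R o\<^sub>L P))"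
  proof -
    have "(Q - P) o\<^sub>L b o\<^sub>L (Q - P) = b - (b o\<^sub>L P) - (P o\<^sub>L b) + (P o\<^sub>L (b o\<^sub>L P))"
      by (simp add: op_diff_left op_diff_right Qb bQ op_assoc)
    moreover have "R o\<^sub>L P = (b o\<^sub>L P) - L" "P o\<^sub>L R = (P o\<^sub>L b) - L"
      "P o\<^sub>L (R o\<^sub>L P) = (P o\<^sub>L (b o\<^sub>L P)) - L"
      by (simp_all add: R_def op_diff_left op_diff_right DP PD PL)
    ultimately show ?thesis
      unfolding remainder_def P_def[symmetric] L_def[symmetric] corner b_def[symmetric] by simp
  qed
  have PJ: "P \<in> J" by (intro FI_J PF_FI PPF)
  have FI1: "R o\<^sub>L P \<in> FI M \<tau>" "P o\<^sub>L R \<in> FI M \<tau>" "P o\<^sub>L (R o\<^sub>L P) \<in> FI M \<tau>"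
    using FI_compose_PF[OF PPF RM M_id] FI_compose_PF[OF PPF M_id RM]
      FI_compose_PF[OF PPF M_id M_compose[OF RM P'(1)]] by simp_all
  have r1: "\<Phi> (R o\<^sub>L P) \<le> 2 * norm R * \<Phi> P" and r2: "\<Phi> (P o\<^sub>L R) \<le> 2 * norm R * \<Phi> P"
    using \<Phi>_mult_le[OF RM PJ] by auto
  have r3: "\<Phi> (P o\<^sub>L (R o\<^sub>L P)) \<le> 4 * norm R * \<Phi> P"
  proof -
    have "\<Phi> (P o\<^sub>L (R o\<^sub>L P)) \<le> 2 * norm P * \<Phi> (R o\<^sub>L P)"
      by (rule \<Phi>_mult_le(1)[OF P'(1) FI_J[OF FI1(1)]])
    also have "\<dots> \<le> 2 * 1 * \<Phi> (R o\<^sub>L P)"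
      using norm_projection_le[OF PP] \<Phi>_nonneg[OF FI_J[OF FI1(1)]]
      by (intro mult_right_mono mult_left_mono) auto
    finally show ?thesis using r1 by simp
  qed
  have "\<Phi> (remainder a Q n f l) \<le> \<Phi> (R o\<^sub>L P) + \<Phi> (P o\<^sub>L R) + \<Phi> (P o\<^sub>L (R o\<^sub>L P))"
    unfolding rem using \<Phi>_triangle_diff[OF J_add[OF FI1(1,2)[THEN FI_J]] FI_J[OF FI1(3)]]
      \<Phi>_triangle[OF FI1(1,2)[THEN FI_J]] by linarith
  \<comment> \<open>Here 8 is 2 + 2 + 4, the last from two applications of
    \<open>\<Phi>_mult_le\<close>.\<close>
  also have "\<dots> \<le> 8 * (norm R * \<Phi> P)" using r1 r2 r3 by simp
  also have "\<dots> \<le> 8 * ((\<beta> / 2 ^ m) * (C + \<eta> * (2 ^ m * t)))"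
  proof (intro mult_left_mono mult_mono)
    have "norm R \<le> norm b / 2 ^ m" using approx by (simp add: R_def D_def n_def)
    also have "\<dots> \<le> \<beta> / 2 ^ m" by (simp add: \<beta>_def divide_right_mono)
    finally show "norm R \<le> \<beta> / 2 ^ m" .
    have "enn2real (\<tau> P) \<le> enn2real (of_nat n * \<tau> e)" using Ptr nfin by (intro enn2real_mono) auto
    also have "\<dots> = real n * t"
      by (simp only: enn2real_mult t_def ennreal_of_nat_eq_real_of_nat enn2real_ennreal of_nat_0_le_iff)
    also have "real n = 2 ^ m" by (simp add: n_def)
    finally have "\<eta> * enn2real (\<tau> P) \<le> \<eta> * (2 ^ m * t)" using \<eta>0 by (intro mult_left_mono) auto
    then show "\<Phi> P \<le> C + \<eta> * (2 ^ m * t)" using C(2)[OF PPF] by linarith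
  qed (use \<beta>0 \<Phi>_nonneg[OF PJ] in auto)
  also have "\<dots> = 8 * \<beta> * C / 2 ^ m + 8 * \<beta> * \<eta> * t"
    by (simp add: field_simps)
  also have "\<dots> \<le> \<delta> / 2 + \<delta> / 2"
  proof (rule add_mono)
    have "16 * \<beta> * C < 2 ^ m * \<delta>" using m \<delta> by (simp add: pos_divide_less_eq)
    then show "8 * \<beta> * C / 2 ^ m \<le> \<delta> / 2" by (simp add: field_simps)
    have "8 * \<beta> * (\<delta> / (16 * \<beta> * s)) * t = (\<delta> / 2) * (t / s)" if "s > 0" for s
      using that \<beta>0 by (simp add: divide_simps)
    then have "8 * \<beta> * \<eta> * t = (\<delta> / 2) * (t / (t + 1))" using t0 by (simp add: \<eta>_def)
    also have "\<dots> \<le> (\<delta> / 2) * 1" using \<delta> t0 by (intro mult_left_mono) auto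
    finally show "8 * \<beta> * \<eta> * t \<le> \<delta> / 2" by simp
  qed
  finally have \<Phi>rem: "\<Phi> (remainder a Q n f l) \<le> \<delta>" by simp
  have remFI: "remainder a Q n f l \<in> FI M \<tau>" unfolding rem by (intro FI_diff FI_add FI1)
  have lb: "\<bar>l j\<bar> \<le> norm a" for j
  proof -
    have "0 \<le> norm b / 2 ^ m" by simp
    then show ?thesis using l[of j] nb by linarith
  qed
  have "(Q - P) o\<^sub>L e = 0" by (simp add: op_diff_left Pe)
  then have "diagonal_block a Q e \<delta> n f l"
    unfolding diagonal_block_def using f lb Qf ff0 remFI \<Phi>rem by (auto simp: P_def)
  then show ?thesis by blast
qed

end

section \<open>Summing the blocks\<close>

text \<open>Pythagoras gives a bound independent of the number of terms. It is stated at one vector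
  so that it can be applied to \<open>Q k x\<close>, which is small.\<close>

lemma (in von_neumann) norm_orthogonal_combination_le:
  assumes B: "finite B" and g: "\<And>i. i \<in> B \<Longrightarrow> g i \<in> projections M"
    and orth: "\<And>i j. i \<in> B \<Longrightarrow> j \<in> B \<Longrightarrow> i \<noteq> j \<Longrightarrow> g i o\<^sub>L g j = 0"
    and c: "\<And>i. i \<in> B \<Longrightarrow> \<bar>c i\<bar> \<le> C" and C: "C \<ge> 0"
  shows "norm (\<Sum>i\<in>B. c i *\<^sub>R g i y) \<le> C * norm y"
proof (rule power2_le_imp_le)
  have o: "inner (g i y) (g j y) = 0" if "i \<in> B" "j \<in> B" "i \<noteq> j" for i j
  proof -
    have "inner (g i y) (g j y) = inner y ((g i o\<^sub>L g j) y)"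
      using self_adjoint_inner[OF projectionsD(2)[OF g[OF that(1)]]] by simp
    then show ?thesis using orth[OF that] by simp
  qed
  have pw: "pairwise (\<lambda>i j. orthogonal (d i *\<^sub>R g i y) (d j *\<^sub>R g j y)) B" for d
    using o by (auto simp: pairwise_def orthogonal_def)
  have "(norm (\<Sum>i\<in>B. c i *\<^sub>R g i y))\<^sup>2 = (\<Sum>i\<in>B. (norm (c i *\<^sub>R g i y))\<^sup>2)"
    by (rule norm_sum_Pythagorean[OF B pw])
  also have "\<dots> \<le> (\<Sum>i\<in>B. C\<^sup>2 * (norm (1 *\<^sub>R g i y))\<^sup>2)"
    using c by (intro sum_mono) (auto simp: power_mult_distrib abs_le_square_iff[symmetric] C intro!: mult_right_mono)
  also have "\<dots> = C\<^sup>2 * (norm (\<Sum>i\<in>B. 1 *\<^sub>R g i y))\<^sup>2"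
    unfolding norm_sum_Pythagorean[OF B pw] sum_distrib_left ..
  also have "(\<Sum>i\<in>B. 1 *\<^sub>R g i y) = (\<Sum>i\<in>B. g i) y" by (simp add: blinfun.sum_left)
  also have "C\<^sup>2 * (norm ((\<Sum>i\<in>B. g i) y))\<^sup>2 \<le> C\<^sup>2 * (norm y)\<^sup>2"
    using blinfun_contraction[OF norm_projection_le[OF projections_sum[OF B g orth]]]
    by (intro mult_left_mono power_mono) auto
  finally show "(norm (\<Sum>i\<in>B. c i *\<^sub>R g i y))\<^sup>2 \<le> (C * norm y)\<^sup>2" by (simp add: power_mult_distrib)
  show "0 \<le> C * norm y" using C by simp
qed

context normed_ideal
begin

text \<open>The remainders add up in \<open>\<Phi>\<close> to \<open>\<sigma>\<close>, while the
  corner of \<open>a\<close> under \<open>Q n\<close> tends to 0 strongly because \<open>Q n\<close>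
  does. The telescoped identity thus makes the diagonal parts converge strongly to
  \<open>a - \<sigma>\<close>.\<close>

theorem weyl_von_neumann:
  assumes cd: "countably_decomposable M" and inf: "properly_infinite M"
    and ratio: "ratio_tends_to_zero M \<tau> \<Phi>"
    and a: "a \<in> M" "self_adjoint a" and \<epsilon>: "\<epsilon> > 0"
  shows "\<exists>d. diagonal_operator M d \<and> a - d \<in> norm_ideal_closure M \<tau> J \<Phi> \<and> \<Phi> (a - d) \<le> \<epsilon>"
proof -
  obtain e where ePF: "\<And>n. e n \<in> PF M \<tau>" and exh: "exhausting e"
    using exhausting_sequence[OF cd] by metis
  \<comment> \<open>Block data are chosen for every \<open>Q\<close> at once, as a triple, so that
    the sequence of corners can be defined by primitive recursion.\<close>
  define B where "B k Q = (SOME p. diagonal_block a Q (e k) (\<epsilon> / 2 ^ Suc k) (fst p) (fst (snd p)) (snd (snd p)))"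
    for k Q
  define N' where "N' k Q = fst (B k Q)" for k Q
  define f' where "f' k Q = fst (snd (B k Q))" for k Q
  define l' where "l' k Q = snd (snd (B k Q))" for k Q
  have block': "diagonal_block a Q (e k) (\<epsilon> / 2 ^ Suc k) (N' k Q) (f' k Q) (l' k Q)"
    if Q: "Q \<in> projections M" for k Q
  proof -
    have "\<epsilon> / 2 ^ Suc k > 0" using \<epsilon> by simp
    from diagonal_block_exists[OF cd inf ratio a Q ePF this] obtain n f l where
      "diagonal_block a Q (e k) (\<epsilon> / 2 ^ Suc k) n f l" by blast
    then have "diagonal_block a Q (e k) (\<epsilon> / 2 ^ Suc k) (fst (n, f, l)) (fst (snd (n, f, l))) (snd (snd (n, f, l)))"
      by simp
    then show ?thesis unfolding N'_def f'_def l'_def B_def by (rule someI)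
  qed
  define Q where "Q = rec_nat id_blinfun (\<lambda>k q. q - (\<Sum>j<N' k q. f' k q j))"
  define N where "N k = N' k (Q k)" for k
  define f where "f k = f' k (Q k)" for k
  define l where "l k = l' k (Q k)" for k
  define P where "P k = (\<Sum>j<N k. f k j)" for k
  have Q0: "Q 0 = id_blinfun" and QS: "Q (Suc k) = Q k - P k" for k
    by (simp_all add: Q_def P_def N_def f_def)
  have blockP: "Q k \<in> projections M \<Longrightarrow> diagonal_block a (Q k) (e k) (\<epsilon> / 2 ^ Suc k) (N k) (f k) (l k)" for k
    unfolding N_def f_def l_def by (rule block')
  have PP': "P k \<in> projections M" "Q k o\<^sub>L P k = P k" if "Q k \<in> projections M" for k
    using blockP[OF that] unfolding diagonal_block_def P_def
    by (auto simp: op_sum_right intro!: projections_sum)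
  \<comment> \<open>Blocks are available only for projections, so this induction has to precede any
    use of their properties.\<close>
  have QP: "Q k \<in> projections M" for k
    by (induction k) (simp_all add: Q0 QS projections_diff PP')
  note Q' = projectionsD[OF QP]
  note block = blockP[OF QP, unfolded diagonal_block_def P_def[symmetric]]
  have fP: "f k j \<in> projections M" and lb: "\<bar>l k j\<bar> \<le> norm a" and Qf: "Q k o\<^sub>L f k j = f k j"
    if "j < N k" for k j
    using block[of k] that by auto
  have ff: "f k i o\<^sub>L f k j = 0" if "i < N k" "j < N k" "i \<noteq> j" for k i j
    using block[of k] that by auto
  have Qe: "Q (Suc k) o\<^sub>L e k = 0" for k using block[of k] by (simp add: QS)
  define \<kappa> where "\<kappa> k = remainder a (Q k) (N k) (f k) (l k)" for k
  have \<kappa>FI: "\<kappa> k \<in> FI M \<tau>" and \<kappa>\<Phi>: "\<Phi> (\<kappa> k) \<le> \<epsilon> / 2 ^ Suc k" for k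
    using block[of k] by (simp_all add: \<kappa>_def)
  define L where "L k = (\<Sum>j<N k. l k j *\<^sub>R f k j)" for k
  have \<kappa>eq: "\<kappa> k = (Q k o\<^sub>L a o\<^sub>L Q k) - (Q (Suc k) o\<^sub>L a o\<^sub>L Q (Suc k)) - L k" for k
    by (simp add: \<kappa>_def remainder_def QS P_def L_def)
  have dec: "Q k o\<^sub>L Q (Suc k) = Q (Suc k)" for k
    by (simp add: QS op_diff_right Q' PP'[OF QP])
  have dec': "Q (k + i) o\<^sub>L Q k = Q (k + i)" for k i
  proof (induction i)
    case (Suc i)
    have "Q (Suc (k + i)) o\<^sub>L Q (k + i) = Q (Suc (k + i))"
      using projection_swap[OF QP QP dec Q'(2)] .
    then have "Q (Suc (k + i)) o\<^sub>L Q k = Q (Suc (k + i)) o\<^sub>L (Q (k + i) o\<^sub>L Q k)"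
      by (simp add: op_assoc[symmetric])
    also have "\<dots> = Q (Suc (k + i))"
      using projection_swap[OF QP QP dec Q'(2), of "k + i"] by (simp add: Suc)
    finally show ?case by simp
  qed (simp add: Q')
  have Qe': "Q n o\<^sub>L e i = 0" if i: "i < n" for i n
  proof -
    obtain k where n: "n = Suc i + k" using less_imp_Suc_add[OF i] by auto
    have "Q n o\<^sub>L e i = Q n o\<^sub>L (Q (Suc i) o\<^sub>L e i)"
      using dec'[of "Suc i" k] by (simp add: n op_assoc[symmetric])
    then show ?thesis by (simp add: Qe)
  qed
  have Qlim: "(\<lambda>n. Q n x) \<longlonglongrightarrow> 0" for x
    by (rule decreasing_projections_tendsto_0[where Q = Q, OF QP dec Qe' exh])
  have Qlim': "(\<lambda>n. (Q n o\<^sub>L a o\<^sub>L Q n) x) \<longlonglongrightarrow> 0" for x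
  proof (rule tendsto_norm_zero_cancel, rule tendsto_sandwich[OF _ _ tendsto_const])
    show "(\<lambda>n. norm a * norm (Q n x)) \<longlonglongrightarrow> 0"
      using tendsto_mult_right_zero[OF tendsto_norm_zero[OF Qlim[of x]], of "norm a"] .
    have "norm ((Q n o\<^sub>L a o\<^sub>L Q n) x) \<le> norm a * norm (Q n x)" for n
      using blinfun_contraction[OF norm_projection_le[OF QP], of n "a (Q n x)"] norm_blinfun[of a "Q n x"]
      by simp
    then show "\<forall>\<^sub>F n in sequentially. norm ((Q n o\<^sub>L a o\<^sub>L Q n) x) \<le> norm a * norm (Q n x)" by simp
  qed simp
  define K where "K n = (\<Sum>k<n. \<kappa> k)" for n
  have KFI: "K n \<in> FI M \<tau>" for n unfolding K_def by (intro FI_sum \<kappa>FI)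
  have KJ: "K n \<in> J" for n by (rule FI_J[OF KFI])
  \<comment> \<open>Telescoping, starting from \<open>Q 0 = 1\<close>.\<close>
  have Ksum: "(\<Sum>k<n. L k) = a - (Q n o\<^sub>L a o\<^sub>L Q n) - K n" for n
    by (induction n) (simp_all add: K_def Q0 \<kappa>eq)
  \<comment> \<open>A geometric sum of the tolerances; from index 0 it bounds all partial sums by
    \<open>\<epsilon>\<close>.\<close>
  have Kd: "\<Phi> (K (n + k) - K n) \<le> \<epsilon> / 2 ^ n - \<epsilon> / 2 ^ (n + k)" for n k
  proof (induction k)
    case (Suc k)
    have e: "K (n + Suc k) - K n = (K (n + k) - K n) + \<kappa> (n + k)" by (simp add: K_def)
    have "\<Phi> (K (n + Suc k) - K n) \<le> \<Phi> (K (n + k) - K n) + \<Phi> (\<kappa> (n + k))"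
      unfolding e by (rule \<Phi>_triangle[OF J_diff[OF KJ KJ] FI_J[OF \<kappa>FI]])
    then show ?case using Suc \<kappa>\<Phi>[of "n + k"] by simp
  qed simp
  have Kd': "\<Phi> (K m - K n) \<le> \<epsilon> / 2 ^ n" if "n \<le> m" for m n
  proof -
    have "0 \<le> \<epsilon> / 2 ^ m" using \<epsilon> by simp
    then show ?thesis using Kd[of n "m - n"] that by simp
  qed
  have CK: "\<exists>N. \<forall>m\<ge>N. \<forall>n\<ge>N. \<Phi> (K m - K n) < r" if "r > 0" for r
  proof -
    obtain N :: nat where N: "\<epsilon> / r < 2 ^ N" using real_arch_pow[of 2 "\<epsilon> / r"] by auto
    have "\<epsilon> / 2 ^ n < r" if "n \<ge> N" for n
    proof -
      have "\<epsilon> / r < 2 ^ n" by (rule less_le_trans[OF N power_increasing[OF that]]) simp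
      then show ?thesis using \<open>r > 0\<close> by (simp add: field_simps)
    qed
    then have "\<Phi> (K m - K n) < r" if "n \<ge> N" "m \<ge> N" for m n
      using that Kd'[of n m] Kd'[of m n] \<Phi>_minus_commute[OF KJ KJ, of m n]
      by (metis linorder_le_cases order_le_less_trans)
    then show ?thesis by blast
  qed
  have "complete_wrt J \<Phi>" using ni by (simp add: norm_ideal_def)
  then obtain \<sigma> where \<sigma>J: "\<sigma> \<in> J" and \<sigma>: "(\<lambda>n. \<Phi> (K n - \<sigma>)) \<longlonglongrightarrow> 0"
    unfolding complete_wrt_def using KJ CK by blast
  define d where "d = a - \<sigma>"
  have ad: "a - d = \<sigma>" by (simp add: d_def)
  have closure: "\<sigma> \<in> norm_ideal_closure M \<tau> J \<Phi>"
    unfolding norm_ideal_closure_def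
  proof (intro CollectI conjI allI impI \<sigma>J)
    fix r :: real assume "r > 0"
    then obtain n where "\<bar>\<Phi> (K n - \<sigma>)\<bar> < r" using LIMSEQ_D[OF \<sigma>, of r] by auto
    then have "\<Phi> (\<sigma> - K n) < r" using \<Phi>_minus_commute[OF KJ \<sigma>J, of n] by simp
    then show "\<exists>f\<in>FI M \<tau>. \<Phi> (\<sigma> - f) < r" using KFI by blast
  qed
  have bound: "\<Phi> \<sigma> \<le> \<epsilon>"
  proof (rule LIMSEQ_le_const)
    show "(\<lambda>n. \<epsilon> + \<Phi> (K n - \<sigma>)) \<longlonglongrightarrow> \<epsilon>" using tendsto_add[OF tendsto_const \<sigma>] by simp
    have "\<Phi> \<sigma> \<le> \<epsilon> + \<Phi> (K n - \<sigma>)" for n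
      using \<Phi>_triangle_diff[OF KJ J_diff[OF KJ \<sigma>J], of n n] Kd'[of 0 n] by (simp add: K_def)
    then show "\<exists>N. \<forall>n\<ge>N. \<Phi> \<sigma> \<le> \<epsilon> + \<Phi> (K n - \<sigma>)" by blast
  qed
  \<comment> \<open>\<open>\<Phi>\<close> dominates a multiple of the operator norm, so convergence
    in \<open>\<Phi>\<close> implies strong convergence.\<close>
  have Klim: "(\<lambda>n. K n x) \<longlonglongrightarrow> \<sigma> x" for x
  proof -
    obtain c where c: "c > 0" "\<And>y. y \<in> J \<Longrightarrow> c * norm y \<le> \<Phi> y"
      using ni unfolding norm_ideal_def by blast
    have "(\<lambda>n. K n x - \<sigma> x) \<longlonglongrightarrow> 0"
    proof (rule tendsto_norm_zero_cancel, rule tendsto_sandwich[OF _ _ tendsto_const])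
      show "(\<lambda>n. \<Phi> (K n - \<sigma>) * (norm x / c)) \<longlonglongrightarrow> 0"
        by (rule tendsto_mult_left_zero[OF \<sigma>])
      have "norm (K n x - \<sigma> x) \<le> \<Phi> (K n - \<sigma>) * (norm x / c)" for n
      proof -
        have "norm (K n x - \<sigma> x) \<le> norm (K n - \<sigma>) * norm x"
          using norm_blinfun[of "K n - \<sigma>" x] by (simp add: blinfun.diff_left)
        also have "\<dots> \<le> (\<Phi> (K n - \<sigma>) / c) * norm x"
          using c(1) c(2)[OF J_diff[OF KJ \<sigma>J], of n] by (intro mult_right_mono) (simp_all add: field_simps)
        finally show ?thesis by simp
      qed
      then show "\<forall>\<^sub>F n in sequentially. norm (K n x - \<sigma> x) \<le> \<Phi> (K n - \<sigma>) * (norm x / c)" by simp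
    qed simp
    then show ?thesis by (simp add: LIM_zero_iff)
  qed
  have Llim: "(\<lambda>n. (\<Sum>k<n. L k) x) \<longlonglongrightarrow> d x" for x
    using tendsto_diff[OF tendsto_diff[OF tendsto_const[of "a x"] Qlim'[of x]] Klim[of x]]
    unfolding Ksum by (simp add: blinfun.diff_left d_def)
  \<comment> \<open>All blocks are merged into one sequence by the pairing of naturals; pairs beyond
    the length of a block get the projection 0.\<close>
  define g where "g i = (case prod_decode i of (k, j) \<Rightarrow> if j < N k then f k j else 0)" for i
  define c where "c i = (case prod_decode i of (k, j) \<Rightarrow> if j < N k then l k j else 0)" for i
  have gP: "g i \<in> projections M" for i by (auto simp: g_def fP split: prod.split)
  have cb: "\<bar>c i\<bar> \<le> norm a" for i by (auto simp: c_def lb split: prod.split)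
  have Qg: "Q k o\<^sub>L g i = g i" if "k \<le> fst (prod_decode i)" for k i
  proof -
    obtain m j where mj: "prod_decode i = (m, j)" by fastforce
    with that obtain t where t: "m = k + t" using le_Suc_ex by auto
    have "Q k o\<^sub>L Q m = Q m" using projection_swap[OF QP QP dec' Q'(2), of k t] t by simp
    then have "Q k o\<^sub>L f m j = f m j" if "j < N m" using Qf[OF that] by (metis op_assoc)
    then show ?thesis by (simp add: g_def mj)
  qed
  have gQ: "g i o\<^sub>L Q k = g i" if "k \<le> fst (prod_decode i)" for k i
    using projection_swap[OF QP gP Qg[OF that] projectionsD(2)[OF gP]] .
  have fQ0: "f k j o\<^sub>L Q (Suc k) = 0" if "j < N k" for k j
  proof -
    have "f k j o\<^sub>L P k = (\<Sum>i<N k. if i = j then f k j else 0)"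
      unfolding P_def op_sum_right using that ff projectionsD(3)[OF fP] by (intro sum.cong) auto
    then have "f k j o\<^sub>L P k = f k j" using that by simp
    moreover have "f k j o\<^sub>L Q k = f k j"
      using projection_swap[OF QP fP[OF that] Qf[OF that] projectionsD(2)[OF fP[OF that]]] .
    ultimately show ?thesis by (simp add: QS op_diff_right)
  qed
  \<comment> \<open>Later blocks lie under \<open>Q (Suc k)\<close>, which the members of block
    \<open>k\<close> annihilate.\<close>
  have gg_less: "g m o\<^sub>L g n = 0" if "fst (prod_decode m) < fst (prod_decode n)" for m n
  proof -
    obtain k j where kj: "prod_decode m = (k, j)" by fastforce
    have "g n = Q (Suc k) o\<^sub>L g n" using Qg[of "Suc k" n] that kj by simp
    then have "g m o\<^sub>L g n = (g m o\<^sub>L Q (Suc k)) o\<^sub>L g n" by (metis op_assoc)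
    moreover have "g m o\<^sub>L Q (Suc k) = 0" by (simp add: g_def kj fQ0)
    ultimately show ?thesis by simp
  qed
  have gg: "g m o\<^sub>L g n = 0" if "m \<noteq> n" for m n
  proof -
    obtain k j k' j' where d: "prod_decode m = (k, j)" "prod_decode n = (k', j')" by fastforce
    have ne: "(k, j) \<noteq> (k', j')" using that d by (metis prod_decode_inverse)
    consider "k < k'" | "k' < k" | "k = k'" by linarith
    then show ?thesis
    proof cases
      case 1 then show ?thesis using gg_less d by simp
    next
      case 2
      then have "g n o\<^sub>L g m = 0" using gg_less d by simp
      then show ?thesis by (rule projection_swap[OF gP gP _ self_adjoint_0])
    next
      case 3 then show ?thesis using ne by (simp add: g_def d ff)
    qed
  qed
  \<comment> \<open>The enumeration does not respect the order of the blocks. Once the first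
    \<open>k\<close> blocks are complete, a partial sum differs from
    \<open>(\<Sum>m<k. L m) x\<close> only by terms of later blocks. These see \<open>x\<close> only
    through \<open>Q k x\<close>, so \<open>norm_orthogonal_combination_le\<close> bounds them
    uniformly.\<close>
  have sums: "(\<lambda>n. complex_of_real (c n) *\<^sub>C g n x) sums d x" for x
  proof -
    have "(\<lambda>n. \<Sum>i<n. c i *\<^sub>R g i x) \<longlonglongrightarrow> d x"
    proof (rule LIMSEQ_I)
      fix r :: real assume r: "r > 0"
      \<comment> \<open>\<open>norm a\<close> may be 0, so the tolerance for \<open>Q n x\<close> is
        divided by \<open>norm a + 1\<close>.\<close>
      have n1: "norm a + 1 > 0" by (simp add: add_nonneg_pos)
      obtain N1 where N1: "\<And>n. n \<ge> N1 \<Longrightarrow> norm ((\<Sum>k<n. L k) x - d x) < r / 2"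
        using LIMSEQ_D[OF Llim[of x], of "r / 2"] r by auto
      obtain N2 where N2: "\<And>n. n \<ge> N2 \<Longrightarrow> norm (Q n x) < r / 2 / (norm a + 1)"
        using LIMSEQ_D[OF Qlim[of x], of "r / 2 / (norm a + 1)"] r n1 by auto
      define k where "k = max N1 N2"
      define I where "I = prod_encode ` (SIGMA i:{..<k}. {..<N i})"
      have "finite I" by (simp add: I_def)
      then obtain n0 where n0: "\<forall>i\<in>I. i < n0"
        unfolding finite_nat_set_iff_bounded by blast
      have "norm ((\<Sum>i<n. c i *\<^sub>R g i x) - d x) < r" if "n \<ge> n0" for n
      proof -
        define A where "A = {i. i < n \<and> fst (prod_decode i) < k}"
        define B where "B = {i. i < n \<and> k \<le> fst (prod_decode i)}"
        have fin: "finite A" "finite B" by (simp_all add: A_def B_def)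
        have AB: "{..<n} = A \<union> B" "A \<inter> B = {}" by (auto simp: A_def B_def)
        have IA: "I \<subseteq> A"
        proof
          fix i assume i: "i \<in> I"
          then have "i < n" using n0 that by fastforce
          then show "i \<in> A" using i by (auto simp: I_def A_def)
        qed
        \<comment> \<open>Indices in \<open>A\<close> outside \<open>I\<close> have a second
          component beyond the length of their block, hence coefficient 0.\<close>
        have "(\<Sum>i\<in>A. c i *\<^sub>R g i x) = (\<Sum>i\<in>I. c i *\<^sub>R g i x)"
        proof (rule sum.mono_neutral_right[OF fin(1) IA], rule ballI)
          fix i assume i: "i \<in> A - I"
          obtain m j where mj: "prod_decode i = (m, j)" by fastforce
          then have "i = prod_encode (m, j)" by (metis prod_decode_inverse)
          then have "\<not> j < N m" using i mj by (auto simp: I_def A_def)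
          then show "c i *\<^sub>R g i x = 0" by (simp add: c_def mj)
        qed
        also have "\<dots> = (\<Sum>(m, j)\<in>(SIGMA i:{..<k}. {..<N i}). l m j *\<^sub>R f m j x)"
          unfolding I_def
          by (subst sum.reindex[OF inj_prod_encode]) (auto simp: c_def g_def intro!: sum.cong)
        also have "\<dots> = (\<Sum>m<k. \<Sum>j<N m. l m j *\<^sub>R f m j x)"
          by (subst sum.Sigma) auto
        also have "\<dots> = (\<Sum>m<k. L m) x"
          by (simp add: L_def blinfun.sum_left blinfun.scaleR_left)
        finally have A: "norm ((\<Sum>i\<in>A. c i *\<^sub>R g i x) - d x) < r / 2" using N1[of k] by (simp add: k_def)
        have "(\<Sum>i\<in>B. c i *\<^sub>R g i x) = (\<Sum>i\<in>B. c i *\<^sub>R g i (Q k x))"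
        proof (rule sum.cong)
          fix i assume "i \<in> B"
          then have "g i o\<^sub>L Q k = g i" using gQ by (simp add: B_def)
          then show "c i *\<^sub>R g i x = c i *\<^sub>R g i (Q k x)" by (metis blinfun_apply_blinfun_compose)
        qed simp
        also have "norm \<dots> \<le> norm a * norm (Q k x)"
          by (rule norm_orthogonal_combination_le) (use fin gP gg cb in auto)
        also have "\<dots> \<le> (norm a + 1) * norm (Q k x)" by (intro mult_right_mono) auto
        also have "\<dots> < r / 2" using N2[of k] n1 by (simp add: k_def pos_less_divide_eq algebra_simps)
        finally have B: "norm (\<Sum>i\<in>B. c i *\<^sub>R g i x) < r / 2" .
        have split: "(\<Sum>i<n. c i *\<^sub>R g i x) - d x = ((\<Sum>i\<in>A. c i *\<^sub>R g i x) - d x) + (\<Sum>i\<in>B. c i *\<^sub>R g i x)"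
          unfolding AB(1) sum.union_disjoint[OF fin AB(2)] by simp
        show ?thesis
          unfolding split
          using A B norm_triangle_ineq[of "(\<Sum>i\<in>A. c i *\<^sub>R g i x) - d x" "\<Sum>i\<in>B. c i *\<^sub>R g i x"]
          by linarith
      qed
      then show "\<exists>n0. \<forall>n\<ge>n0. norm ((\<Sum>i<n. c i *\<^sub>R g i x) - d x) < r" by blast
    qed
    then show ?thesis by (simp add: sums_def scaleR_scaleC)
  qed
  have "d \<in> M" unfolding d_def by (intro M_diff a J_M \<sigma>J)
  then have "diagonal_operator M d"
    unfolding diagonal_operator_def
    by (intro conjI exI[of _ g] exI[of _ "\<lambda>n. complex_of_real (c n)"] allI impI gP gg sums)
  then show ?thesis using closure bound unfolding ad[symmetric] by blast
qed

end

theorem theorem3p2p2: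
  fixes M :: "'h::complex_hilbert operator set"
    and \<tau> :: "'h operator \<Rightarrow> ennreal"
    and K\<^sub>\<Phi> :: "'h operator set"
    and \<Phi> :: "'h operator \<Rightarrow> real"
    and a :: "'h operator"
    and \<epsilon> :: real
  assumes "von_neumann_algebra M"
    and "countably_decomposable M"
    and "properly_infinite M"
    and "faithful_normal_semifinite_tracial_weight M \<tau>"
    and "norm_ideal M \<tau> K\<^sub>\<Phi> \<Phi>"
    and "ratio_tends_to_zero M \<tau> \<Phi>"
    and "a \<in> M"
    and "self_adjoint a"
    and "\<epsilon> > 0"
  shows "\<exists>d. diagonal_operator M d \<and>
           a - d \<in> norm_ideal_closure M \<tau> K\<^sub>\<Phi> \<Phi> \<and>
           \<Phi> (a - d) \<le> \<epsilon>"
proof -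
  interpret normed_ideal M \<tau> K\<^sub>\<Phi> \<Phi>
    by unfold_locales (fact assms)+
  show ?thesis using assms by (intro weyl_von_neumann)
qed

end
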